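(* Let $m\ge p\ge2$ and let $G:(\mathbb{R}^m,0)\to(\mathbb{R}^p,0)$ be a non-constant real analytic map germ with isolated critical value, i.e. $\operatorname{Disc}G=\{0\}$. Then $G$ satisfies the Milnor condition (b) at the origin if and only if there exists $\varepsilon_0>0$ such that for every $0<\varepsilon<\varepsilon_0$ there exists $\eta$, $0<\eta\ll\varepsilon$, such that the restriction map $$G_|:S^{m-1}_\varepsilon\cap G^{-1}(B^p_\eta\setminus\{0\})\to B^p_\eta\setminus\{0\}$$ is a smooth submersion.
   Context: A germ is identified with a representative $G:U\to\mathbb{R}^p$, $U\subseteq\mathbb{R}^m$ an open neighbourhood of $0$, $G(0)=0$. Put $V_G:=G^{-1}(0)$, $\operatorname{Sing}G:=\{x\in U:\operatorname{rank}\,dG(x)\text{ is not maximal}\}$, $\operatorname{Disc}G:=G(\operatorname{Sing}G)$; all sets are considered as germs at the origin. $S^{m-1}_\varepsilon\subset\mathbb{R}^m$ is the sphere of radius $\varepsilon$ centred at $0$ and $B^p_\eta\subset\mathbb{R}^p$ the open ball of radius $\eta$ centred at $0$. Milnor set (with $\rho(x)=\|x\|^2$): $M(G)$ is the set of $x\in U$ at which $G$ and $\rho$ are not transverse; equivalently, the set of $x\in U$ at which $\nabla\rho(x),\nabla G_1(x),\dots,\nabla G_p(x)$ are linearly dependent over $\mathbb{R}$. Milnor condition (b) at the origin: $\overline{M(G)\setminus V_G}\cap V_G\subseteq\{0\}$ as germs of sets at the origin. *)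

theory Defs
  imports "HOL-Analysis.Analysis"
begin

section \<open>Germs of sets at the origin\<close>

definition germ_subset :: "'a::real_normed_vector set \<Rightarrow> 'a set \<Rightarrow> bool" where
  "germ_subset A B \<longleftrightarrow> eventually (\<lambda>x. x \<in> A \<longrightarrow> x \<in> B) (nhds 0)"

definition germ_eq :: "'a::real_normed_vector set \<Rightarrow> 'a set \<Rightarrow> bool" where
  "germ_eq A B \<longleftrightarrow> germ_subset A B \<and> germ_subset B A"


section \<open>Real analytic and smooth maps\<close>

text \<open>Multi-indices are functions \<open>'m \<Rightarrow> nat\<close>; \<open>has_sum\<close> is unconditional (hence, for values in
  \<open>real ^ 'p\<close>, absolute) convergence of the power series.\<close>

definition real_analytic_on :: "(real^'m) set \<Rightarrow> (real^'m \<Rightarrow> real^'p) \<Rightarrow> bool" where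
  "real_analytic_on U f \<longleftrightarrow>
     (\<forall>x\<in>U. \<exists>r>0. \<exists>c :: ('m \<Rightarrow> nat) \<Rightarrow> real^'p. \<forall>y\<in>ball x r.
        ((\<lambda>\<alpha>. (\<Prod>i\<in>UNIV. (y $ i - x $ i) ^ \<alpha> i) *\<^sub>R c \<alpha>) has_sum f y) UNIV)"

text \<open>Only meant for open \<open>S\<close> and finite-dimensional domains, where it says that all directional
  derivatives are of class \<open>C\<^sup>k\<close>.\<close>

primrec Ck_on :: "nat \<Rightarrow> 'a::euclidean_space set \<Rightarrow> ('a \<Rightarrow> 'b::real_normed_vector) \<Rightarrow> bool" where
  "Ck_on 0 S f \<longleftrightarrow> continuous_on S f"
| "Ck_on (Suc k) S f \<longleftrightarrow>
     (\<forall>x\<in>S. f differentiable (at x)) \<and>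
     (\<forall>v. Ck_on k S (\<lambda>x. frechet_derivative f (at x) v))"

definition smooth_on :: "'a::euclidean_space set \<Rightarrow> ('a \<Rightarrow> 'b::real_normed_vector) \<Rightarrow> bool" where
  "smooth_on S f \<longleftrightarrow> (\<forall>k. Ck_on k S f)"


section \<open>Submersions between embedded submanifolds\<close>

definition tangent_space :: "'a::euclidean_space set \<Rightarrow> 'a \<Rightarrow> 'a set" where
  "tangent_space X x =
     {v. \<exists>\<delta>>0. \<exists>\<gamma> :: real \<Rightarrow> 'a. smooth_on {-\<delta><..<\<delta>} \<gamma> \<and> \<gamma> ` {-\<delta><..<\<delta>} \<subseteq> X \<and>
           \<gamma> 0 = x \<and> (\<gamma> has_vector_derivative v) (at 0)}"

text \<open>For embedded submanifolds \<open>X\<close>, \<open>Y\<close> of Euclidean spaces: \<open>f : X \<rightarrow> Y\<close> is smooth, i.e. locally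
  the restriction of a smooth map of the ambient space, and its differential maps each
  tangent space of \<open>X\<close> onto that of \<open>Y\<close>. The values of \<open>f\<close> outside \<open>X\<close> play no role.\<close>

definition smooth_submersion ::
  "'a::euclidean_space set \<Rightarrow> 'b::euclidean_space set \<Rightarrow> ('a \<Rightarrow> 'b) \<Rightarrow> bool" where
  "smooth_submersion X Y f \<longleftrightarrow> f ` X \<subseteq> Y \<and>
     (\<forall>x\<in>X. \<exists>W g. open W \<and> x \<in> W \<and> smooth_on W g \<and> (\<forall>y\<in>X \<inter> W. g y = f y) \<and>
        frechet_derivative g (at x) ` tangent_space X x = tangent_space Y (f x))"


section \<open>Sets attached to a map \<open>G\<close> on \<open>U\<close>\<close>

definition zero_locus :: "(real^'m) set \<Rightarrow> (real^'m \<Rightarrow> real^'p) \<Rightarrow> (real^'m) set" where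
  "zero_locus U G = {x \<in> U. G x = 0}"

definition Sing :: "(real^'m) set \<Rightarrow> (real^'m \<Rightarrow> real^'p) \<Rightarrow> (real^'m) set" where
  "Sing U G = {x \<in> U. rank (jacobian G (at x)) \<noteq> min CARD('m) CARD('p)}"

definition Disc :: "(real^'m) set \<Rightarrow> (real^'m \<Rightarrow> real^'p) \<Rightarrow> (real^'p) set" where
  "Disc U G = G ` Sing U G"

text \<open>\<open>Disc G = {0}\<close> as a property of the germ of \<open>G\<close>: the image of a germ of sets depends on the
  representative, so the equality is required for all sufficiently small ones.\<close>

definition isolated_critical_value :: "(real^'m) set \<Rightarrow> (real^'m \<Rightarrow> real^'p) \<Rightarrow> bool" where
  "isolated_critical_value U G \<longleftrightarrow>
     eventually (\<lambda>r. germ_eq (Disc (U \<inter> ball 0 r) G) {0}) (at_right 0)"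

definition nonconstant_germ :: "(real^'m \<Rightarrow> real^'p) \<Rightarrow> bool" where
  "nonconstant_germ G \<longleftrightarrow> \<not> eventually (\<lambda>x. G x = G 0) (nhds 0)"

definition gradient :: "(real^'m \<Rightarrow> real) \<Rightarrow> real^'m \<Rightarrow> real^'m" where
  "gradient f x = (\<chi> j. frechet_derivative f (at x) (axis j 1))"

text \<open>Linear dependence is that of the indexed family \<open>\<nabla>\<rho>, \<nabla>G\<^sub>1, \<dots>, \<nabla>G\<^sub>p\<close>, not of the set of its
  members, which would miss coinciding gradients.\<close>

definition Milnor_set :: "(real^'m) set \<Rightarrow> (real^'m \<Rightarrow> real^'p) \<Rightarrow> (real^'m) set" where
  "Milnor_set U G = {x \<in> U. \<exists>(a::real) (b::'p \<Rightarrow> real). (a \<noteq> 0 \<or> (\<exists>i. b i \<noteq> 0)) \<and>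
     a *\<^sub>R gradient (\<lambda>y. (norm y)\<^sup>2) x + (\<Sum>i\<in>UNIV. b i *\<^sub>R gradient (\<lambda>y. G y $ i) x) = 0}"

definition Milnor_condition_b :: "(real^'m) set \<Rightarrow> (real^'m \<Rightarrow> real^'p) \<Rightarrow> bool" where
  "Milnor_condition_b U G \<longleftrightarrow>
     germ_subset (closure (Milnor_set U G - zero_locus U G) \<inter> zero_locus U G) {0}"

end

theory Submission
  imports Defs "HOL-Computational_Algebra.Polynomial"
begin

text \<open>At a point \<open>x\<close> of the sphere of radius \<open>\<epsilon>\<close> with \<open>G x \<noteq> 0\<close>, the restriction of \<open>G\<close> to the sphere
  is a submersion iff \<open>x\<close> is not in the Milnor set \<open>M\<close>. So the right-hand side says that, for every small
  \<open>\<epsilon>\<close>, the norm of \<open>G\<close> is bounded away from \<open>0\<close> on \<open>{x \<in> M. norm x = \<epsilon> \<and> G x \<noteq> 0}\<close>. Condition (b) gives this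
  by compactness of the sphere. In the converse direction the bounds may depend on \<open>\<epsilon>\<close>, and the point is
  that they can be chosen as a power of \<open>\<epsilon>\<close>.

  To see this, consider systems of sign conditions on power series in \<open>(t, c, y)\<close> near the
  origin, and whether they have a solution \<open>y\<close> for given \<open>t, c\<close>. If \<open>K\<close> is large enough, the answer is the
  same for all \<open>(t, c)\<close> with \<open>0 < t < \<delta>\<close> and \<open>0 < c < t ^ K\<close>. This is shown by induction on the number of
  variables \<open>y\<close>: after the substitution \<open>c \<mapsto> t ^ K * c\<close> each series is a monomial in \<open>t, c\<close> times a series
  which does not vanish identically on \<open>t = c = 0\<close>; a shear makes the latter regular in one
  variable, Weierstrass preparation makes it a polynomial in that variable, and the variable is eliminated by the real
  elimination method of Cohen and Hoermander. Applied to the conditions \<open>norm x = t\<close>, \<open>x \<in> M\<close>,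
  \<open>0 < (norm (G x))\<^sup>2 < c\<close>, which for fixed \<open>t\<close> have no solution when \<open>c\<close> is small, this yields
  \<open>norm x ^ K \<le> (norm (G x))\<^sup>2\<close> on \<open>M\<close> off the zero locus, near the origin.\<close>

section \<open>Sign patterns of families of polynomials\<close>

text \<open>A priori the bound on a sphere could decay faster than every power of its radius. No
  decay rate is estimated: solvability is compared between parameters, so that one sphere with its
  own bound rules out solutions for all admissible \<open>(t, c)\<close>. That sphere must be
  smaller than a \<delta> not known beforehand, which is where bounds on all small spheres come in.
  Two needs shape the elimination. The sign conditions that it produces must live on the box of the
  prepared polynomials, so it uses only ring operations on the coefficients, with pseudo-remainders
  in place of division. And a solution near the origin must be carried to a solution inside a
  prescribed box. Hence signs are matched by an order automorphism of the line, which says where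
  each point goes, and the linear polynomials vanishing at the ends of the interval are added to the
  family. Every elimination may shrink \<delta> and raise \<open>K\<close>; both are existentially
  bound in the statement that is proved by induction.\<close>

lemma poly_sgn_at_top:
  fixes p :: "real poly"
  assumes "p \<noteq> 0"
  shows "\<exists>N. \<forall>y\<ge>N. sgn (poly p y) = sgn (lead_coeff p)"
proof (cases "lead_coeff p > 0")
  case True
  then obtain N where "\<forall>y\<ge>N. poly p y \<ge> lead_coeff p" using poly_pinfty_gt_lc by blast
  then have "\<forall>y\<ge>N. sgn (poly p y) = sgn (lead_coeff p)"
    using True by (metis order_less_le_trans sgn_1_pos)
  then show ?thesis ..
next
  case False
  then have "lead_coeff (-p) > 0" using assms by (auto simp: not_less order.order_iff_strict)
  then obtain N where "\<forall>y\<ge>N. poly (-p) y \<ge> lead_coeff (-p)" using poly_pinfty_gt_lc by blast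
  then have "sgn (poly p y) = sgn (lead_coeff p)" if "y \<ge> N" for y
    using \<open>lead_coeff (-p) > 0\<close> that by (smt (verit) lead_coeff_minus poly_minus sgn_1_neg)
  then show ?thesis by blast
qed

lemma poly_sgn_at_bot:
  fixes p :: "real poly"
  assumes "p \<noteq> 0"
  shows "\<exists>N. \<forall>y\<le>N. sgn (poly p y) = (-1) ^ degree p * sgn (lead_coeff p)"
proof -
  let ?q = "pcompose p [:0, -1:]"
  have "?q \<noteq> 0" using assms by (simp add: pcompose_eq_0_iff)
  moreover have "lead_coeff ?q = lead_coeff p * (-1) ^ degree p"
    by (subst lead_coeff_comp) auto
  ultimately obtain N where "\<forall>y\<ge>N. sgn (poly ?q y) = sgn (lead_coeff p * (-1) ^ degree p)"
    using poly_sgn_at_top by metis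
  then have "sgn (poly p y) = (-1) ^ degree p * sgn (lead_coeff p)" if "y \<le> -N" for y
    using that by (auto simp: poly_pcompose sgn_mult power_sgn dest!: spec[of _ "-y"])
  then show ?thesis by blast
qed

lemma poly_sgn_const:
  fixes p :: "real poly"
  assumes "\<And>z. min a b \<le> z \<Longrightarrow> z \<le> max a b \<Longrightarrow> poly p z \<noteq> 0"
  shows "sgn (poly p a) = sgn (poly p b)"
proof (rule ccontr)
  assume ne: "sgn (poly p a) \<noteq> sgn (poly p b)"
  have nz: "poly p a \<noteq> 0" "poly p b \<noteq> 0" using assms by auto
  then have neg: "poly p a * poly p b < 0"
    using ne by (auto simp: sgn_if mult_less_0_iff split: if_splits)
  have "a \<noteq> b" using ne by blast
  then have "\<exists>z. min a b \<le> z \<and> z \<le> max a b \<and> poly p z = 0"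
  proof (cases "a < b")
    case True
    then show ?thesis using poly_IVT[OF True neg] by (auto simp: min_def max_def intro: less_imp_le)
  next
    case False
    then have "b < a" using \<open>a \<noteq> b\<close> by simp
    moreover have "poly p b * poly p a < 0" using neg by (simp add: mult.commute)
    ultimately obtain z where "b < z" "z < a" "poly p z = 0" using poly_IVT by blast
    then show ?thesis by (auto simp: min_def intro!: exI[of _ z])
  qed
  then show False using assms by blast
qed

text \<open>Piecewise linear with nodes \<open>a\<close>, \<open>u\<close>, \<open>b\<close> sent to
  \<open>a\<close>, \<open>v\<close>, \<open>b\<close>; exchanging \<open>u\<close> and
  \<open>v\<close> gives the inverse. It serves to move the image of a single zero while everything
  outside one gap stays in place.\<close>

lemma bump_automorphism:
  fixes a b u v :: real
  assumes "a < u" "u < b" "a < v" "v < b"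
  shows "\<exists>\<tau>::real \<Rightarrow> real. strict_mono \<tau> \<and> surj \<tau> \<and> \<tau> u = v \<and> (\<forall>y. y \<le> a \<or> b \<le> y \<longrightarrow> \<tau> y = y)"
proof -
  define h where "h u v y =
    (if y \<le> a \<or> b \<le> y then y else if y \<le> u then a + (v - a) / (u - a) * (y - a)
     else b - (b - v) / (b - u) * (b - y))" for u v y :: real
  have rng: "a < h u v y \<and> h u v y < b \<and> (y \<le> u \<longrightarrow> h u v y \<le> v) \<and> (u < y \<longrightarrow> v < h u v y)"
    if "a < y" "y < b" "a < u" "u < b" "a < v" "v < b" for u v y
  proof (cases "y \<le> u")
    case True
    have "0 < (v - a) / (u - a) * (y - a)" using that by simp
    moreover have "(v - a) / (u - a) * (y - a) \<le> (v - a) / (u - a) * (u - a)"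
      using that True by (intro mult_left_mono) auto
    ultimately show ?thesis using that True by (auto simp: h_def)
  next
    case False
    have "0 < (b - v) / (b - u) * (b - y)" using that by simp
    moreover have "(b - v) / (b - u) * (b - y) < (b - v) / (b - u) * (b - u)"
      using that False by (intro mult_strict_left_mono) auto
    ultimately show ?thesis using that False by (auto simp: h_def)
  qed
  have inv: "h u v (h v u y) = y" if "a < u" "u < b" "a < v" "v < b" for u v y
  proof (cases "a < y \<and> y < b")
    case True
    then have "a < h v u y \<and> h v u y < b \<and> (y \<le> v \<longrightarrow> h v u y \<le> u) \<and> (v < y \<longrightarrow> u < h v u y)"
      using rng[of y v u] that by auto
    then show ?thesis using that True
      by (auto simp: h_def field_simps) 
  qed (auto simp: h_def)
  have "strict_mono (h u v)"
  proof (rule strict_monoI)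
    fix y z :: real assume yz: "y < z"
    consider "y \<le> a \<or> b \<le> y" | "a < y \<and> y < b \<and> (z \<le> a \<or> b \<le> z)" | "a < y" "y < b" "a < z" "z < b"
      by linarith
    then show "h u v y < h u v z"
    proof cases
      case 1
      then show ?thesis using yz rng[of z u v] assms by (cases "z \<le> a \<or> b \<le> z") (auto simp: h_def)
    next
      case 2
      then show ?thesis using yz rng[of y u v] assms by (auto simp: h_def)
    next
      case 3
      show ?thesis
      proof (cases "y \<le> u \<and> u < z")
        case True
        then show ?thesis using rng[of y u v] rng[of z u v] 3 assms by auto
      next
        case False
        then show ?thesis using 3 yz assms
          by (auto simp: h_def divide_strict_right_mono)
      qed
    qed
  qed
  moreover have "surj (h u v)" using inv assms by (metis surjI)
  moreover have "h u v u = v" using assms by (simp add: h_def)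
  moreover have "\<forall>y. y \<le> a \<or> b \<le> y \<longrightarrow> h u v y = y" by (simp add: h_def)
  ultimately show ?thesis by blast
qed

lemma poly_deriv_sgn_less:
  fixes p :: "real poly"
  assumes "a < b" "\<And>z. a < z \<Longrightarrow> z < b \<Longrightarrow> sgn (poly (pderiv p) z) = s" "s \<noteq> 0"
  shows "sgn (poly p b - poly p a) = s"
proof -
  obtain z where z: "a < z" "z < b" "poly p b - poly p a = (b - a) * poly (pderiv p) z"
    using poly_MVT[OF assms(1), of p] by blast
  then show ?thesis using assms by (simp add: sgn_mult)
qed

text \<open>\<open>Z\<close> contains the critical points of \<open>p\<close>, so \<open>p\<close>
  is strictly monotone on the gap of \<open>Z\<close> around \<zeta> and has opposite signs on its
  two sides. These signs carry over to \<open>q\<close> at the images of the ends, and the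
  intermediate value theorem gives \<open>\<zeta>'\<close>.\<close>

lemma matching_root:
  fixes p q :: "real poly" and \<sigma> :: "real \<Rightarrow> real"
  assumes \<sigma>: "strict_mono \<sigma>" "surj \<sigma>" and Z: "finite Z" "\<And>z. poly (pderiv p) z = 0 \<Longrightarrow> z \<in> Z"
    and eqZ: "\<And>z. z \<in> Z \<Longrightarrow> sgn (poly p z) = sgn (poly q (\<sigma> z))"
    and deg: "degree p = degree q" "degree p > 0" "sgn (lead_coeff p) = sgn (lead_coeff q)"
    and \<zeta>: "poly p \<zeta> = 0" "\<zeta> \<notin> Z"
  shows "\<exists>\<alpha> \<beta> \<zeta>'. \<alpha> < \<zeta> \<and> \<zeta> < \<beta> \<and> {\<alpha><..<\<beta>} \<inter> Z = {} \<and> \<sigma> \<alpha> < \<zeta>' \<and> \<zeta>' < \<sigma> \<beta> \<and> poly q \<zeta>' = 0"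
proof -
  define s where "s = sgn (poly (pderiv p) \<zeta>)"
  have s: "s \<noteq> 0" using Z(2)[of \<zeta>] \<zeta> by (auto simp: s_def sgn_0_0)
  have nz: "p \<noteq> 0" "q \<noteq> 0" using deg by auto
  have sg: "sgn (poly (pderiv p) w) = s" if "{min w \<zeta><..<max w \<zeta>} \<inter> Z = {}" "w \<notin> Z" for w
    unfolding s_def
  proof (rule poly_sgn_const)
    fix z assume z: "min w \<zeta> \<le> z" "z \<le> max w \<zeta>"
    show "poly (pderiv p) z \<noteq> 0"
    proof
      assume "poly (pderiv p) z = 0"
      then have "z \<in> Z" by (rule Z(2))
      then have "z \<noteq> w" "z \<noteq> \<zeta>" "z \<notin> {min w \<zeta><..<max w \<zeta>}" using that \<zeta>(2) by auto
      then show False using z by (auto simp: min_def max_def split: if_splits)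
    qed
  qed
  have left: "sgn (poly p w) = - s" if "w < \<zeta>" "{w<..<\<zeta>} \<inter> Z = {}" for w
  proof -
    have "sgn (poly p \<zeta> - poly p w) = s"
    proof (rule poly_deriv_sgn_less[OF that(1) _ s])
      fix z assume z: "w < z" "z < \<zeta>"
      then show "sgn (poly (pderiv p) z) = s" using that by (intro sg) (auto simp: disjoint_iff)
    qed
    then show ?thesis using \<zeta> by (auto simp: sgn_if split: if_splits)
  qed
  have right: "sgn (poly p w) = s" if "\<zeta> < w" "{\<zeta><..<w} \<inter> Z = {}" for w
  proof -
    have "sgn (poly p w - poly p \<zeta>) = s"
    proof (rule poly_deriv_sgn_less[OF that(1) _ s])
      fix z assume z: "\<zeta> < z" "z < w"
      then show "sgn (poly (pderiv p) z) = s" using that by (intro sg) (auto simp: disjoint_iff)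
    qed
    then show ?thesis using \<zeta> by simp
  qed
  have "\<exists>\<alpha><\<zeta>. {\<alpha><..<\<zeta>} \<inter> Z = {} \<and> sgn (poly q (\<sigma> \<alpha>)) = - s"
  proof (cases "{z \<in> Z. z < \<zeta>} = {}")
    case False
    define \<alpha> where "\<alpha> = Max {z \<in> Z. z < \<zeta>}"
    have "\<alpha> \<in> {z \<in> Z. z < \<zeta>}" unfolding \<alpha>_def using Z(1) False by (intro Max_in) auto
    moreover have "z \<le> \<alpha>" if "z \<in> Z" "z < \<zeta>" for z
      unfolding \<alpha>_def using Z(1) that by (intro Max_ge) auto
    ultimately have *: "\<alpha> < \<zeta>" "\<alpha> \<in> Z" "{\<alpha><..<\<zeta>} \<inter> Z = {}" by (simp_all, force)
    then show ?thesis using left[of \<alpha>] eqZ[of \<alpha>] by auto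
  next
    case True
    obtain N M where N: "\<And>y. y \<le> N \<Longrightarrow> sgn (poly p y) = (-1) ^ degree p * sgn (lead_coeff p)"
      and M: "\<And>y. y \<le> M \<Longrightarrow> sgn (poly q y) = (-1) ^ degree q * sgn (lead_coeff q)"
      using poly_sgn_at_bot[OF nz(1)] poly_sgn_at_bot[OF nz(2)] by metis
    have "- s = sgn (poly p (min N (\<zeta> - 1)))" using True by (subst left) auto
    also have "\<dots> = (-1) ^ degree p * sgn (lead_coeff p)" by (intro N) auto
    finally have *: "sgn (poly q y) = - s" if "y \<le> M" for y using M[OF that] deg by simp
    \<comment> \<open>On an unbounded side of the gap the end is chosen through its image, far
      enough out for \<open>q\<close> to have its sign at minus infinity. Equal degrees and equal
      signs of the leading coefficients make this the sign of \<open>p\<close> there.\<close>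
    obtain \<alpha> where \<alpha>: "\<sigma> \<alpha> = min M (\<sigma> \<zeta> - 1)" using \<sigma>(2) by (metis surjD)
    then have "\<alpha> < \<zeta>" using \<sigma>(1) by (metis min.cobounded2 diff_less_eq less_add_one order_le_less_trans
          strict_mono_less)
    then show ?thesis using * \<alpha> True by auto
  qed
  then obtain \<alpha> where \<alpha>: "\<alpha> < \<zeta>" "{\<alpha><..<\<zeta>} \<inter> Z = {}" "sgn (poly q (\<sigma> \<alpha>)) = - s" by blast
  have "\<exists>\<beta>>\<zeta>. {\<zeta><..<\<beta>} \<inter> Z = {} \<and> sgn (poly q (\<sigma> \<beta>)) = s"
  proof (cases "{z \<in> Z. \<zeta> < z} = {}")
    case False
    define \<beta> where "\<beta> = Min {z \<in> Z. \<zeta> < z}"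
    have "\<beta> \<in> {z \<in> Z. \<zeta> < z}" unfolding \<beta>_def using Z(1) False by (intro Min_in) auto
    moreover have "\<beta> \<le> z" if "z \<in> Z" "\<zeta> < z" for z
      unfolding \<beta>_def using Z(1) that by (intro Min_le) auto
    ultimately have *: "\<zeta> < \<beta>" "\<beta> \<in> Z" "{\<zeta><..<\<beta>} \<inter> Z = {}" by (simp_all, force)
    then show ?thesis using right[of \<beta>] eqZ[of \<beta>] by auto
  next
    case True
    obtain N M where N: "\<And>y. N \<le> y \<Longrightarrow> sgn (poly p y) = sgn (lead_coeff p)"
      and M: "\<And>y. M \<le> y \<Longrightarrow> sgn (poly q y) = sgn (lead_coeff q)"
      using poly_sgn_at_top[OF nz(1)] poly_sgn_at_top[OF nz(2)] by metis
    have "s = sgn (poly p (max N (\<zeta> + 1)))" using True by (subst right) auto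
    also have "\<dots> = sgn (lead_coeff p)" by (intro N) auto
    finally have *: "sgn (poly q y) = s" if "M \<le> y" for y using M[OF that] deg by simp
    obtain \<beta> where \<beta>: "\<sigma> \<beta> = max M (\<sigma> \<zeta> + 1)" using \<sigma>(2) by (metis surjD)
    then have "\<zeta> < \<beta>" using \<sigma>(1) by (metis max.cobounded2 less_add_one order_less_le_trans
          strict_mono_less)
    then show ?thesis using * \<beta> True by auto
  qed
  then obtain \<beta> where \<beta>: "\<zeta> < \<beta>" "{\<zeta><..<\<beta>} \<inter> Z = {}" "sgn (poly q (\<sigma> \<beta>)) = s" by blast
  have "\<sigma> \<alpha> < \<sigma> \<beta>" using \<sigma>(1) \<alpha>(1) \<beta>(1) by (meson order.strict_trans strict_monoD)
  moreover have "poly q (\<sigma> \<alpha>) * poly q (\<sigma> \<beta>) < 0"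
    using \<alpha>(3) \<beta>(3) s by (auto simp: sgn_if mult_less_0_iff split: if_splits)
  ultimately obtain \<zeta>' where "\<sigma> \<alpha> < \<zeta>'" "\<zeta>' < \<sigma> \<beta>" "poly q \<zeta>' = 0" using poly_IVT by blast
  moreover have "{\<alpha><..<\<beta>} \<inter> Z = {}" using \<alpha>(2) \<beta>(2) \<zeta>(2)
    by (auto simp: disjoint_iff) (metis linorder_neqE_linordered_idom)
  ultimately show ?thesis using \<alpha>(1) \<beta>(1) by blast
qed

lemma unique_root_in_gap:
  fixes p :: "real poly"
  assumes "\<And>z. \<alpha> < z \<Longrightarrow> z < \<beta> \<Longrightarrow> poly (pderiv p) z \<noteq> 0"
    and "\<alpha> < x" "x < \<beta>" "\<alpha> < y" "y < \<beta>" "poly p x = 0" "poly p y = 0"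
  shows "x = y"
proof (rule ccontr)
  assume "x \<noteq> y"
  then have "\<exists>x y. \<alpha> < x \<and> x < y \<and> y < \<beta> \<and> poly p x = 0 \<and> poly p y = 0"
    using assms by (metis linorder_neqE_linordered_idom)
  then obtain x y where *: "\<alpha> < x" "x < y" "y < \<beta>" "poly p x = 0" "poly p y = 0" by blast
  obtain z where "x < z" "z < y" "poly p y - poly p x = (y - x) * poly (pderiv p) z"
    using poly_MVT[OF *(2)] by blast
  then show False using * assms(1)[of z] by auto
qed

text \<open>An order automorphism matching the signs of a family of polynomials is changed, between
  consecutive zeros of the family, so as to match the zeros of one more polynomial.\<close>

lemma adjoin_poly_automorphism:
  fixes f g :: "'i \<Rightarrow> real poly" and p q :: "real poly"
  assumes R: "finite R" and \<sigma>: "strict_mono \<sigma>" "surj \<sigma>"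
    and fg: "\<And>i y. i \<in> R \<Longrightarrow> sgn (poly (f i) y) = sgn (poly (g i) (\<sigma> y))"
    and pq: "\<And>y. sgn (poly (pderiv p) y) = sgn (poly (pderiv q) (\<sigma> y))"
    and root: "\<And>i z. i \<in> R \<Longrightarrow> f i \<noteq> 0 \<Longrightarrow> poly (f i) z = 0 \<Longrightarrow> sgn (poly p z) = sgn (poly q (\<sigma> z))"
    and root': "\<And>z. poly (pderiv p) z = 0 \<Longrightarrow> sgn (poly p z) = sgn (poly q (\<sigma> z))"
    and deg: "degree p = degree q" "degree p > 0" "sgn (lead_coeff p) = sgn (lead_coeff q)"
  shows "\<exists>\<sigma>. strict_mono \<sigma> \<and> surj \<sigma> \<and>
    (\<forall>i\<in>R. \<forall>y. sgn (poly (f i) y) = sgn (poly (g i) (\<sigma> y))) \<and>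
    (\<forall>y. sgn (poly p y) = sgn (poly q (\<sigma> y)))"
proof -
  \<comment> \<open>Between consecutive points of \<open>Z\<close> the signs of
    \<open>pderiv p\<close> and of all nonzero members of the family are constant, so \<sigma> can
    be changed there without harm.\<close>
  define Z where "Z = {z. poly (pderiv p) z = 0} \<union> (\<Union>i\<in>{i\<in>R. f i \<noteq> 0}. {z. poly (f i) z = 0})"
  have pnz: "p \<noteq> 0" "q \<noteq> 0" "pderiv p \<noteq> 0" using deg by (auto simp: pderiv_eq_0_iff)
  have finZ: "finite Z" unfolding Z_def using R pnz by (auto intro: poly_roots_finite)
  have Zp: "z \<in> Z" if "poly (pderiv p) z = 0" for z using that by (auto simp: Z_def)
  define Inv where "Inv \<sigma> \<longleftrightarrow> strict_mono \<sigma> \<and> surj \<sigma> \<and>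
      (\<forall>i\<in>R. \<forall>y. sgn (poly (f i) y) = sgn (poly (g i) (\<sigma> y))) \<and>
      (\<forall>y. sgn (poly (pderiv p) y) = sgn (poly (pderiv q) (\<sigma> y))) \<and>
      (\<forall>z\<in>Z. sgn (poly p z) = sgn (poly q (\<sigma> z)))" for \<sigma> :: "real \<Rightarrow> real"
  have "\<exists>\<sigma>. Inv \<sigma> \<and> (\<forall>z. poly p z = 0 \<longrightarrow> poly q (\<sigma> z) = 0)" if "Inv \<sigma>" for \<sigma>
    using that
  \<comment> \<open>Induction on the number of zeros of \<open>p\<close> not yet sent to zeros of
    \<open>q\<close>. A bump inside the gap around one of them repairs it; by Rolle the gap holds no
    other zero of \<open>p\<close>, so nothing is undone.\<close>
  proof (induction "card {z. poly p z = 0 \<and> poly q (\<sigma> z) \<noteq> 0}" arbitrary: \<sigma> rule: less_induct)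
    case less
    let ?B = "\<lambda>\<sigma>. {z. poly p z = 0 \<and> poly q (\<sigma> z) \<noteq> 0}"
    note Inv = less.prems[unfolded Inv_def]
    have finB: "finite (?B \<sigma>)" by (rule finite_subset[OF _ poly_roots_finite[OF pnz(1)]]) auto
    show ?case
    proof (cases "?B \<sigma> = {}")
      case True
      then show ?thesis using less.prems by auto
    next
      case False
      then obtain \<zeta> where \<zeta>: "poly p \<zeta> = 0" "poly q (\<sigma> \<zeta>) \<noteq> 0" by blast
      have \<zeta>Z: "\<zeta> \<notin> Z" using Inv \<zeta> by (metis sgn_0 sgn_0_0)
      have sm: "strict_mono \<sigma>" and su: "surj \<sigma>" using Inv by auto
      obtain \<alpha> \<beta> \<zeta>' where gap: "\<alpha> < \<zeta>" "\<zeta> < \<beta>" "{\<alpha><..<\<beta>} \<inter> Z = {}"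
        and \<zeta>': "\<sigma> \<alpha> < \<zeta>'" "\<zeta>' < \<sigma> \<beta>" "poly q \<zeta>' = 0"
        using matching_root[OF sm su finZ Zp _ deg \<zeta>(1) \<zeta>Z] Inv by blast
      have "\<sigma> \<alpha> < \<sigma> \<zeta>" "\<sigma> \<zeta> < \<sigma> \<beta>" using sm gap by (auto simp: strict_mono_less)
      then obtain \<tau> where \<tau>: "strict_mono \<tau>" "surj \<tau>" "\<tau> (\<sigma> \<zeta>) = \<zeta>'"
        "\<And>y. y \<le> \<sigma> \<alpha> \<or> \<sigma> \<beta> \<le> y \<Longrightarrow> \<tau> y = y"
        using bump_automorphism[of "\<sigma> \<alpha>" "\<sigma> \<zeta>" "\<sigma> \<beta>" \<zeta>'] \<zeta>' by metis
      define \<sigma>1 where "\<sigma>1 = \<tau> \<circ> \<sigma>"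
      have out: "\<sigma>1 y = \<sigma> y" if "y \<le> \<alpha> \<or> \<beta> \<le> y" for y
        using that \<tau>(4) sm by (auto simp: \<sigma>1_def strict_mono_less_eq)
      have sm1: "strict_mono \<sigma>1" using \<tau>(1) sm by (auto simp: \<sigma>1_def strict_mono_def)
      have su1: "surj \<sigma>1" using \<tau>(2) su unfolding \<sigma>1_def by (rule comp_surj[rotated])
      \<comment> \<open>The bump permutes the interval between \<open>\<sigma> \<alpha>\<close> and
        \<open>\<sigma> \<beta>\<close>, so the new image of a point of the gap is the old image of
        another point of the gap, where the signs are the same.\<close>
      have inn: "\<exists>w. \<alpha> < w \<and> w < \<beta> \<and> \<sigma>1 y = \<sigma> w" if "\<alpha> < y" "y < \<beta>" for y
      proof -
        obtain w where w: "\<sigma>1 y = \<sigma> w" using su by (metis surjD)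
        have "\<sigma>1 \<alpha> < \<sigma>1 y" "\<sigma>1 y < \<sigma>1 \<beta>" using that sm1 by (auto simp: strict_mono_less)
        then have "\<sigma> \<alpha> < \<sigma> w" "\<sigma> w < \<sigma> \<beta>" using w out by auto
        then show ?thesis using w sm by (auto simp: strict_mono_less)
      qed
      have const: "sgn (poly h y) = sgn (poly h w)" 
        if "\<alpha> < y" "y < \<beta>" "\<alpha> < w" "w < \<beta>" "\<And>z. poly h z = 0 \<Longrightarrow> z \<in> Z" for y w h
      proof (rule poly_sgn_const)
        fix z assume "min y w \<le> z" "z \<le> max y w"
        then have "z \<in> {\<alpha><..<\<beta>}" using that by auto
        then show "poly h z \<noteq> 0" using gap(3) that(5) by blast
      qed
      have fg1: "sgn (poly (f i) y) = sgn (poly (g i) (\<sigma>1 y))" if i: "i \<in> R" for i y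
      proof (cases "f i = 0 \<or> y \<le> \<alpha> \<or> \<beta> \<le> y")
        case True
        then show ?thesis
        proof
          \<comment> \<open>The zeros of a zero polynomial are not in \<open>Z\<close>. Here
            \<open>g i\<close> is zero as well, because it vanishes on the range of
            \<sigma>.\<close>
          assume "f i = 0"
          then have "sgn (poly (g i) (\<sigma> w)) = 0" for w using Inv i by (metis poly_0 sgn_0)
          then show ?thesis using \<open>f i = 0\<close> su by (metis poly_0 sgn_0 surjD)
        qed (use out Inv i in auto)
      next
        case False
        then obtain w where w: "\<alpha> < w" "w < \<beta>" "\<sigma>1 y = \<sigma> w" using inn by force
        have "sgn (poly (f i) y) = sgn (poly (f i) w)"
          using False w i by (intro const) (auto simp: Z_def)
        then show ?thesis using Inv i w by auto
      qed
      have pq1: "sgn (poly (pderiv p) y) = sgn (poly (pderiv q) (\<sigma>1 y))" for y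
      proof (cases "y \<le> \<alpha> \<or> \<beta> \<le> y")
        case False
        then obtain w where w: "\<alpha> < w" "w < \<beta>" "\<sigma>1 y = \<sigma> w" using inn by force
        have "sgn (poly (pderiv p) y) = sgn (poly (pderiv p) w)"
          using False w by (intro const) (auto simp: Z_def)
        then show ?thesis using Inv w by auto
      qed (use out Inv in auto)
      have "sgn (poly p z) = sgn (poly q (\<sigma>1 z))" if "z \<in> Z" for z
      proof -
        have "z \<notin> {\<alpha><..<\<beta>}" using that gap(3) by blast
        then have "z \<le> \<alpha> \<or> \<beta> \<le> z" by auto
        then show ?thesis using out Inv that by auto
      qed
      then have Inv1: "Inv \<sigma>1" using sm1 su1 fg1 pq1 by (auto simp: Inv_def)
      have "?B \<sigma>1 \<subset> ?B \<sigma>"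
      proof
        show "?B \<sigma>1 \<subseteq> ?B \<sigma>"
        proof
          fix z assume z: "z \<in> ?B \<sigma>1"
          have "z \<noteq> \<zeta>" using z \<tau>(3) \<zeta>'(3) by (auto simp: \<sigma>1_def)
          have "z \<le> \<alpha> \<or> \<beta> \<le> z"
          proof (rule ccontr)
            assume "\<not> (z \<le> \<alpha> \<or> \<beta> \<le> z)"
            then have "\<alpha> < z" "z < \<beta>" by auto
            have "poly (pderiv p) w \<noteq> 0" if "\<alpha> < w" "w < \<beta>" for w
              using that gap(3) Zp[of w] by (meson disjoint_iff greaterThanLessThan_iff)
            moreover have "poly p z = 0" using z by blast
            ultimately have "z = \<zeta>"
              using \<zeta>(1) gap(1,2) \<open>\<alpha> < z\<close> \<open>z < \<beta>\<close> unique_root_in_gap[of \<alpha> \<beta> p z \<zeta>] by blast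
            then show False using \<open>z \<noteq> \<zeta>\<close> by simp
          qed
          then have "\<sigma>1 z = \<sigma> z" by (rule out)
          then show "z \<in> ?B \<sigma>" using z by simp
        qed
        have "\<zeta> \<in> ?B \<sigma>" "\<zeta> \<notin> ?B \<sigma>1" using \<zeta> \<tau>(3) \<zeta>'(3) by (simp_all add: \<sigma>1_def)
        then show "?B \<sigma>1 \<noteq> ?B \<sigma>" by blast
      qed
      then have "card (?B \<sigma>1) < card (?B \<sigma>)" using finB by (rule psubset_card_mono[rotated])
      from less.hyps[OF this Inv1] show ?thesis .
    qed
  qed
  moreover have "Inv \<sigma>" unfolding Inv_def Z_def using \<sigma> fg pq root root' by auto
  ultimately obtain \<sigma> where "Inv \<sigma>" and fwd: "\<And>z. poly p z = 0 \<Longrightarrow> poly q (\<sigma> z) = 0" by blast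
  note Inv = \<open>Inv \<sigma>\<close>[unfolded Inv_def]
  have sm: "strict_mono \<sigma>" and su: "surj \<sigma>" using Inv by auto
  have inj: "inj \<sigma>" using sm by (rule strict_mono_imp_inj_on)
  define \<rho> where "\<rho> = inv \<sigma>"
  have \<rho>: "\<sigma> (\<rho> y) = y" "\<rho> (\<sigma> y) = y" for y using su inj by (auto simp: \<rho>_def surj_f_inv_f)
  have sm': "strict_mono \<rho>" using sm \<rho> by (metis strict_mono_def strict_mono_less)
  have su': "surj \<rho>" using \<rho> by (metis surjI)
  \<comment> \<open>The same matching, with the inverse of \<sigma> and with \<open>p\<close> and
    \<open>q\<close> exchanged, yields a zero \<zeta> of \<open>p\<close> in the gap. Its image and
    \<open>\<sigma> y\<close> are zeros of \<open>q\<close> in a gap free of zeros of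
    \<open>pderiv q\<close>, hence equal.\<close>
  have bwd: "poly p y = 0" if y: "poly q (\<sigma> y) = 0" for y
  proof (rule ccontr)
    assume ny: "poly p y \<noteq> 0"
    have yZ: "y \<notin> Z" using Inv y ny by (metis sgn_0 sgn_0_0)
    have dq: "z \<in> \<sigma> ` Z" if "poly (pderiv q) z = 0" for z
    proof -
      have "poly (pderiv p) (\<rho> z) = 0" using that Inv \<rho> by (metis sgn_0 sgn_0_0)
      then show ?thesis using Zp \<rho> by (metis imageI)
    qed
    obtain \<alpha> \<beta> \<zeta> where gap: "\<alpha> < \<sigma> y" "\<sigma> y < \<beta>" "{\<alpha><..<\<beta>} \<inter> \<sigma> ` Z = {}"
        and \<zeta>: "\<rho> \<alpha> < \<zeta>" "\<zeta> < \<rho> \<beta>" "poly p \<zeta> = 0"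
    proof -
      have "sgn (poly q z) = sgn (poly p (\<rho> z))" if "z \<in> \<sigma> ` Z" for z
        using that Inv \<rho>(2) by force
      moreover have "\<sigma> y \<notin> \<sigma> ` Z" using yZ inj by (simp add: inj_image_mem_iff)
      ultimately show thesis
        using matching_root[OF sm' su' finite_imageI[OF finZ] dq, of q p "\<sigma> y"] y deg that by force
    qed
    have "\<sigma> y = \<sigma> \<zeta>"
    proof (rule unique_root_in_gap[of \<alpha> \<beta> q])
      show "\<alpha> < \<sigma> \<zeta>" "\<sigma> \<zeta> < \<beta>" using \<zeta> sm \<rho> by (metis strict_mono_less)+
      show "poly (pderiv q) z \<noteq> 0" if "\<alpha> < z" "z < \<beta>" for z
        using that gap(3) dq[of z] by (meson disjoint_iff greaterThanLessThan_iff)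
    qed (use gap(1,2) y fwd[OF \<zeta>(3)] in simp_all)
    then show False using ny \<zeta>(3) inj by (auto dest: injD)
  qed
  \<comment> \<open>Zeros now correspond in both directions, so agreement of the signs at
    \<open>w\<close> spreads to every \<open>y\<close> not separated from \<open>w\<close> by a zero
    of \<open>p\<close>. Beyond the extreme zeros \<open>w\<close> is taken far out; between
    consecutive zeros it is a critical point of \<open>p\<close>, which lies in
    \<open>Z\<close>.\<close>
  have transfer: "sgn (poly p y) = sgn (poly q (\<sigma> y))"
    if w: "sgn (poly p w) = sgn (poly q (\<sigma> w))" and nr: "\<And>z. min y w \<le> z \<Longrightarrow> z \<le> max y w \<Longrightarrow> poly p z \<noteq> 0"
    for y w
  proof -
    have "sgn (poly p y) = sgn (poly p w)" using nr by (rule poly_sgn_const)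
    moreover have "sgn (poly q (\<sigma> y)) = sgn (poly q (\<sigma> w))"
    proof (rule poly_sgn_const)
      fix z assume z: "min (\<sigma> y) (\<sigma> w) \<le> z" "z \<le> max (\<sigma> y) (\<sigma> w)"
      have "min (\<sigma> y) (\<sigma> w) = \<sigma> (min y w)" "max (\<sigma> y) (\<sigma> w) = \<sigma> (max y w)"
        by (simp_all add: min_def max_def strict_mono_less_eq[OF sm])
      then have "\<sigma> (min y w) \<le> \<sigma> (\<rho> z)" "\<sigma> (\<rho> z) \<le> \<sigma> (max y w)" using z \<rho>(1)[of z] by simp_all
      then have "min y w \<le> \<rho> z" "\<rho> z \<le> max y w" unfolding strict_mono_less_eq[OF sm] .
      then have "poly p (\<rho> z) \<noteq> 0" by (rule nr)
      then show "poly q z \<noteq> 0" using bwd[of "\<rho> z"] \<rho>(1)[of z] by fastforce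
    qed
    ultimately show ?thesis using w by simp
  qed
  have "sgn (poly p y) = sgn (poly q (\<sigma> y))" for y
  proof (cases "poly p y = 0")
    case True
    then show ?thesis using fwd by simp
  next
    case False
    let ?L = "{z. poly p z = 0 \<and> z < y}" and ?U = "{z. poly p z = 0 \<and> y < z}"
    have fin: "finite ?L" "finite ?U" using poly_roots_finite[OF pnz(1)] by auto
    consider "?L = {}" | "?U = {}" | "?L \<noteq> {}" "?U \<noteq> {}" by blast
    then show ?thesis
    proof cases
      case 1
      obtain N M where N: "\<And>y. y \<le> N \<Longrightarrow> sgn (poly p y) = (-1) ^ degree p * sgn (lead_coeff p)"
        and M: "\<And>y. y \<le> M \<Longrightarrow> sgn (poly q y) = (-1) ^ degree q * sgn (lead_coeff q)"
        using poly_sgn_at_bot[OF pnz(1)] poly_sgn_at_bot[OF pnz(2)] by metis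
      define w where "w = min y (min N (\<rho> M))"
      have "\<sigma> w \<le> M" using strict_mono_less_eq[OF sm, of w "\<rho> M"] \<rho>(1)[of M]
        by (simp add: w_def)
      then have "sgn (poly p w) = sgn (poly q (\<sigma> w))" using N[of w] M[of "\<sigma> w"] deg
        by (simp add: w_def)
      then show ?thesis
      proof (rule transfer)
        fix z assume "z \<le> max y w"
        then have "z \<le> y" by (simp add: w_def)
        then show "poly p z \<noteq> 0" using 1 False by (cases "z = y") auto
      qed
    next
      case 2
      obtain N M where N: "\<And>y. N \<le> y \<Longrightarrow> sgn (poly p y) = sgn (lead_coeff p)"
        and M: "\<And>y. M \<le> y \<Longrightarrow> sgn (poly q y) = sgn (lead_coeff q)"
        using poly_sgn_at_top[OF pnz(1)] poly_sgn_at_top[OF pnz(2)] by metis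
      define w where "w = max y (max N (\<rho> M))"
      have "M \<le> \<sigma> w" using strict_mono_less_eq[OF sm, of "\<rho> M" w] \<rho>(1)[of M]
        by (simp add: w_def)
      then have "sgn (poly p w) = sgn (poly q (\<sigma> w))" using N[of w] M[of "\<sigma> w"] deg
        by (simp add: w_def)
      then show ?thesis
      proof (rule transfer)
        fix z assume "min y w \<le> z"
        then have "y \<le> z" by (simp add: w_def)
        then show "poly p z \<noteq> 0" using 2 False by (cases "z = y") auto
      qed
    next
      case 3
      define a b where "a = Max ?L" and "b = Min ?U"
      have a: "poly p a = 0" "a < y" using Max_in[OF fin(1) 3(1)] by (auto simp: a_def)
      have b: "poly p b = 0" "y < b" using Min_in[OF fin(2) 3(2)] by (auto simp: b_def)
      have nr: "poly p z \<noteq> 0" if "a < z" "z < b" for z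
      proof
        assume z: "poly p z = 0"
        then consider "z < y" | "y < z" using False by (metis linorder_neqE_linordered_idom)
        then show False
        proof cases
          case 1
          then have "z \<le> a" unfolding a_def using fin z by (intro Max_ge) auto
          then show ?thesis using that by simp
        next
          case 2
          then have "b \<le> z" unfolding b_def using fin z by (intro Min_le) auto
          then show ?thesis using that by simp
        qed
      qed
      have "a < b" using a b by simp
      then obtain w where w: "a < w" "w < b" "poly p b - poly p a = (b - a) * poly (pderiv p) w"
        using poly_MVT by blast
      then have "poly (pderiv p) w = 0" using a b by auto
      then have "sgn (poly p w) = sgn (poly q (\<sigma> w))" using Zp Inv by auto
      then show ?thesis
      proof (rule transfer)
        fix z assume "min y w \<le> z" "z \<le> max y w"
        then have "a < z" "z < b" using w(1,2) a(2) b(2) by linarith+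
        then show "poly p z \<noteq> 0" by (rule nr)
      qed
    qed
  qed
  then show ?thesis using Inv by blast
qed

section \<open>Elimination for polynomials whose coefficients are functions of a parameter\<close>

definition function_ring :: "('a \<Rightarrow> real) set \<Rightarrow> bool" where
  "function_ring A \<longleftrightarrow> (\<forall>v. (\<lambda>_. v) \<in> A) \<and>
     (\<forall>f\<in>A. \<forall>g\<in>A. (\<lambda>x. f x + g x) \<in> A \<and> (\<lambda>x. f x * g x) \<in> A)"

lemma function_ringD:
  assumes "function_ring A"
  shows "(\<lambda>_. v) \<in> A" "f \<in> A \<Longrightarrow> g \<in> A \<Longrightarrow> (\<lambda>x. f x + g x) \<in> A"
    "f \<in> A \<Longrightarrow> g \<in> A \<Longrightarrow> (\<lambda>x. f x * g x) \<in> A" "f \<in> A \<Longrightarrow> g \<in> A \<Longrightarrow> (\<lambda>x. f x - g x) \<in> A"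
proof -
  show c: "(\<lambda>_. v) \<in> A" and a: "f \<in> A \<Longrightarrow> g \<in> A \<Longrightarrow> (\<lambda>x. f x + g x) \<in> A"
    and m: "f \<in> A \<Longrightarrow> g \<in> A \<Longrightarrow> (\<lambda>x. f x * g x) \<in> A" for f g v
    using assms by (auto simp: function_ring_def)
  assume "f \<in> A" "g \<in> A"
  then show "(\<lambda>x. f x - g x) \<in> A" using a[OF _ m[OF c[of "-1"]], of f g] by simp
qed

definition poly_family :: "('a \<Rightarrow> real) set \<Rightarrow> nat \<Rightarrow> ('a \<Rightarrow> real poly) set" where
  "poly_family A d = {p. (\<forall>x. degree (p x) \<le> d) \<and> (\<forall>k. (\<lambda>x. coeff (p x) k) \<in> A)}"

definition poly_trunc :: "nat \<Rightarrow> real poly \<Rightarrow> real poly" where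
  "poly_trunc j p = (\<Sum>i\<le>j. monom (coeff p i) i)"

lemma coeff_poly_trunc: "coeff (poly_trunc j p) k = (if k \<le> j then coeff p k else 0)"
  by (auto simp: poly_trunc_def coeff_sum)

lemma poly_trunc_same: "degree p \<le> j \<Longrightarrow> poly_trunc j p = p"
  by (intro poly_eqI) (auto simp: coeff_poly_trunc coeff_eq_0)

lemma poly_family_trunc:
  assumes "function_ring A" "p \<in> poly_family A d"
  shows "(\<lambda>x. poly_trunc j (p x)) \<in> poly_family A j"
proof -
  have "(\<lambda>x. coeff (poly_trunc j (p x)) k) \<in> A" for k
    using assms function_ringD(1)[OF assms(1), of 0]
    by (cases "k \<le> j") (auto simp: poly_family_def coeff_poly_trunc)
  then show ?thesis by (auto simp: poly_family_def coeff_poly_trunc intro!: degree_le)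
qed

lemma poly_family_mono: "p \<in> poly_family A d \<Longrightarrow> d \<le> e \<Longrightarrow> p \<in> poly_family A e"
  by (auto simp: poly_family_def intro: order_trans)

lemma poly_family_pderiv:
  assumes "function_ring A" "p \<in> poly_family A d"
  shows "(\<lambda>x. pderiv (p x)) \<in> poly_family A (d - 1)"
  using assms function_ringD(3)[OF assms(1) function_ringD(1)[OF assms(1)]]
  by (auto simp: poly_family_def coeff_pderiv degree_pderiv intro!: diff_le_mono)

text \<open>The coefficient of \<open>q\<close> at \<open>j\<close> is no unit of \<open>A\<close>,
  so division is replaced by pseudo-division. Each round multiplies by the square of this
  coefficient; at a zero of \<open>q x\<close> the remainder then has the sign of \<open>p x\<close>
  whenever the coefficient is nonzero.\<close>

lemma poly_family_pseudo_mod: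
  assumes A: "function_ring A" and q: "q \<in> poly_family A j" and j: "0 < j" and p: "p \<in> poly_family A d"
  shows "\<exists>r \<in> poly_family A (j - 1). \<forall>x. \<exists>s N. r x = smult (coeff (q x) j ^ (2 * N)) (p x) - s * q x"
  using p
proof (induction d arbitrary: p rule: less_induct)
  case (less d)
  show ?case
  proof (cases "d < j")
    case True
    then have "p \<in> poly_family A (j - 1)" using less.prems by (auto intro: poly_family_mono)
    moreover have "p x = smult (coeff (q x) j ^ (2 * 0)) (p x) - 0 * q x" for x by simp
    ultimately show ?thesis by blast
  next
    case False
    define m where "m x = monom (coeff (q x) j * coeff (p x) d) (d - j)" for x
    define p1 where "p1 x = smult (coeff (q x) j ^ 2) (p x) - m x * q x" for x
    have cm: "coeff (m x * q x) k = (if k < d - j then 0 else coeff (q x) j * coeff (p x) d * coeff (q x) (k - (d - j)))"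
      for x k by (simp add: m_def coeff_monom_mult)
    have c1: "coeff (p1 x) k = coeff (q x) j * coeff (q x) j * coeff (p x) k -
      (if k < d - j then 0 else coeff (q x) j * coeff (p x) d * coeff (q x) (k - (d - j)))" for x k
      by (simp add: p1_def cm power2_eq_square)
    have "(\<lambda>x. coeff (p1 x) k) \<in> A" for k
      unfolding c1 using q less.prems
      by (cases "k < d - j") (auto simp: poly_family_def intro!: function_ringD[OF A])
    moreover have "degree (p1 x) \<le> d - 1" for x
    proof (rule degree_le, intro allI impI)
      fix k assume k: "d - 1 < k"
      show "coeff (p1 x) k = 0"
      proof (cases "k = d")
        case True
        then show ?thesis using False by (simp add: c1)
      next
        case k': False
        moreover have "degree (p x) \<le> d" "degree (q x) \<le> j"
          using q less.prems by (auto simp: poly_family_def)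
        ultimately have "degree (p x) < k" "degree (q x) < k - (d - j)" using k False j by auto
        then show ?thesis by (simp add: c1 coeff_eq_0)
      qed
    qed
    ultimately have "p1 \<in> poly_family A (d - 1)" by (auto simp: poly_family_def)
    moreover have "d - 1 < d" using False j by simp
    ultimately obtain r where r: "r \<in> poly_family A (j - 1)"
      "\<And>x. \<exists>s N. r x = smult (coeff (q x) j ^ (2 * N)) (p1 x) - s * q x" using less.IH by blast
    have "\<exists>s N. r x = smult (coeff (q x) j ^ (2 * N)) (p x) - s * q x" for x
    proof -
      obtain s N where s: "r x = smult (coeff (q x) j ^ (2 * N)) (p1 x) - s * q x" using r(2) by blast
      have "r x = smult (coeff (q x) j ^ (2 * Suc N)) (p x) - (smult (coeff (q x) j ^ (2 * N)) (m x) + s) * q x"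
        unfolding s p1_def by (simp add: smult_diff_right algebra_simps power2_eq_square)
      then show ?thesis by blast
    qed
    then show ?thesis using r(1) by blast
  qed
qed

definition same_signs :: "('a \<Rightarrow> real) set \<Rightarrow> 'a \<Rightarrow> 'a \<Rightarrow> bool" where
  "same_signs E x x' \<longleftrightarrow> (\<forall>e\<in>E. sgn (e x) = sgn (e x'))"

lemma same_signsD: "same_signs E x x' \<Longrightarrow> e \<in> E \<Longrightarrow> sgn (e x) = sgn (e x')"
  by (simp add: same_signs_def)

text \<open>An order automorphism encodes that the sign tables at \<open>x\<close> and
  \<open>x'\<close> agree, and it also says which point takes over the role of \<open>y\<close>. The
  latter is needed to transport solutions.\<close>

definition sign_automorphism ::
  "('a \<Rightarrow> real poly) set \<Rightarrow> (real \<Rightarrow> real) \<Rightarrow> 'a \<Rightarrow> 'a \<Rightarrow> bool" where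
  "sign_automorphism P \<sigma> x x' \<longleftrightarrow> strict_mono \<sigma> \<and> surj \<sigma> \<and>
     (\<forall>p\<in>P. \<forall>y. sgn (poly (p x) y) = sgn (poly (p x') (\<sigma> y)))"

text \<open>Elimination of one real variable: finitely many sign conditions on the parameter fix the
  sign table, hence also which sign vectors of the family occur on the line.\<close>

definition sign_determined :: "('a \<Rightarrow> real) set \<Rightarrow> ('a \<Rightarrow> real poly) set \<Rightarrow> bool" where
  "sign_determined A P \<longleftrightarrow> (\<exists>E. finite E \<and> E \<subseteq> A \<and>
     (\<forall>x x'. same_signs E x x' \<longrightarrow> (\<exists>\<sigma>. sign_automorphism P \<sigma> x x')))"

lemma sign_determinedI:
  assumes "finite E" "E \<subseteq> A" "\<And>x x'. same_signs E x x' \<Longrightarrow> \<exists>\<sigma>. sign_automorphism P \<sigma> x x'"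
  shows "sign_determined A P"
  unfolding sign_determined_def by (rule exI[of _ E]) (simp add: assms)

lemma sign_determinedE:
  assumes "sign_determined A P"
  obtains E where "finite E" "E \<subseteq> A" "\<And>x x'. same_signs E x x' \<Longrightarrow> \<exists>\<sigma>. sign_automorphism P \<sigma> x x'"
  using assms unfolding sign_determined_def by (elim exE conjE) simp

text \<open>The signs of \<open>p\<close> at the zeros of a polynomial \<open>q\<close> of lower degree are those of a pseudo-remainder of
  \<open>p\<close> modulo \<open>q\<close>; since the true degree of \<open>q x\<close> depends on \<open>x\<close>, all truncations of \<open>q\<close> are used.\<close>

lemma adjoin_poly_family:
  assumes A: "function_ring A" and P: "finite P" "P \<subseteq> poly_family A d" and p: "p \<in> poly_family A d"
    and IH: "\<And>Q. finite Q \<Longrightarrow> Q \<subseteq> poly_family A (d - 1) \<Longrightarrow> sign_determined A (P \<union> Q)"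
    and d: "0 < d"
  shows "sign_determined A (insert p P)"
proof -
  let ?t = "\<lambda>x. poly_trunc (d - 1) (p x)" and ?p' = "\<lambda>x. pderiv (p x)"
  \<comment> \<open>The sign of \<open>p\<close> must be known at the zeros of its derivative too,
    since they cut the line into pieces on which \<open>p\<close> is monotone.\<close>
  define R where "R = insert ?p' P"
  have R: "finite R" "R \<subseteq> poly_family A d"
    using P poly_family_pderiv[OF A p] by (auto simp: R_def intro: poly_family_mono)
  define PR where "PR q j r \<longleftrightarrow> r \<in> poly_family A (j - 1) \<and> (\<forall>x. \<exists>s N. r x =
      smult (coeff (q x) j ^ (2 * N)) (p x) - s * poly_trunc j (q x))" for q j r
  define r where "r q j = (SOME r. PR q j r)" for q j
  have PR: "PR q j (r q j)" if "q \<in> R" "j \<in> {1..d}" for q j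
  proof -
    have "\<exists>r \<in> poly_family A (j - 1). \<forall>x. \<exists>s N. r x =
        smult (coeff (poly_trunc j (q x)) j ^ (2 * N)) (p x) - s * poly_trunc j (q x)"
      using that R by (intro poly_family_pseudo_mod[OF A _ _ p] poly_family_trunc[OF A]) auto
    then have "\<exists>r. PR q j r" by (auto simp: PR_def coeff_poly_trunc)
    then show ?thesis unfolding r_def by (rule someI_ex)
  qed
  have r: "r q j \<in> poly_family A (j - 1)"
    and rs: "\<exists>s N. r q j x = smult (coeff (q x) j ^ (2 * N)) (p x) - s * poly_trunc j (q x)"
    if "q \<in> R" "j \<in> {1..d}" for q j x using PR[OF that] by (auto simp: PR_def)
  define Q where "Q = insert ?p' ((\<lambda>(q, j). r q j) ` (R \<times> {1..d}))"
  \<comment> \<open>Where the coefficient of degree \<open>d\<close> vanishes, \<open>p\<close>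
    coincides with its truncation, which has lower degree; \<open>E1\<close> settles this case and
    \<open>E2\<close> the other one.\<close>
  have "finite {?t}" "{?t} \<subseteq> poly_family A (d - 1)" using poly_family_trunc[OF A p] by auto
  then have "sign_determined A (P \<union> {?t})" by (rule IH)
  then obtain E1 where E1: "finite E1" "E1 \<subseteq> A"
    "\<And>x x'. same_signs E1 x x' \<Longrightarrow> \<exists>\<sigma>. sign_automorphism (P \<union> {?t}) \<sigma> x x'" by (rule sign_determinedE) (rule that)
  have "finite Q" using R by (simp add: Q_def)
  moreover have "Q \<subseteq> poly_family A (d - 1)"
    using poly_family_pderiv[OF A p] r by (fastforce simp: Q_def intro: poly_family_mono)
  ultimately have "sign_determined A (P \<union> Q)" by (rule IH)
  then obtain E2 where E2: "finite E2" "E2 \<subseteq> A"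
    "\<And>x x'. same_signs E2 x x' \<Longrightarrow> \<exists>\<sigma>. sign_automorphism (P \<union> Q) \<sigma> x x'" by (rule sign_determinedE) (rule that)
  \<comment> \<open>The signs of all coefficients fix the true degrees of the polynomials at a
    parameter and the signs of their leading coefficients.\<close>
  define C where "C = (\<lambda>(q, j). (\<lambda>x. coeff (q x) j)) ` (insert p R \<times> {..d})"
  have C: "finite C" "C \<subseteq> A" using R p by (auto simp: C_def poly_family_def)
  have main: "\<exists>\<sigma>. sign_automorphism (insert p P) \<sigma> x x'" if E: "same_signs (E1 \<union> E2 \<union> C) x x'" for x x'
  proof -
    have le: "degree (q z) \<le> d" if "q \<in> insert p R" for q z
    proof -
      have "q \<in> poly_family A d" using that R p by auto
      then show ?thesis by (simp add: poly_family_def)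
    qed
    have cC: "sgn (coeff (q x) j) = sgn (coeff (q x') j)" if "q \<in> insert p R" for q j
    proof (cases "j \<le> d")
      case True
      then have "(\<lambda>x. coeff (q x) j) \<in> C" using that by (force simp: C_def)
      then show ?thesis using same_signsD[OF E, of "\<lambda>x. coeff (q x) j"] by simp
    next
      case False
      then have "degree (q x) < j" "degree (q x') < j"
        using le[OF that, of x] le[OF that, of x'] by auto
      then show ?thesis by (simp add: coeff_eq_0)
    qed
    then have z: "coeff (q x) j = 0 \<longleftrightarrow> coeff (q x') j = 0" if "q \<in> insert p R" for q j
      using that by (metis sgn_0_0)
    have dg: "degree (q x) = degree (q x')" if "q \<in> insert p R" for q
      using z[OF that] by (simp add: degree_def)
    show ?thesis
    proof (cases "coeff (p x) d = 0")
      case True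
      have "?t y = p y" if "y \<in> {x, x'}" for y
      proof (rule poly_trunc_same)
        have c: "coeff (p y) d = 0" using that True z[of p d] by fastforce
        have "degree (p y) \<le> d" using le[of p y] by simp
        moreover have "degree (p y) \<noteq> d" using c d by (metis degree_0 leading_coeff_0_iff less_irrefl)
        ultimately show "degree (p y) \<le> d - 1" by simp
      qed
      then have tt: "?t x = p x" "?t x' = p x'" by auto
      have "same_signs E1 x x'" using E by (simp add: same_signs_def)
      then obtain \<sigma> where "sign_automorphism (P \<union> {?t}) \<sigma> x x'" using E1(3) by blast
      then have "sign_automorphism (insert p P) \<sigma> x x'" using tt by (simp add: sign_automorphism_def)
      then show ?thesis by blast
    next
      case False
      then have dp: "degree (p x) = d" using le[of p x] by (auto intro: antisym le_degree)
      have "same_signs E2 x x'" using E by (simp add: same_signs_def)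
      then obtain \<sigma> where \<sigma>: "sign_automorphism (P \<union> Q) \<sigma> x x'" using E2(3) by blast
      then have sg: "sgn (poly (q x) y) = sgn (poly (q x') (\<sigma> y))" if "q \<in> R \<union> Q" for q y
        using that by (auto simp: sign_automorphism_def R_def Q_def)
      \<comment> \<open>The true degree of \<open>q x\<close> selects the truncation. At a zero of
        \<open>q x\<close> the pseudo-remainder is \<open>p x\<close> times an even power of a
        nonzero coefficient, so both have the same sign.\<close>
      have key: "sgn (poly (p x) y) = sgn (poly (p x') (\<sigma> y))"
        if q: "q \<in> R" "q x \<noteq> 0" and y: "poly (q x) y = 0" for q y
      proof -
        define j where "j = degree (q x)"
        have "j \<noteq> 0"
        proof
          assume "j = 0"
          then obtain c where "q x = [:c:]" unfolding j_def using degree_eq_zeroE by blast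
          then show False using q y by auto
        qed
        then have j: "j \<in> {1..d}" using le[of q x] q by (auto simp: j_def)
        have nz: "coeff (q x) j \<noteq> 0" "coeff (q x') j \<noteq> 0" using q z[of q j] by (auto simp: j_def)
        have tr: "poly_trunc j (q x) = q x" "poly_trunc j (q x') = q x'"
          using dg[of q] q by (auto intro!: poly_trunc_same simp: j_def)
        have y': "poly (q x') (\<sigma> y) = 0" using sg[of q y] q y by (metis UnI1 sgn_0 sgn_0_0)
        obtain s N where "r q j x = smult (coeff (q x) j ^ (2 * N)) (p x) - s * poly_trunc j (q x)"
          using rs[OF q(1) j] by blast
        then have 1: "poly (r q j x) y = coeff (q x) j ^ (2 * N) * poly (p x) y" using tr y by simp
        obtain s' N' where "r q j x' = smult (coeff (q x') j ^ (2 * N')) (p x') - s' * poly_trunc j (q x')"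
          using rs[OF q(1) j] by blast
        then have 2: "poly (r q j x') (\<sigma> y) = coeff (q x') j ^ (2 * N') * poly (p x') (\<sigma> y)"
          using tr y' by simp
        have "r q j \<in> Q" using q j by (force simp: Q_def)
        then have "sgn (poly (r q j x) y) = sgn (poly (r q j x') (\<sigma> y))" using sg by blast
        moreover have "sgn (coeff (q x) j ^ (2 * N)) = 1" "sgn (coeff (q x') j ^ (2 * N')) = 1"
          using nz by (simp_all only: sgn_pos zero_less_power_eq even_mult_iff even_numeral simp_thms)
        ultimately show ?thesis by (simp add: 1 2 sgn_mult)
      qed
      have nz: "pderiv (p x) \<noteq> 0" using dp d by (auto simp: pderiv_eq_0_iff)
      have "\<exists>\<sigma>. strict_mono \<sigma> \<and> surj \<sigma> \<and>
          (\<forall>q\<in>P. \<forall>y. sgn (poly (q x) y) = sgn (poly (q x') (\<sigma> y))) \<and>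
          (\<forall>y. sgn (poly (p x) y) = sgn (poly (p x') (\<sigma> y)))"
      proof (rule adjoin_poly_automorphism[OF P(1), where \<sigma> = \<sigma>])
        show "strict_mono \<sigma>" "surj \<sigma>" using \<sigma> by (simp_all add: sign_automorphism_def)
        show "sgn (poly (q x) y) = sgn (poly (q x') (\<sigma> y))" if "q \<in> P" for q y
          using sg[of q y] that by (simp add: R_def)
        show "sgn (poly (pderiv (p x)) y) = sgn (poly (pderiv (p x')) (\<sigma> y))" for y
          using sg[of ?p' y] by (simp add: R_def)
        show "sgn (poly (p x) z) = sgn (poly (p x') (\<sigma> z))"
          if "q \<in> P" "q x \<noteq> 0" "poly (q x) z = 0" for q z using key[of q z] that by (simp add: R_def)
        show "sgn (poly (p x) z) = sgn (poly (p x') (\<sigma> z))"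
          if "poly (pderiv (p x)) z = 0" for z using key[of ?p' z] that nz by (simp add: R_def)
        show "degree (p x) = degree (p x')" using dg[of p] by simp
        then show "sgn (lead_coeff (p x)) = sgn (lead_coeff (p x'))" using cC[of p d] dp by simp
        show "0 < degree (p x)" using dp d by simp
      qed
      then show ?thesis by (auto simp: sign_automorphism_def)
    qed
  qed
  have "finite (E1 \<union> E2 \<union> C)" "E1 \<union> E2 \<union> C \<subseteq> A" using E1(1,2) E2(1,2) C by simp_all
  then show ?thesis using main by (rule sign_determinedI)
qed

text \<open>Induction on the degree bound. Members of top degree are adjoined one at a time to an
  arbitrary finite set \<open>Q\<close> of lower degree, because adjoining one of them calls for
  derivatives, truncations and remainders, which join \<open>Q\<close>.\<close>

theorem sign_determined_poly_family:
  assumes A: "function_ring A" and "finite P" "P \<subseteq> poly_family A d"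
  shows "sign_determined A P"
  using assms(2,3)
proof (induction d arbitrary: P)
  case 0
  define E where "E = (\<lambda>p x. coeff (p x) 0) ` P"
  have "finite E" "E \<subseteq> A" using 0 by (auto simp: E_def poly_family_def)
  moreover have "sign_automorphism P id x x'" if "same_signs E x x'" for x x'
  proof -
    have "poly (p z) y = coeff (p z) 0" if "p \<in> P" for p z y
    proof -
      have "degree (p z) = 0" using that 0 by (auto simp: poly_family_def)
      then obtain c where "p z = [:c:]" by (rule degree_eq_zeroE)
      then show ?thesis by simp
    qed
    moreover have "sgn (coeff (p x) 0) = sgn (coeff (p x') 0)" if "p \<in> P" for p
      using \<open>same_signs E x x'\<close> that by (auto simp: same_signs_def E_def)
    ultimately show ?thesis by (simp add: sign_automorphism_def strict_mono_def)
  qed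
  ultimately show ?case by (intro sign_determinedI[of E]) auto
next
  case (Suc d)
  have "sign_determined A (P \<union> Q)" if "finite Q" "Q \<subseteq> poly_family A d" for Q
    using Suc.prems that
  proof (induction P arbitrary: Q rule: finite_induct)
    case empty
    then show ?case using Suc.IH by simp
  next
    case (insert p P)
    have "sign_determined A (insert p (P \<union> Q))"
    proof (rule adjoin_poly_family[OF A, where d = "Suc d"])
      show "P \<union> Q \<subseteq> poly_family A (Suc d)"
        using insert.prems poly_family_mono[of _ A d "Suc d"] by auto
      fix Q' assume "finite Q'" "Q' \<subseteq> poly_family A (Suc d - 1)"
      then show "sign_determined A (P \<union> Q \<union> Q')"
        using insert.IH[of "Q \<union> Q'"] insert.prems by (simp add: Un_assoc)
    qed (use insert in auto)
    then show ?case by simp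
  qed
  from this[of "{}"] show ?case by simp
qed

section \<open>Convergent power series\<close>

text \<open>Fubini for unconditional sums, restated for \<open>suminf\<close>, in which the power
  series calculus below is carried out.\<close>

lemma summable_on_iterated_sums:
  fixes u :: "nat \<Rightarrow> nat \<Rightarrow> real"
  assumes "(\<lambda>(j, k). u j k) summable_on UNIV \<times> UNIV"
  shows "summable (\<lambda>j. u j k)" "summable (u j)" "summable (\<lambda>j. suminf (u j))"
    "(\<lambda>k. \<Sum>j. u j k) sums (\<Sum>j. suminf (u j))"
proof -
  obtain S where S: "((\<lambda>(j, k). u j k) has_sum S) (UNIV \<times> UNIV)" using assms by (auto simp: summable_on_def)
  then have S': "((\<lambda>(k, j). u j k) has_sum S) (UNIV \<times> UNIV)"
    by (subst (asm) has_sum_swap) (simp add: case_prod_unfold)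
  have 1: "(u j has_sum suminf (u j)) UNIV" for j
  proof -
    have "u j summable_on UNIV" using summable_on_SigmaD1[OF assms, of j] by simp
    then show ?thesis by (metis has_sum_imp_sums has_sum_infsum sums_unique)
  qed
  have 2: "((\<lambda>j. u j k) has_sum (\<Sum>j. u j k)) UNIV" for k
  proof -
    have "(\<lambda>j. u j k) summable_on UNIV"
      using summable_on_SigmaD1[of "\<lambda>k j. u j k" UNIV "\<lambda>_. UNIV" k] S' by (auto simp: summable_on_def)
    then show ?thesis by (metis has_sum_imp_sums has_sum_infsum sums_unique)
  qed
  show "summable (\<lambda>j. u j k)" "summable (u j)" using 1[THEN has_sum_imp_sums] 2[THEN has_sum_imp_sums]
    by (auto simp: sums_iff)
  have 3: "((\<lambda>j. suminf (u j)) has_sum S) UNIV"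
    by (rule has_sum_SigmaD[OF S]) (use 1 in simp)
  then have "(\<lambda>j. suminf (u j)) sums S" by (rule has_sum_imp_sums)
  then show "summable (\<lambda>j. suminf (u j))" and eq: "(\<lambda>k. \<Sum>j. u j k) sums (\<Sum>j. suminf (u j))"
  proof -
    assume *: "(\<lambda>j. suminf (u j)) sums S"
    show "summable (\<lambda>j. suminf (u j))" using * by (simp add: sums_iff)
    have "((\<lambda>k. \<Sum>j. u j k) has_sum S) UNIV"
      by (rule has_sum_SigmaD[OF S']) (use 2 in simp)
    then show "(\<lambda>k. \<Sum>j. u j k) sums (\<Sum>j. suminf (u j))"
      using * by (metis has_sum_imp_sums sums_unique)
  qed
qed

lemma dominated_double_series:
  fixes u b :: "nat \<Rightarrow> nat \<Rightarrow> real"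
  assumes ub: "\<And>j k. \<bar>u j k\<bar> \<le> b j k" and b: "\<And>j. summable (b j)" "summable (\<lambda>j. suminf (b j))"
  shows "summable (\<lambda>j. u j k)" "summable (\<lambda>j. suminf (u j))" "(\<lambda>k. \<Sum>j. u j k) sums (\<Sum>j. suminf (u j))"
proof -
  have b0: "0 \<le> b j k" for j k using ub[of j k] by linarith
  have "(\<lambda>(j, k). b j k) summable_on UNIV \<times> UNIV"
  proof (rule summable_on_SigmaI[where g = "\<lambda>j. suminf (b j)"])
    show "((\<lambda>y. case (j, y) of (j, k) \<Rightarrow> b j k) has_sum suminf (b j)) UNIV" for j
      using b(1)[of j] b0 by (auto intro!: sums_nonneg_imp_has_sum simp: summable_sums)
    show "(\<lambda>j. suminf (b j)) summable_on UNIV"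
      using b b0 by (intro summable_nonneg_imp_summable_on suminf_nonneg) auto
  qed (use b0 in auto)
  then have "(\<lambda>x. norm (case x of (j, k) \<Rightarrow> u j k)) summable_on UNIV \<times> UNIV"
    by (rule Infinite_Sum.abs_summable_on_comparison_test') (use ub in auto)
  then have *: "(\<lambda>(j, k). u j k) summable_on UNIV \<times> UNIV" by (rule abs_summable_summable)
  show "summable (\<lambda>j. u j k)" "summable (\<lambda>j. suminf (u j))" "(\<lambda>k. \<Sum>j. u j k) sums (\<Sum>j. suminf (u j))"
    using summable_on_iterated_sums[OF *] by auto
qed

lemma powser_eventually_nonzero:
  fixes a :: "nat \<Rightarrow> real"
  assumes s: "0 < s" and sm: "\<And>x. \<bar>x\<bar> < s \<Longrightarrow> (\<lambda>n. a n * x ^ n) sums f x" and a: "a m \<noteq> 0"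
  shows "eventually (\<lambda>x. f x \<noteq> 0) (at 0)"
proof -
  define d where "d = (LEAST n. a n \<noteq> 0)"
  have d: "a d \<noteq> 0" and lt: "\<And>n. n < d \<Longrightarrow> a n = 0"
    unfolding d_def using LeastI[of "\<lambda>n. a n \<noteq> 0", OF a] not_less_Least by blast+
  have "((\<lambda>x. f x / x ^ d) \<longlongrightarrow> a (0 + d)) (at 0)"
  proof (rule powser_limit_0_strong[OF s])
    fix x :: real assume x: "x \<noteq> 0" "norm x < s"
    have "(\<lambda>n. a (n + d) * x ^ (n + d)) sums (f x - (\<Sum>i<d. a i * x ^ i))"
      using sm[of x] x by (subst sums_iff_shift) auto
    then have "(\<lambda>n. a (n + d) * x ^ (n + d) / x ^ d) sums (f x / x ^ d)"
      using sums_divide[of _ "f x" "x ^ d"] lt by simp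
    then show "(\<lambda>n. a (n + d) * x ^ n) sums (f x / x ^ d)" using x by (simp add: power_add)
  qed
  then have "eventually (\<lambda>x. f x / x ^ d \<noteq> 0) (at 0)" using d by (intro tendsto_imp_eventually_ne) auto
  then show ?thesis by eventually_elim auto
qed

section \<open>Power series in several variables with majorants on boxes\<close>

definition polybox :: "'i set \<Rightarrow> ('i \<Rightarrow> real) \<Rightarrow> ('i \<Rightarrow> real) set" where
  "polybox I r = {x. \<forall>i\<in>I. \<bar>x i\<bar> \<le> r i}"

text \<open>\<open>pser I r f B\<close>: on the box of radii \<open>r\<close> the function \<open>f\<close> is the sum of a power series in the
  variables \<open>x i\<close>, \<open>i \<in> I\<close>, for which the absolute values of the terms at \<open>r\<close> have sum at most \<open>B\<close>.\<close>

inductive pser :: "'i set \<Rightarrow> ('i \<Rightarrow> real) \<Rightarrow> (('i \<Rightarrow> real) \<Rightarrow> real) \<Rightarrow> real \<Rightarrow> bool" for I r where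
  const: "\<bar>v\<bar> \<le> B \<Longrightarrow> pser I r (\<lambda>_. v) B"
| coord: "i \<in> I \<Longrightarrow> pser I r (\<lambda>x. x i) (r i)"
| mult: "pser I r f B \<Longrightarrow> pser I r g C \<Longrightarrow> pser I r (\<lambda>x. f x * g x) (B * C)"
| series: "(\<And>k. pser I r (f k) (B k)) \<Longrightarrow> summable B \<Longrightarrow>
    (\<And>x. x \<in> polybox I r \<Longrightarrow> (\<lambda>k::nat. f k x) sums g x) \<Longrightarrow> pser I r g (suminf B)"

text \<open>Variables outside \<open>I\<close> stay in the type but do not influence the value. This
  replaces the passage to functions of fewer variables when a variable is eliminated.\<close>

lemma pser_local:
  assumes "pser I r f B" "x \<in> polybox I r" "\<And>i. i \<in> I \<Longrightarrow> x i = y i"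
  shows "f x = f y"
  using assms(1)
proof induction
  case (series f B g)
  have "y \<in> polybox I r" using assms by (auto simp: polybox_def)
  then have "(\<lambda>k. f k x) sums g y" using series by simp
  then show ?case using series.hyps(3)[OF assms(2)] sums_unique2 by blast
qed (use assms in auto)

lemma pser_bound:
  assumes "pser I r f B" "x \<in> polybox I r"
  shows "\<bar>f x\<bar> \<le> B"
  using assms(1)
proof induction
  case (mult f B g C)
  then show ?case unfolding abs_mult by (intro mult_mono) auto
next
  case (series f B g)
  have "(\<lambda>k. f k x) sums g x" using series assms by blast
  then have "g x = (\<Sum>k. f k x)" by (simp add: sums_iff)
  moreover have "summable (\<lambda>k. \<bar>f k x\<bar>)"
    using series.IH series.hyps(2) by (intro summable_comparison_test'[OF series.hyps(2)]) auto
  then have "\<bar>\<Sum>k. f k x\<bar> \<le> (\<Sum>k. \<bar>f k x\<bar>)" by (rule summable_rabs)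
  moreover have "(\<Sum>k. \<bar>f k x\<bar>) \<le> suminf B"
    using series.IH series.hyps(2) \<open>summable (\<lambda>k. \<bar>f k x\<bar>)\<close> by (intro suminf_le) auto
  ultimately show ?case by simp
qed (use assms in \<open>auto simp: polybox_def\<close>)

lemma pser_nonneg:
  assumes "pser I r f B" "\<And>i. i \<in> I \<Longrightarrow> 0 \<le> r i"
  shows "0 \<le> B"
proof -
  have "(\<lambda>_. 0) \<in> polybox I r" using assms by (auto simp: polybox_def)
  then show ?thesis using pser_bound[OF assms(1)] by (metis abs_ge_zero order_trans)
qed

lemma pser_add:
  assumes "pser I r f B" "pser I r g C"
  shows "pser I r (\<lambda>x. f x + g x) (B + C)"
proof -
  let ?h = "\<lambda>k::nat. if k = 0 then f else if k = 1 then g else (\<lambda>_. 0)"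
  let ?D = "\<lambda>k::nat. if k = 0 then B else if k = 1 then C else 0"
  have s: "(\<lambda>k::nat. if k = 0 then u else if k = 1 then v else 0) sums (u + v)" for u v :: real
    using sums_finite[of "{0, 1::nat}" "\<lambda>k. if k = 0 then u else if k = 1 then v else 0"] by auto
  have "pser I r (\<lambda>x. f x + g x) (suminf ?D)"
  proof (rule pser.series[where f = ?h])
    show "pser I r (?h k) (?D k)" for k using assms by (auto intro: pser.const)
    show "summable ?D" using s by (rule sums_summable)
    have "(\<lambda>k. ?h k x) = (\<lambda>k. if k = 0 then f x else if k = 1 then g x else 0)" for x by auto
    then show "(\<lambda>k. ?h k x) sums (f x + g x)" for x using s by simp
  qed
  then show ?thesis using s[of B C] by (simp add: sums_iff)
qed

lemma pser_mono:
  assumes "pser I r f B" "B \<le> C"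
  shows "pser I r f C"
  using pser_add[OF assms(1) pser.const[of 0 "C - B" I r]] assms(2) by simp

lemma pser_cmult: "pser I r f B \<Longrightarrow> pser I r (\<lambda>x. c * f x) (\<bar>c\<bar> * B)"
  by (rule pser.mult[OF pser.const]) auto

lemma pser_power: "pser I r f B \<Longrightarrow> pser I r (\<lambda>x. f x ^ k) (B ^ k)"
  by (induction k) (auto intro: pser.const pser.mult)

text \<open>Replacing each variable by a series bounded by its radius leaves the bound unchanged.
  The inductive form of \<open>pser\<close> makes this immediate: no multi-indexed series has to be
  expanded or rearranged.\<close>

lemma pser_compose:
  assumes f: "pser I r f B" and g: "\<And>i. i \<in> I \<Longrightarrow> pser J s (\<lambda>x. g x i) (r i)"
  shows "pser J s (\<lambda>x. f (g x)) B"
  using f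
proof induction
  case (series f B h)
  show ?case
  proof (rule pser.series[OF series.IH series.hyps(2)])
    fix x assume "x \<in> polybox J s"
    then have "g x \<in> polybox I r" using pser_bound[OF g] by (auto simp: polybox_def)
    then show "(\<lambda>k. f k (g x)) sums h (g x)" by (rule series.hyps(3))
  qed
qed (auto intro: pser.intros g)

lemma pser_widen:
  assumes "pser I r f B" "I \<subseteq> J" "\<And>i. i \<in> I \<Longrightarrow> s i \<le> r i"
  shows "pser J s f B"
proof (rule pser_compose[OF assms(1), of J s "\<lambda>x. x"])
  show "pser J s (\<lambda>x. x i) (r i)" if "i \<in> I" for i
    using that assms(2,3) by (intro pser_mono[OF pser.coord]) auto
qed

text \<open>Induction on the derivation: Cauchy products for products, exchange of summations for
  series. The bounds \<open>b k\<close>, weighted by powers of \<open>r j\<close>, dominate all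
  these rearrangements because they sum to at most \<open>B\<close>.\<close>

lemma pser_expand:
  assumes f: "pser (insert j I) r f B" and j: "j \<notin> I" and r: "0 < r j" "\<And>i. i \<in> I \<Longrightarrow> 0 \<le> r i"
  shows "\<exists>a b. (\<forall>k. pser I r (a k) (b k)) \<and> summable (\<lambda>k. b k * r j ^ k) \<and> (\<Sum>k. b k * r j ^ k) \<le> B \<and>
    (\<forall>x\<in>polybox (insert j I) r. (\<lambda>k. a k x * x j ^ k) sums f x)"
  using f
proof induction
  case (const v B)
  have s: "(\<lambda>k::nat. (if k = 0 then u else 0) * z ^ k) sums u" for u z :: real
    using sums_finite[of "{0::nat}" "\<lambda>k. (if k = 0 then u else 0) * z ^ k"] by auto
  show ?case using const s[of B "r j"] s
    by (intro exI[of _ "\<lambda>k _. if k = 0 then v else 0"] exI[of _ "\<lambda>k. if k = 0 then B else 0"])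
      (auto simp: sums_iff intro: pser.const)
next
  case (coord i)
  show ?case
  proof (cases "i = j")
    case True
    have s: "(\<lambda>k::nat. (if k = 1 then 1 else 0) * z ^ k) sums z" for z :: real
      using sums_finite[of "{1::nat}" "\<lambda>k. (if k = 1 then 1 else 0) * z ^ k"] by auto
    show ?thesis using True s[of "r j"] s
      by (intro exI[of _ "\<lambda>k _. if k = 1 then 1 else 0"] exI[of _ "\<lambda>k. if k = 1 then 1 else 0"])
        (auto simp: sums_iff intro: pser.const)
  next
    case False
    have s: "(\<lambda>k::nat. (if k = 0 then u else 0) * z ^ k) sums u" for u z :: real
      using sums_finite[of "{0::nat}" "\<lambda>k. (if k = 0 then u else 0) * z ^ k"] by auto
    show ?thesis using False coord s[of "r i" "r j"] s
      by (intro exI[of _ "\<lambda>k x. if k = 0 then x i else 0"] exI[of _ "\<lambda>k. if k = 0 then r i else 0"])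
        (auto simp: sums_iff intro: pser.const pser.coord)
  qed
next
  case (mult f B g C)
  obtain a b where a: "\<And>k. pser I r (a k) (b k)" and b: "summable (\<lambda>k. b k * r j ^ k)" "(\<Sum>k. b k * r j ^ k) \<le> B"
    and fa: "\<And>x. x \<in> polybox (insert j I) r \<Longrightarrow> (\<lambda>k. a k x * x j ^ k) sums f x" using mult.IH(1) by blast
  obtain c d where c: "\<And>k. pser I r (c k) (d k)" and d: "summable (\<lambda>k. d k * r j ^ k)" "(\<Sum>k. d k * r j ^ k) \<le> C"
    and gc: "\<And>x. x \<in> polybox (insert j I) r \<Longrightarrow> (\<lambda>k. c k x * x j ^ k) sums g x" using mult.IH(2) by blast
  have b0: "0 \<le> b k" and d0: "0 \<le> d k" for k using a c r(2) pser_nonneg by blast+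
  have cauchy: "(\<lambda>k. (\<Sum>i\<le>k. u i * v (k - i)) * z ^ k) sums ((\<Sum>k. u k * z ^ k) * (\<Sum>k. v k * z ^ k))"
    if "summable (\<lambda>k. norm (u k * z ^ k))" "summable (\<lambda>k. norm (v k * z ^ k))" for u v :: "nat \<Rightarrow> real" and z
  proof -
    have "(\<Sum>i\<le>k. u i * v (k - i)) * z ^ k = (\<Sum>i\<le>k. (u i * z ^ i) * (v (k - i) * z ^ (k - i)))" for k
      unfolding sum_distrib_right
    proof (rule sum.cong)
      fix i assume "i \<in> {..k}"
      then have "z ^ k = z ^ i * z ^ (k - i)" by (simp flip: power_add)
      then show "u i * v (k - i) * z ^ k = (u i * z ^ i) * (v (k - i) * z ^ (k - i))" by simp
    qed simp
    then show ?thesis using Cauchy_product_sums[OF that] by simp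
  qed
  define e where "e k x = (\<Sum>i\<le>k. a i x * c (k - i) x)" for k x
  define h where "h k = (\<Sum>i\<le>k. b i * d (k - i))" for k
  have sumI: "pser I r (\<lambda>x. \<Sum>i\<in>S. p i x) (\<Sum>i\<in>S. q i)"
    if "finite S" "\<And>i. i \<in> S \<Longrightarrow> pser I r (p i) (q i)" for S :: "nat set" and p q
    using that by (induction S rule: finite_induct) (auto intro: pser.const pser_add)
  have "pser I r (e k) (h k)" for k unfolding e_def h_def using a c by (intro sumI pser.mult) auto
  moreover have hs: "(\<lambda>k. h k * r j ^ k) sums ((\<Sum>k. b k * r j ^ k) * (\<Sum>k. d k * r j ^ k))"
    unfolding h_def by (rule cauchy) (use b d b0 d0 r in \<open>simp_all add: abs_mult\<close>)
  moreover have "(\<Sum>k. h k * r j ^ k) \<le> B * C"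
  proof -
    have "0 \<le> (\<Sum>k. d k * r j ^ k)" using d d0 r by (intro suminf_nonneg) auto
    moreover have "0 \<le> (\<Sum>k. b k * r j ^ k)" using b b0 r by (intro suminf_nonneg) auto
    ultimately show ?thesis using hs b d by (auto simp: sums_iff intro!: mult_mono)
  qed
  moreover have "(\<lambda>k. e k x * x j ^ k) sums (f x * g x)" if x: "x \<in> polybox (insert j I) r" for x
  proof -
    have x': "x \<in> polybox I r" "\<bar>x j\<bar> \<le> r j" using x by (auto simp: polybox_def)
    have dom: "\<bar>p * x j ^ k\<bar> \<le> q * r j ^ k" if "\<bar>p\<bar> \<le> q" for p q k
      using that x'(2) unfolding abs_mult power_abs by (intro mult_mono power_mono) auto
    have "summable (\<lambda>k. norm (a k x * x j ^ k))"
      by (rule summable_comparison_test'[OF b(1)]) (use dom[OF pser_bound[OF a x'(1)]] in auto)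
    moreover have "summable (\<lambda>k. norm (c k x * x j ^ k))"
      by (rule summable_comparison_test'[OF d(1)]) (use dom[OF pser_bound[OF c x'(1)]] in auto)
    ultimately have "(\<lambda>k. (\<Sum>i\<le>k. a i x * c (k - i) x) * x j ^ k) sums
        ((\<Sum>k. a k x * x j ^ k) * (\<Sum>k. c k x * x j ^ k))" by (rule cauchy)
    then show ?thesis unfolding e_def using fa[OF x] gc[OF x] by (simp add: sums_iff)
  qed
  ultimately show ?case by (intro exI[of _ e] exI[of _ h]) (auto simp: sums_iff)
next
  case (series f B g)
  define Q where "Q l a b \<longleftrightarrow> (\<forall>k. pser I r (a k) (b k)) \<and> summable (\<lambda>k. b k * r j ^ k) \<and>
    (\<Sum>k. b k * r j ^ k) \<le> B l \<and> (\<forall>x\<in>polybox (insert j I) r. (\<lambda>k. a k x * x j ^ k) sums f l x)" for l a b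
  have "\<exists>a b. Q l a b" for l using series.IH unfolding Q_def .
  then obtain a b where "Q l (a l) (b l)" for l by metis
  then have a: "\<And>l k. pser I r (a l k) (b l k)" and b: "\<And>l. summable (\<lambda>k. b l k * r j ^ k)"
      "\<And>l. (\<Sum>k. b l k * r j ^ k) \<le> B l"
    and fa: "\<And>l x. x \<in> polybox (insert j I) r \<Longrightarrow> (\<lambda>k. a l k x * x j ^ k) sums f l x"
    by (simp_all add: Q_def)
  have b0: "0 \<le> b l k" for l k using a r(2) pser_nonneg by blast
  have sB: "summable (\<lambda>l. \<Sum>k. b l k * r j ^ k)"
  proof (rule summable_comparison_test'[OF series.hyps(2)])
    have "0 \<le> (\<Sum>k. b l k * r j ^ k)" for l using b b0 r by (intro suminf_nonneg) auto
    then show "norm (\<Sum>k. b l k * r j ^ k) \<le> B l" for l using b(2) by simp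
  qed
  have dbl: "summable (\<lambda>l. u l k)" "summable (\<lambda>l. suminf (u l))" "(\<lambda>k. \<Sum>l. u l k) sums (\<Sum>l. suminf (u l))"
    if "\<And>l k. \<bar>u l k\<bar> \<le> b l k * r j ^ k" for u k
    using dominated_double_series[OF that b(1) sB] by auto
  define h where "h k = (\<Sum>l. b l k)" for k
  define e where "e k x = (\<Sum>l. a l k x)" for k x
  have sb: "summable (\<lambda>l. b l k)" for k
  proof -
    have "summable (\<lambda>l. b l k * r j ^ k)" using b0 r by (intro dbl(1)) auto
    then show ?thesis using r(1) summable_mult_D[of "r j ^ k" "\<lambda>l. b l k"] by (simp add: mult.commute)
  qed
  have sa: "summable (\<lambda>l. a l k x)" if "x \<in> polybox I r" for k x
    using pser_bound[OF a that] by (intro summable_comparison_test'[OF sb[of k]]) auto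
  have "pser I r (e k) (h k)" for k
    unfolding h_def by (rule pser.series[OF a sb]) (simp add: e_def summable_sums sa)
  moreover have hs: "(\<lambda>k. h k * r j ^ k) sums (\<Sum>l. \<Sum>k. b l k * r j ^ k)"
  proof -
    have "h k * r j ^ k = (\<Sum>l. b l k * r j ^ k)" for k unfolding h_def using sb by (rule suminf_mult2)
    then show ?thesis using dbl(3)[of "\<lambda>l k. b l k * r j ^ k"] b0 r by simp
  qed
  moreover have "(\<Sum>k. h k * r j ^ k) \<le> suminf B"
    using hs suminf_le[OF b(2) sB series.hyps(2)] by (simp add: sums_iff)
  moreover have "(\<lambda>k. e k x * x j ^ k) sums g x" if x: "x \<in> polybox (insert j I) r" for x
  proof -
    have x': "x \<in> polybox I r" "\<bar>x j\<bar> \<le> r j" using x by (auto simp: polybox_def)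
    have "\<bar>a l k x * x j ^ k\<bar> \<le> b l k * r j ^ k" for l k
      using pser_bound[OF a x'(1)] x'(2) b0 unfolding abs_mult power_abs by (intro mult_mono power_mono) auto
    note dbl[of "\<lambda>l k. a l k x * x j ^ k", OF this]
    moreover have "e k x * x j ^ k = (\<Sum>l. a l k x * x j ^ k)" for k
      unfolding e_def using sa[OF x'(1)] by (rule suminf_mult2)
    moreover have "(\<Sum>k. a l k x * x j ^ k) = f l x" for l using fa[OF x] by (simp add: sums_iff)
    ultimately show ?thesis using series.hyps(3)[OF x] by (simp add: sums_iff)
  qed
  ultimately show ?case by (intro exI[of _ e] exI[of _ h]) (auto simp: sums_iff)
qed

lemma pser_expandE:
  assumes "pser (insert j I) r f B" "j \<notin> I" "0 < r j" "\<forall>i\<in>I. 0 \<le> r i"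
  obtains a b where "\<And>k. pser I r (a k) (b k)" "summable (\<lambda>k. b k * r j ^ k)" "(\<Sum>k. b k * r j ^ k) \<le> B"
    "\<And>x. x \<in> polybox (insert j I) r \<Longrightarrow> (\<lambda>k. a k x * x j ^ k) sums f x"
proof -
  have "\<exists>a b. (\<forall>k. pser I r (a k) (b k)) \<and> summable (\<lambda>k. b k * r j ^ k) \<and> (\<Sum>k. b k * r j ^ k) \<le> B \<and>
      (\<forall>x\<in>polybox (insert j I) r. (\<lambda>k. a k x * x j ^ k) sums f x)"
    by (rule pser_expand[OF assms(1-3)]) (use assms(4) in blast)
  then show thesis by (elim exE conjE) (rule that, auto)
qed

text \<open>The nonconstant part shrinks linearly with the box. The summand
  \<open>\<bar>f (\<lambda>_. 0)\<bar>\<close> in the estimate is carried along for the sake of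
  products, where \<open>(D + \<bar>u\<bar>) * (E + \<bar>v\<bar>) \<le> B * C\<close> and
  \<open>l * l \<le> l\<close> close the induction.\<close>

lemma pser_scale:
  assumes "pser I r f B" "0 < l" "l \<le> 1" "\<And>i. i \<in> I \<Longrightarrow> 0 \<le> r i"
  shows "\<exists>C\<ge>0. C + \<bar>f (\<lambda>_. 0)\<bar> \<le> B \<and> pser I (\<lambda>i. l * r i) (\<lambda>x. f x - f (\<lambda>_. 0)) (l * C)"
  using assms(1)
proof induction
  case (const v B)
  then show ?case by (intro exI[of _ 0]) (auto intro: pser.const)
next
  case (coord i)
  then show ?case using assms(4) pser.coord[of i I "\<lambda>i. l * r i"] by (intro exI[of _ "r i"]) auto
next
  case (mult f B g C)
  obtain D where D: "0 \<le> D" "D + \<bar>f (\<lambda>_. 0)\<bar> \<le> B" "pser I (\<lambda>i. l * r i) (\<lambda>x. f x - f (\<lambda>_. 0)) (l * D)"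
    using mult by blast
  obtain E where E: "0 \<le> E" "E + \<bar>g (\<lambda>_. 0)\<bar> \<le> C" "pser I (\<lambda>i. l * r i) (\<lambda>x. g x - g (\<lambda>_. 0)) (l * E)"
    using mult by blast
  define u v where "u = f (\<lambda>_. 0)" and "v = g (\<lambda>_. 0)"
  let ?F = "D * E + (\<bar>u\<bar> * E + \<bar>v\<bar> * D)"
  have h: "pser I (\<lambda>i. l * r i) (\<lambda>x. (f x - u) * (g x - v) + (u * (g x - v) + v * (f x - u)))
      ((l * D) * (l * E) + (\<bar>u\<bar> * (l * E) + \<bar>v\<bar> * (l * D)))"
    using D(3) E(3) unfolding u_def v_def by (intro pser_add pser.mult pser_cmult)
  have eq: "(\<lambda>x. (f x - u) * (g x - v) + (u * (g x - v) + v * (f x - u))) = (\<lambda>x. f x * g x - u * v)"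
    by (rule ext) (simp add: algebra_simps)
  have le: "(l * D) * (l * E) + (\<bar>u\<bar> * (l * E) + \<bar>v\<bar> * (l * D)) \<le> l * ?F"
  proof -
    have "l * l \<le> l" using assms(2,3) by (simp add: mult_left_le)
    then have "(l * l) * (D * E) \<le> l * (D * E)" using D E by (intro mult_right_mono) auto
    then show ?thesis by (simp add: algebra_simps)
  qed
  have "pser I (\<lambda>i. l * r i) (\<lambda>x. f x * g x - u * v) (l * ?F)"
    using pser_mono[OF h le] unfolding eq .
  moreover have "?F + \<bar>u * v\<bar> \<le> B * C"
  proof -
    have "?F + \<bar>u * v\<bar> = (D + \<bar>u\<bar>) * (E + \<bar>v\<bar>)" by (simp add: algebra_simps abs_mult)
    also have "\<dots> \<le> B * C" using D E by (intro mult_mono) (auto simp: u_def v_def)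
    finally show ?thesis .
  qed
  moreover have "0 \<le> ?F" using D E by auto
  ultimately show ?case unfolding u_def v_def by blast
next
  case (series f B g)
  then obtain D where D: "\<And>k. 0 \<le> D k" "\<And>k. D k + \<bar>f k (\<lambda>_. 0)\<bar> \<le> B k"
    "\<And>k. pser I (\<lambda>i. l * r i) (\<lambda>x. f k x - f k (\<lambda>_. 0)) (l * D k)" by metis
  have z: "(\<lambda>_. 0) \<in> polybox I r" using assms(4) by (auto simp: polybox_def)
  have sD: "summable D" and sf: "summable (\<lambda>k. \<bar>f k (\<lambda>_. 0)\<bar>)"
    using D(1,2) by (auto intro!: summable_comparison_test'[OF series.hyps(2)]) (smt (verit))+
  have sub: "x \<in> polybox I r" if "x \<in> polybox I (\<lambda>i. l * r i)" for x
    using that assms(3,4) by (auto simp: polybox_def intro: order_trans mult_left_le_one_le assms(2) less_imp_le)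
      (meson assms(2,3) less_imp_le mult_left_le_one_le order_trans)
  have "pser I (\<lambda>i. l * r i) (\<lambda>x. g x - g (\<lambda>_. 0)) (\<Sum>k. l * D k)"
  proof (rule pser.series[OF D(3)])
    show "(\<lambda>k. f k x - f k (\<lambda>_. 0)) sums (g x - g (\<lambda>_. 0))" if "x \<in> polybox I (\<lambda>i. l * r i)" for x
      using sub[OF that] z by (intro sums_diff series.hyps(3))
  qed (use sD in simp)
  moreover have "(\<Sum>k. l * D k) = l * suminf D" using sD by (rule suminf_mult)
  moreover have "suminf D + \<bar>g (\<lambda>_. 0)\<bar> \<le> suminf B"
  proof -
    have "\<bar>g (\<lambda>_. 0)\<bar> \<le> (\<Sum>k. \<bar>f k (\<lambda>_. 0)\<bar>)"
      using series.hyps(3)[OF z] summable_rabs[OF sf] by (simp add: sums_iff)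
    moreover have "suminf D + (\<Sum>k. \<bar>f k (\<lambda>_. 0)\<bar>) = (\<Sum>k. D k + \<bar>f k (\<lambda>_. 0)\<bar>)"
      using sD sf by (rule suminf_add)
    moreover have "\<dots> \<le> suminf B" using D(2) sD sf series.hyps(2) by (intro suminf_le summable_add)
    ultimately show ?thesis by linarith
  qed
  ultimately show ?case using D(1) sD by (intro exI[of _ "suminf D"]) (auto intro: suminf_nonneg)
qed

text \<open>On the line through \<open>v\<close> this is a power series in one variable, not
  identically zero because of its value at 1.\<close>

lemma pser_ray_eventually_nonzero:
  assumes f: "pser I r f B" and v: "v \<in> polybox I r" "f v \<noteq> 0"
  shows "eventually (\<lambda>s. f (\<lambda>i. s * v i) \<noteq> 0) (at 0)"
proof -
  have "pser {()} (\<lambda>_. 1) (\<lambda>x. f (\<lambda>i. x () * v i)) B"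
  proof (rule pser_compose[OF f])
    fix i assume "i \<in> I"
    then have "\<bar>v i\<bar> * 1 \<le> r i" using v by (auto simp: polybox_def)
    then show "pser {()} (\<lambda>_. 1) (\<lambda>x. x () * v i) (r i)"
      using pser_mono[OF pser_cmult[OF pser.coord[of "()" "{()}" "\<lambda>_. 1"], of "v i"]] by (simp add: mult.commute)
  qed
  then obtain a b where a: "\<And>k. pser {} (\<lambda>_::unit. 1) (a k) (b k)"
    and s: "\<And>x. x \<in> polybox {()} (\<lambda>_. 1) \<Longrightarrow> (\<lambda>k. a k x * x () ^ k) sums f (\<lambda>i. x () * v i)"
    using pser_expand[of "()" "{}" "\<lambda>_. 1"] by force
  define c where "c k = a k (\<lambda>_. 0)" for k
  have "a k x = c k" for k x unfolding c_def by (rule pser_local[OF a]) (auto simp: polybox_def)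
  then have s': "(\<lambda>k. c k * z ^ k) sums f (\<lambda>i. z * v i)" if "\<bar>z\<bar> \<le> 1" for z
    using s[of "\<lambda>_. z"] that by (auto simp: polybox_def)
  have "\<exists>m. c m \<noteq> 0"
  proof (rule ccontr)
    assume "\<nexists>m. c m \<noteq> 0"
    then have "(\<lambda>k. 0) sums f v" using s'[of 1] by simp
    from sums_unique2[OF this sums_zero] show False using v by simp
  qed
  then obtain m where m: "c m \<noteq> 0" ..
  show ?thesis
  proof (rule powser_eventually_nonzero[where a = c and s = 1 and m = m])
    show "(\<lambda>n. c n * x ^ n) sums f (\<lambda>i. x * v i)" if "\<bar>x\<bar> < 1" for x using that by (intro s') simp
  qed (use m in auto)
qed

text \<open>Power series on a box form an integral domain. If \<open>a k\<close> and
  \<open>c l\<close> are nonzero coefficients of \<open>f\<close> and \<open>g\<close> in powers of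
  \<open>x j\<close>, the induction hypothesis gives a point \<open>z\<close> where neither
  vanishes; along the direction \<open>j\<close> through \<open>z\<close> both functions are nonzero
  close to, but off, the value 0 of that coordinate.\<close>

lemma pser_mult_nonzero:
  assumes "finite I" "\<And>i. i \<in> I \<Longrightarrow> 0 < r i" "pser I r f B" "pser I r g C"
    "x \<in> polybox I r" "f x \<noteq> 0" "y \<in> polybox I r" "g y \<noteq> 0"
  shows "\<exists>z \<in> polybox I r. f z * g z \<noteq> 0"
  using assms
proof (induction I arbitrary: f g B C x y rule: finite_induct)
  case empty
  have "f x = f y" by (rule pser_local[OF empty.prems(2)]) (auto simp: polybox_def)
  then show ?case using empty by force
next
  case (insert j I)
  have r: "0 < r j" "\<And>i. i \<in> I \<Longrightarrow> 0 < r i" "\<And>i. i \<in> I \<Longrightarrow> 0 \<le> r i" using insert.prems(1) by (auto intro: less_imp_le)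
  obtain a b where a: "\<And>k. pser I r (a k) (b k)"
    and fa: "\<And>x. x \<in> polybox (insert j I) r \<Longrightarrow> (\<lambda>k. a k x * x j ^ k) sums f x"
    using pser_expand[OF insert.prems(2) insert.hyps(2) r(1,3)] by blast
  obtain c d where c: "\<And>k. pser I r (c k) (d k)"
    and gc: "\<And>x. x \<in> polybox (insert j I) r \<Longrightarrow> (\<lambda>k. c k x * x j ^ k) sums g x"
    using pser_expand[OF insert.prems(3) insert.hyps(2) r(1,3)] by blast
  have sub: "x \<in> polybox I r" if "x \<in> polybox (insert j I) r" for x using that by (auto simp: polybox_def)
  have nz: "\<exists>k. u k \<noteq> 0" if "(\<lambda>k. u k * z ^ k) sums w" "w \<noteq> 0" for u :: "nat \<Rightarrow> real" and z w
  proof (rule ccontr)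
    assume "\<nexists>k. u k \<noteq> 0"
    then have "(\<lambda>k::nat. 0::real) sums w" using that(1) by simp
    from sums_unique2[OF this sums_zero] show False using that(2) by simp
  qed
  obtain k where k: "a k x \<noteq> 0" using nz[OF fa[OF insert.prems(4)] insert.prems(5)] by blast
  obtain l where l: "c l y \<noteq> 0" using nz[OF gc[OF insert.prems(6)] insert.prems(7)] by blast
  obtain z where z: "z \<in> polybox I r" "a k z * c l z \<noteq> 0"
    using insert.IH[OF r(2) a c sub[OF insert.prems(4)] k sub[OF insert.prems(6)] l] by blast
  have zs: "z(j := s) \<in> polybox (insert j I) r" if "\<bar>s\<bar> < r j" for s
    using z(1) that by (auto simp: polybox_def)
  have az: "a m (z(j := s)) = a m z" "c m (z(j := s)) = c m z" for m s
    using insert.hyps(2) pser_local[OF a z(1)] pser_local[OF c z(1)] by (metis fun_upd_other)+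
  have "(\<lambda>k. a k z * s ^ k) sums f (z(j := s))" "(\<lambda>k. c k z * s ^ k) sums g (z(j := s))" if "\<bar>s\<bar> < r j" for s
    using fa[OF zs[OF that]] gc[OF zs[OF that]] by (simp_all add: az)
  note fg = this
  have "eventually (\<lambda>s. f (z(j := s)) \<noteq> 0) (at 0)"
    by (rule powser_eventually_nonzero[where a = "\<lambda>k. a k z" and m = k, OF r(1)])
      (use fg(1) z(2) in simp_all)
  moreover have "eventually (\<lambda>s. g (z(j := s)) \<noteq> 0) (at 0)"
    by (rule powser_eventually_nonzero[where a = "\<lambda>k. c k z" and m = l, OF r(1)])
      (use fg(2) z(2) in simp_all)
  moreover have "eventually (\<lambda>s. \<bar>s\<bar> < r j) (at (0::real))"
    using r(1) by (auto simp: eventually_at dist_real_def)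
  ultimately have "eventually (\<lambda>s. f (z(j := s)) \<noteq> 0 \<and> g (z(j := s)) \<noteq> 0 \<and> \<bar>s\<bar> < r j) (at 0)"
    by eventually_elim auto
  then obtain s where "f (z(j := s)) \<noteq> 0" "g (z(j := s)) \<noteq> 0" "\<bar>s\<bar> < r j"
    using eventually_happens at_neq_bot by blast
  then have "f (z(j := s)) * g (z(j := s)) \<noteq> 0" by (simp del: fun_upd_apply)
  then show ?case using zs[OF \<open>\<bar>s\<bar> < r j\<close>] by blast
qed

lemma pser_common_nonzero:
  assumes "finite I" "\<And>i. i \<in> I \<Longrightarrow> 0 < r i" "finite F"
    and "\<And>f. f \<in> F \<Longrightarrow> \<exists>B. pser I r f B" "\<And>f. f \<in> F \<Longrightarrow> \<exists>x \<in> polybox I r. f x \<noteq> 0"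
  shows "\<exists>x \<in> polybox I r. \<forall>f\<in>F. f x \<noteq> 0"
proof -
  have "\<exists>B. pser I r (\<lambda>x. \<Prod>f\<in>F. f x) B \<and> (\<exists>x \<in> polybox I r. (\<Prod>f\<in>F. f x) \<noteq> 0)"
    using assms(3-5)
  proof (induction F rule: finite_induct)
    case empty
    have "(\<lambda>_. 0) \<in> polybox I r" using assms(2) by (auto simp: polybox_def intro: less_imp_le)
    then show ?case using pser.const[of 1 1 I r] by auto
  next
    case (insert f F)
    obtain B x where B: "pser I r (\<lambda>x. \<Prod>f\<in>F. f x) B" "x \<in> polybox I r" "(\<Prod>f\<in>F. f x) \<noteq> 0"
      using insert.IH insert.prems by auto
    obtain C y where C: "pser I r f C" "y \<in> polybox I r" "f y \<noteq> 0" using insert.prems by blast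
    have eq: "(\<Prod>f\<in>insert f F. f x) = f x * (\<Prod>f\<in>F. f x)" for x using insert.hyps by simp
    obtain z where z: "z \<in> polybox I r" "f z * (\<Prod>f\<in>F. f z) \<noteq> 0"
      using pser_mult_nonzero[OF assms(1,2) C(1) B(1) C(2,3) B(2,3)] by blast
    show ?case unfolding eq
      by (intro exI[of _ "C * B"] conjI bexI[of _ z] pser.mult C(1) B(1) z)
  qed
  then obtain x where x: "x \<in> polybox I r" "(\<Prod>f\<in>F. f x) \<noteq> 0" by (elim exE conjE bexE)
  then have "f x \<noteq> 0" if "f \<in> F" for f using prod_zero[OF assms(3)] that by metis
  then show ?thesis using x(1) by blast
qed

lemma pser_power_series:
  assumes a: "\<And>k. pser I r (a k) (b k)" and b: "summable (\<lambda>k. b k * r j ^ k)" and r: "0 \<le> r j" "\<And>i. i \<in> I \<Longrightarrow> 0 \<le> r i"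
  shows "pser (insert j I) r (\<lambda>x. \<Sum>k. a k x * x j ^ k) (\<Sum>k. b k * r j ^ k)"
    and "x \<in> polybox (insert j I) r \<Longrightarrow> summable (\<lambda>k. a k x * x j ^ k)"
proof -
  have P: "pser (insert j I) r (\<lambda>x. a k x * x j ^ k) (b k * r j ^ k)" for k
    by (intro pser.mult pser_power pser.coord pser_widen[OF a]) auto
  show s: "summable (\<lambda>k. a k x * x j ^ k)" if "x \<in> polybox (insert j I) r" for x
    by (rule summable_comparison_test'[OF b]) (use pser_bound[OF P that] in simp)
  show "pser (insert j I) r (\<lambda>x. \<Sum>k. a k x * x j ^ k) (\<Sum>k. b k * r j ^ k)"
    by (rule pser.series[OF P b]) (use s in \<open>simp add: summable_sums\<close>)
qed

lemma summable_shift_weight: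
  fixes b :: "nat \<Rightarrow> real"
  assumes "summable (\<lambda>k. b k * r ^ k)" "0 < r"
  shows "summable (\<lambda>k. b (k + n) * r ^ k)"
proof -
  have "summable (\<lambda>k. b (k + n) * r ^ (k + n))" using summable_ignore_initial_segment[OF assms(1), of n] by simp
  then have "summable (\<lambda>k. b (k + n) * r ^ (k + n) * inverse (r ^ n))" by (rule summable_mult2)
  then show ?thesis using assms(2) by (simp add: power_add field_simps)
qed

section \<open>Orders of vanishing, Weierstrass division and preparation\<close>

lemma pser_order:
  assumes f: "pser (insert j I) r f B" and j: "j \<notin> I" and r: "0 < r j" "\<And>i. i \<in> I \<Longrightarrow> 0 < r i"
    and nz: "x0 \<in> polybox (insert j I) r" "f x0 \<noteq> 0"
  shows "\<exists>d a g C D. pser I r a C \<and> (\<exists>y\<in>polybox I r. a y \<noteq> 0) \<and> pser (insert j I) r g D \<and>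
    (\<forall>x\<in>polybox (insert j I) r. f x = x j ^ d * (a x + x j * g x))"
proof -
  have r0: "0 \<le> r i" if "i \<in> I" for i using r(2)[OF that] by simp
  obtain a b where a: "\<And>k. pser I r (a k) (b k)" and b: "summable (\<lambda>k. b k * r j ^ k)"
    and fa: "\<And>x. x \<in> polybox (insert j I) r \<Longrightarrow> (\<lambda>k. a k x * x j ^ k) sums f x"
    using pser_expand[OF f j r(1) r0] by blast
  have sub: "x \<in> polybox I r" if "x \<in> polybox (insert j I) r" for x using that by (auto simp: polybox_def)
  define N where "N k \<longleftrightarrow> (\<exists>y\<in>polybox I r. a k y \<noteq> 0)" for k
  have "\<exists>k. N k"
  proof (rule ccontr)
    assume "\<nexists>k. N k"
    then have "(\<lambda>k. a k x0 * x0 j ^ k) = (\<lambda>k. 0)" using sub[OF nz(1)] by (auto simp: N_def)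
    then have "(\<lambda>k. 0) sums f x0" using fa[OF nz(1)] by simp
    from sums_unique2[OF this sums_zero] show False using nz(2) by simp
  qed
  define d where "d = (LEAST k. N k)"
  have d: "N d" and lt: "\<And>k. k < d \<Longrightarrow> \<not> N k"
    unfolding d_def using \<open>\<exists>k. N k\<close> by (auto intro: LeastI_ex dest: not_less_Least)
  define g where "g x = (\<Sum>k. a (k + Suc d) x * x j ^ k)" for x
  have a': "pser I r (a (k + Suc d)) (b (k + Suc d))" for k by (rule a)
  note b' = summable_shift_weight[OF b r(1), of "Suc d"]
  note g = pser_power_series[where a = "\<lambda>k. a (k + Suc d)" and b = "\<lambda>k. b (k + Suc d)", OF a' b' less_imp_le[OF r(1)] r0, simplified]
  have "f x = x j ^ d * (a d x + x j * g x)" if x: "x \<in> polybox (insert j I) r" for x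
  proof -
    have z: "a k x = 0" if "k < d" for k using lt[OF that] sub[OF x] by (auto simp: N_def)
    have "f x = (\<Sum>k. a (k + Suc d) x * x j ^ (k + Suc d)) + (\<Sum>k<Suc d. a k x * x j ^ k)"
      using suminf_split_initial_segment[OF sums_summable[OF fa[OF x]], of "Suc d"] fa[OF x] by (simp add: sums_iff)
    also have "(\<Sum>k<Suc d. a k x * x j ^ k) = a d x * x j ^ d" using z by simp
    also have "(\<Sum>k. a (k + Suc d) x * x j ^ (k + Suc d)) = (\<Sum>k. x j ^ Suc d * (a (k + Suc d) x * x j ^ k))"
      by (simp add: power_add algebra_simps)
    also have "\<dots> = x j ^ Suc d * g x" unfolding g_def using g(2)[OF x] by (intro suminf_mult) simp
    finally show ?thesis by (simp add: algebra_simps)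
  qed
  moreover have "pser (insert j I) r g (\<Sum>k. b (Suc (k + d)) * r j ^ k)" unfolding g_def using g(1) by simp
  ultimately show ?thesis using a d unfolding N_def by blast
qed

lemma pser_factor:
  assumes f: "pser (insert c (insert t J)) r f B" and dist: "c \<noteq> t" "c \<notin> J" "t \<notin> J"
    and r: "\<forall>i\<in>insert c (insert t J). 0 < r i" "r t \<le> 1"
    and nz: "x0 \<in> polybox (insert c (insert t J)) r" "f x0 \<noteq> 0"
  shows "\<exists>a b e C. pser J r e C \<and> (\<exists>y\<in>polybox J r. e y \<noteq> 0) \<and>
    (\<forall>K\<ge>a. \<exists>h D. pser (insert c (insert t J)) r h D \<and>
      (\<forall>x\<in>polybox (insert c (insert t J)) r. f (x(c := x t ^ K * x c)) = x t ^ (a + K * b) * x c ^ b * h x) \<and>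
      (\<forall>x\<in>polybox (insert c (insert t J)) r. x t = 0 \<longrightarrow> x c = 0 \<longrightarrow> h x = e x))"
proof -
  let ?I = "insert c (insert t J)"
  have rc: "0 < r c" and rt: "0 < r t" and r': "\<And>i. i \<in> insert t J \<Longrightarrow> 0 < r i" "\<And>i. i \<in> J \<Longrightarrow> 0 < r i"
    using r by auto
  have cn: "c \<notin> insert t J" using dist by simp
  obtain b A f3 C D where A: "pser (insert t J) r A C" and f3: "pser ?I r f3 D"
    and Anz: "\<exists>y\<in>polybox (insert t J) r. A y \<noteq> 0"
    and fA: "\<And>x. x \<in> polybox ?I r \<Longrightarrow> f x = x c ^ b * (A x + x c * f3 x)"
    using pser_order[OF f cn rc r'(1) nz] by blast
  obtain y0 where y0: "y0 \<in> polybox (insert t J) r" "A y0 \<noteq> 0" using Anz by blast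
  obtain a e g C' D' where e: "pser J r e C'" and g: "pser (insert t J) r g D'"
    and enz: "\<exists>y\<in>polybox J r. e y \<noteq> 0"
    and Ae: "\<And>x. x \<in> polybox (insert t J) r \<Longrightarrow> A x = x t ^ a * (e x + x t * g x)"
    using pser_order[OF A dist(3) rt r'(2) y0] by blast
  have main: "\<exists>h D. pser ?I r h D \<and>
      (\<forall>x\<in>polybox ?I r. f (x(c := x t ^ K * x c)) = x t ^ (a + K * b) * x c ^ b * h x) \<and>
      (\<forall>x\<in>polybox ?I r. x t = 0 \<longrightarrow> x c = 0 \<longrightarrow> h x = e x)" if K: "a \<le> K" for K
  proof -
    define h where "h x = e x + (x t * g x + x t ^ (K - a) * x c * f3 (x(c := x t ^ K * x c)))" for x
    have rK: "r t ^ K * r c \<le> r c" using r(2) rt rc by (simp add: mult_le_cancel_right1 power_le_one)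
    have "pser ?I r (\<lambda>x. f3 (x(c := x t ^ K * x c))) D"
    proof (rule pser_compose[OF f3])
      fix i assume i: "i \<in> ?I"
      show "pser ?I r (\<lambda>x. (x(c := x t ^ K * x c)) i) (r i)"
      proof (cases "i = c")
        case True
        have "pser ?I r (\<lambda>x. x t ^ K * x c) (r t ^ K * r c)"
          by (intro pser.mult pser_power pser.coord) auto
        then show ?thesis using True rK by (auto intro: pser_mono)
      next
        case False
        then show ?thesis using i by (auto intro: pser.coord)
      qed
    qed
    moreover have "pser ?I r e C'" "pser ?I r g D'" using e g by (auto intro: pser_widen)
    ultimately have "pser ?I r h (C' + (r t * D' + r t ^ (K - a) * r c * D))"
      unfolding h_def by (intro pser_add pser.mult pser_power pser.coord) auto
    moreover have "f (x(c := x t ^ K * x c)) = x t ^ (a + K * b) * x c ^ b * h x" if x: "x \<in> polybox ?I r" for x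
    proof -
      let ?x = "x(c := x t ^ K * x c)"
      have xt: "\<bar>x t\<bar> \<le> 1" "\<bar>x c\<bar> \<le> r c" using x r(2) by (auto simp: polybox_def)
      have "\<bar>x t ^ K * x c\<bar> \<le> 1 * r c" unfolding abs_mult power_abs
        using xt by (intro mult_mono) (auto intro: power_le_one)
      then have x': "?x \<in> polybox ?I r" using x by (auto simp: polybox_def)
      have xJ: "?x \<in> polybox (insert t J) r" "x \<in> polybox (insert t J) r" "x \<in> polybox J r"
        using x x' by (auto simp: polybox_def)
      have "A ?x = A x" by (rule pser_local[OF A xJ(1)]) (use cn in auto)
      then have "f ?x = (x t ^ K * x c) ^ b * (x t ^ a * (e x + x t * g x) + x t ^ K * x c * f3 ?x)"
        using fA[OF x'] Ae[OF xJ(2)] by simp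
      moreover have "x t ^ K = x t ^ a * x t ^ (K - a)" using K by (simp flip: power_add)
      then have "x t ^ a * (e x + x t * g x) + x t ^ K * x c * f3 ?x = x t ^ a * h x"
        unfolding h_def by (simp add: distrib_left mult.assoc)
      ultimately have "f ?x = (x t ^ K * x c) ^ b * (x t ^ a * h x)" by (simp only:)
      also have "\<dots> = x t ^ (a + K * b) * x c ^ b * h x"
        by (simp add: power_add power_mult_distrib power_mult)
      finally show ?thesis .
    qed
    moreover have "h x = e x" if "x t = 0" "x c = 0" for x using that by (simp add: h_def)
    ultimately show ?thesis by blast
  qed
  show ?thesis using e enz main by blast
qed

text \<open>The product \<open>q * e\<close> is split into its terms of degree below
  \<open>d\<close> in \<open>x j\<close> and a multiple of \<open>x j ^ d\<close>, which is written
  as \<open>- \<kappa> * x j ^ d * q'\<close>. The third in the assumption on \<open>E\<close> makes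
  the bound of \<open>q'\<close> a third of that of \<open>q\<close>.\<close>

lemma weierstrass_step:
  assumes e: "pser (insert j I) s e E" and j: "j \<notin> I" and s: "0 < s j" "\<forall>i\<in>I. 0 < s i"
    and \<kappa>: "\<kappa> \<noteq> 0" "E \<le> \<bar>\<kappa>\<bar> * s j ^ d / 3" and q: "pser (insert j I) s q Q"
  shows "\<exists>q' w. pser (insert j I) s q' (Q / 3) \<and> (\<forall>k. pser I s (w k) (Q * E / s j ^ k)) \<and>
    (\<forall>x\<in>polybox (insert j I) s. q x * e x = (\<Sum>k<d. w k x * x j ^ k) - \<kappa> * x j ^ d * q' x)"
proof -
  have s0: "0 \<le> s i" if "i \<in> I" for i using s(2) that by (simp add: less_imp_le)
  then have sI: "\<forall>i\<in>I. 0 \<le> s i" by simp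
  have s0': "0 \<le> s i" if "i \<in> insert j I" for i using that s0 s(1) by auto
  have Q0: "0 \<le> Q" using pser_nonneg[OF q s0'] .
  obtain a b where a: "\<And>k. pser I s (a k) (b k)" and b: "summable (\<lambda>k. b k * s j ^ k)" "(\<Sum>k. b k * s j ^ k) \<le> Q * E"
    and qe: "\<And>x. x \<in> polybox (insert j I) s \<Longrightarrow> (\<lambda>k. a k x * x j ^ k) sums (q x * e x)"
    by (rule pser_expandE[OF pser.mult[OF q e] j s(1) sI]) (rule that)
  have b0: "0 \<le> b k" for k using pser_nonneg[OF a s0] .
  define p where "p x = (\<Sum>k. a (k + d) x * x j ^ k)" for x
  have bs: "summable (\<lambda>k. b (k + d) * s j ^ k)" using summable_shift_weight[OF b(1) s(1)] .
  have p: "pser (insert j I) s p (\<Sum>k. b (k + d) * s j ^ k)"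
    unfolding p_def using a bs s(1) s0 by (intro pser_power_series(1)) auto
  have ps: "summable (\<lambda>k. a (k + d) x * x j ^ k)" if "x \<in> polybox (insert j I) s" for x
    by (rule pser_power_series(2)[OF _ bs _ _ that]) (use a s(1) s0 in auto)
  have "(\<Sum>k. b (k + d) * s j ^ k) \<le> Q * E / s j ^ d"
  proof -
    have "(\<Sum>k. b (k + d) * s j ^ k) * s j ^ d = (\<Sum>k. b (k + d) * s j ^ k * s j ^ d)"
      using bs by (rule suminf_mult2)
    also have "\<dots> = (\<Sum>k. b (k + d) * s j ^ (k + d))" by (simp add: power_add mult.assoc)
    also have "\<dots> = (\<Sum>k. b k * s j ^ k) - (\<Sum>k<d. b k * s j ^ k)"
      using b(1) by (rule suminf_minus_initial_segment)
    also have "\<dots> \<le> Q * E" using b b0 s(1) sum_nonneg[of "{..<d}" "\<lambda>k. b k * s j ^ k"] by fastforce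
    finally show ?thesis using s(1) by (simp add: field_simps)
  qed
  then have pb: "pser (insert j I) s p (Q * E / s j ^ d)" using pser_mono[OF p] by blast
  have le: "\<bar>- (1 / \<kappa>)\<bar> * (Q * E / s j ^ d) \<le> Q / 3"
  proof -
    have "Q * E \<le> Q * (\<bar>\<kappa>\<bar> * s j ^ d / 3)" using \<kappa>(2) Q0 by (rule mult_left_mono)
    then show ?thesis using \<kappa>(1) s(1) by (simp add: field_simps)
  qed
  have "pser (insert j I) s (\<lambda>x. - (1 / \<kappa>) * p x) (Q / 3)"
    using pser_mono[OF pser_cmult[OF pb, of "- (1 / \<kappa>)"] le] .
  moreover have "pser I s (a k) (Q * E / s j ^ k)" for k
  proof (rule pser_mono[OF a])
    have "b k * s j ^ k \<le> (\<Sum>k. b k * s j ^ k)"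
      using sum_le_suminf[OF b(1), of "{k}"] b0 s(1) by simp
    then show "b k \<le> Q * E / s j ^ k" using b(2) s(1) by (simp add: field_simps)
  qed
  moreover have "q x * e x = (\<Sum>k<d. a k x * x j ^ k) - \<kappa> * x j ^ d * (- (1 / \<kappa>) * p x)"
    if x: "x \<in> polybox (insert j I) s" for x
  proof -
    have "q x * e x = (\<Sum>k. a (k + d) x * x j ^ (k + d)) + (\<Sum>k<d. a k x * x j ^ k)"
      using suminf_split_initial_segment[OF sums_summable[OF qe[OF x]], of d] qe[OF x] by (simp add: sums_iff)
    also have "(\<Sum>k. a (k + d) x * x j ^ (k + d)) = (\<Sum>k. x j ^ d * (a (k + d) x * x j ^ k))"
      by (simp add: power_add algebra_simps)
    also have "\<dots> = x j ^ d * p x" unfolding p_def using ps[OF x] by (rule suminf_mult)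
    finally show ?thesis using \<kappa>(1) by simp
  qed
  ultimately show ?thesis by (intro exI[of _ "\<lambda>x. - (1 / \<kappa>) * p x"] exI[of _ a]) blast
qed

text \<open>The step is iterated from \<open>q 0 = 1 / \<kappa>\<close>; on summing over
  \<open>n\<close> the terms with \<open>x j ^ d\<close> telescope. The corrections to
  \<open>1 / \<kappa>\<close> add up to at most half of its absolute value, since the powers of 1/3
  from the first on sum to 1/2; this fixes the sign of the quotient.\<close>

lemma weierstrass_division:
  assumes e: "pser (insert j I) s e E" and j: "j \<notin> I" and s: "0 < s j" "\<forall>i\<in>I. 0 < s i"
    and \<kappa>: "\<kappa> \<noteq> 0" "E \<le> \<bar>\<kappa>\<bar> * s j ^ d / 3"
  shows "\<exists>q w. (\<forall>k. \<exists>C. pser I s (w k) C) \<and> (\<forall>x\<in>polybox (insert j I) s.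
    (\<kappa> * x j ^ d + e x) * q x = x j ^ d + (\<Sum>k<d. w k x * x j ^ k) \<and> 0 < q x * \<kappa>)"
proof -
  let ?Q = "\<lambda>n. 1 / \<bar>\<kappa>\<bar> / 3 ^ n" and ?box = "polybox (insert j I) s"
  define R where "R n q q' w \<longleftrightarrow> (\<forall>k. pser I s (w k) (?Q n * E / s j ^ k)) \<and>
    (\<forall>x\<in>?box. q x * e x = (\<Sum>k<d. w k x * x j ^ k) - \<kappa> * x j ^ d * q' x)"
    for n :: nat and q q' and w :: "nat \<Rightarrow> ('a \<Rightarrow> real) \<Rightarrow> real"
  have step: "\<exists>q'. pser (insert j I) s q' (?Q (Suc n)) \<and> (\<exists>w. R n q q' w)"
    if qn: "pser (insert j I) s q (?Q n)" for q n
  proof -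
    obtain q' w where "pser (insert j I) s q' (?Q n / 3)" "R n q q' w"
      using weierstrass_step[OF e j s \<kappa> qn] unfolding R_def by blast
    moreover have "?Q n / 3 = ?Q (Suc n)" by simp
    ultimately show ?thesis by metis
  qed
  have "pser (insert j I) s (\<lambda>_. 1 / \<kappa>) (?Q 0)" by (rule pser.const) simp
  then obtain q where q: "\<And>n. pser (insert j I) s (q n) (?Q n)" and q0: "q 0 = (\<lambda>_. 1 / \<kappa>)"
    and "\<And>n. \<exists>w. R n (q n) (q (Suc n)) w"
    using dependent_nat_choice[of "\<lambda>n q. pser (insert j I) s q (?Q n) \<and> (n = 0 \<longrightarrow> q = (\<lambda>_. 1 / \<kappa>))"
        "\<lambda>n q q'. \<exists>w. R n q q' w"] step by (metis nat.distinct(1))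
  then obtain w where w: "\<And>n. R n (q n) (q (Suc n)) (w n)" by metis
  define q' where "q' x = (\<Sum>n. q n x)" for x
  define w' where "w' k x = (\<Sum>n. w n k x)" for k x
  have sQ: "summable ?Q" using summable_divide[OF summable_geometric[of "1 / 3 :: real"], of "\<bar>\<kappa>\<bar>"]
    by (simp add: power_one_over field_simps)
  have wb: "pser I s (w n k) (?Q n * E / s j ^ k)" for n k using w unfolding R_def by blast
  have sw: "summable (\<lambda>n. ?Q n * E / s j ^ k)" for k by (intro summable_divide summable_mult2 sQ)
  have sww: "summable (\<lambda>n. w n k x)" if "x \<in> polybox I s" for k x
    by (rule summable_comparison_test'[OF sw[of k]]) (use pser_bound[OF wb that] in simp)
  have "pser I s (w' k) (\<Sum>n. ?Q n * E / s j ^ k)" for k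
    by (rule pser.series[OF wb sw]) (simp add: w'_def summable_sums sww)
  moreover have "(\<kappa> * x j ^ d + e x) * q' x = x j ^ d + (\<Sum>k<d. w' k x * x j ^ k) \<and> 0 < q' x * \<kappa>"
    if x: "x \<in> ?box" for x
  proof -
    have xI: "x \<in> polybox I s" using x by (auto simp: polybox_def)
    have qb: "\<bar>q n x\<bar> \<le> ?Q n" for n using pser_bound[OF q x] .
    have sq: "summable (\<lambda>n. q n x)" by (rule summable_comparison_test'[OF sQ]) (use qb in simp)
    have tail: "(\<Sum>n. q (Suc n) x) = q' x - 1 / \<kappa>"
      unfolding q'_def using suminf_split_head[OF sq] q0 by simp
    have sq': "summable (\<lambda>n. q (Suc n) x)" using sq by (subst summable_Suc_iff)
    have "q n x * e x = (\<Sum>k<d. w n k x * x j ^ k) - \<kappa> * x j ^ d * q (Suc n) x" for n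
      using w x unfolding R_def by blast
    then have "(\<lambda>n. (\<Sum>k<d. w n k x * x j ^ k) - \<kappa> * x j ^ d * q (Suc n) x) sums (q' x * e x)"
      using sums_mult2[OF summable_sums[OF sq], of "e x"] by (simp add: q'_def)
    moreover have "(\<lambda>n. (\<Sum>k<d. w n k x * x j ^ k) - \<kappa> * x j ^ d * q (Suc n) x) sums
        ((\<Sum>k<d. w' k x * x j ^ k) - \<kappa> * x j ^ d * (q' x - 1 / \<kappa>))"
      unfolding w'_def tail[symmetric]
      by (intro sums_diff sums_sum sums_mult2 sums_mult summable_sums sww[OF xI] sq')
    ultimately have "q' x * e x = (\<Sum>k<d. w' k x * x j ^ k) - \<kappa> * x j ^ d * (q' x - 1 / \<kappa>)"
      by (rule sums_unique2)
    then have 1: "(\<kappa> * x j ^ d + e x) * q' x = x j ^ d + (\<Sum>k<d. w' k x * x j ^ k)"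
      using \<kappa>(1) by (simp add: algebra_simps)
    have "(\<lambda>n. ?Q (Suc n)) sums (1 / (2 * \<bar>\<kappa>\<bar>))"
    proof -
      have "(\<lambda>n. 1 / (3 * \<bar>\<kappa>\<bar>) * (1 / 3) ^ n) sums (1 / (3 * \<bar>\<kappa>\<bar>) * (1 / (1 - 1 / 3)))"
        by (intro sums_mult geometric_sums) simp
      then show ?thesis by (simp add: power_one_over field_simps)
    qed
    then have gs: "summable (\<lambda>n. ?Q (Suc n))" "(\<Sum>n. ?Q (Suc n)) = 1 / (2 * \<bar>\<kappa>\<bar>)" by (simp_all only: sums_iff)
    have sa: "summable (\<lambda>n. \<bar>q (Suc n) x\<bar>)"
      by (rule summable_comparison_test'[OF gs(1)]) (use qb[of "Suc _"] in simp)
    have "\<bar>\<Sum>n. q (Suc n) x\<bar> \<le> (\<Sum>n. \<bar>q (Suc n) x\<bar>)" using sa by (rule summable_rabs)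
    also have "\<dots> \<le> (\<Sum>n. ?Q (Suc n))" using qb sa gs(1) by (rule suminf_le)
    finally have "\<bar>\<Sum>n. q (Suc n) x\<bar> \<le> 1 / (2 * \<bar>\<kappa>\<bar>)" unfolding gs(2) .
    then have "\<bar>q' x - 1 / \<kappa>\<bar> * \<bar>\<kappa>\<bar> \<le> 1 / (2 * \<bar>\<kappa>\<bar>) * \<bar>\<kappa>\<bar>" unfolding tail by (rule mult_right_mono) simp
    then have "\<bar>q' x * \<kappa> - 1\<bar> \<le> 1 / 2" using \<kappa>(1) by (simp add: left_diff_distrib flip: abs_mult)
    then have "0 < q' x * \<kappa>" by arith
    then show ?thesis using 1 by simp
  qed
  ultimately show ?thesis by (intro exI[of _ q'] exI[of _ w']) blast
qed

text \<open>\<open>d\<close> is the order of \<open>f\<close> along the \<open>j\<close> axis and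
  \<kappa> the leading coefficient there. The remainder \<open>f - \<kappa> * x j ^ d\<close> has
  two parts: the coefficients up to degree \<open>d\<close> less their values at the origin, small
  with \<open>l\<close>, and the terms of higher degree, small with \<rho> compared to
  \<open>\<rho> ^ d\<close>. Hence \<rho> is chosen before \<open>l\<close>. Both stay free below a
  bound, which lets finitely many series share a box.\<close>

lemma weierstrass_preparation:
  assumes f: "pser (insert j I) r f B" and j: "j \<notin> I" and r: "0 < r j" "\<forall>i\<in>I. 0 < r i"
    and nz: "\<bar>z\<bar> \<le> r j" "f ((\<lambda>_. 0)(j := z)) \<noteq> 0"
  shows "\<exists>d \<kappa> \<rho>0. \<kappa> \<noteq> 0 \<and> 0 < \<rho>0 \<and> (\<forall>\<rho>. 0 < \<rho> \<and> \<rho> \<le> \<rho>0 \<longrightarrow> (\<exists>l0>0. \<forall>l. 0 < l \<and> l \<le> l0 \<longrightarrow>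
    (\<exists>q w. (\<forall>k. \<exists>C. pser I (\<lambda>i. l * r i) (w k) C) \<and>
      (\<forall>x\<in>polybox (insert j I) ((\<lambda>i. l * r i)(j := \<rho>)).
        f x * q x = x j ^ d + (\<Sum>k<d. w k x * x j ^ k) \<and> 0 < q x * \<kappa>))))"
proof -
  have rI: "\<forall>i\<in>I. 0 \<le> r i" using r(2) by (auto intro: less_imp_le)
  obtain a b where a: "\<And>k. pser I r (a k) (b k)" and b: "summable (\<lambda>k. b k * r j ^ k)" "(\<Sum>k. b k * r j ^ k) \<le> B"
    and fa: "\<And>x. x \<in> polybox (insert j I) r \<Longrightarrow> (\<lambda>k. a k x * x j ^ k) sums f x"
    by (rule pser_expandE[OF f j r(1) rI]) (rule that)
  have b0: "0 \<le> b k" for k using pser_nonneg[OF a] rI by blast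
  have B0: "0 \<le> B" using rI r(1) by (intro pser_nonneg[OF f]) auto
  let ?a0 = "\<lambda>k. a k (\<lambda>_. 0)"
  have "\<exists>k. ?a0 k \<noteq> 0"
  proof (rule ccontr)
    assume N: "\<nexists>k. ?a0 k \<noteq> 0"
    have "(\<lambda>_. 0) \<in> polybox I r" using rI by (auto simp: polybox_def)
    then have "a k ((\<lambda>_. 0)(j := z)) = ?a0 k" for k using j by (intro pser_local[OF a, symmetric]) auto
    then have "(\<lambda>k. a k ((\<lambda>_. 0)(j := z)) * ((\<lambda>_. 0)(j := z)) j ^ k) = (\<lambda>k. 0)" using N by simp
    moreover have "(\<lambda>_. 0)(j := z) \<in> polybox (insert j I) r" using rI nz(1) by (auto simp: polybox_def)
    ultimately have "(\<lambda>k. 0) sums f ((\<lambda>_. 0)(j := z))" using fa by metis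
    from sums_unique2[OF this sums_zero] show False using nz(2) by simp
  qed
  then obtain m where m: "?a0 m \<noteq> 0" ..
  define d where "d = (LEAST k. ?a0 k \<noteq> 0)"
  have d: "?a0 d \<noteq> 0" unfolding d_def using m by (rule LeastI)
  have lt: "?a0 k = 0" if "k < d" for k using not_less_Least[OF that[unfolded d_def]] by simp
  define \<kappa> where "\<kappa> = ?a0 d"
  \<comment> \<open>Each of the two parts of the remainder is to stay below a sixth of
    \<open>\<bar>\<kappa>\<bar> * \<rho> ^ d\<close>; together this is the third asked for by the
    division. The \<open>+ 1\<close> guards against \<open>B = 0\<close>.\<close>
  define \<rho>0 where "\<rho>0 = min (r j) (\<bar>\<kappa>\<bar> * r j ^ Suc d / (6 * (B + 1)))"
  have \<kappa>: "\<kappa> \<noteq> 0" using d by (simp add: \<kappa>_def)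
  have "0 < \<rho>0" using \<kappa> r(1) B0 by (simp add: \<rho>0_def)
  moreover have "\<exists>l0>0. \<forall>l. 0 < l \<and> l \<le> l0 \<longrightarrow>
    (\<exists>q w. (\<forall>k. \<exists>C. pser I (\<lambda>i. l * r i) (w k) C) \<and>
      (\<forall>x\<in>polybox (insert j I) ((\<lambda>i. l * r i)(j := \<rho>)).
        f x * q x = x j ^ d + (\<Sum>k<d. w k x * x j ^ k) \<and> 0 < q x * \<kappa>))" if \<rho>: "0 < \<rho>" "\<rho> \<le> \<rho>0" for \<rho>
  proof -
    define l0 where "l0 = min 1 (\<bar>\<kappa>\<bar> * \<rho> ^ d / (6 * (B + 1)))"
    have "0 < l0" using \<kappa> \<rho> B0 by (simp add: l0_def)
    moreover have "\<exists>q w. (\<forall>k. \<exists>C. pser I (\<lambda>i. l * r i) (w k) C) \<and>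
      (\<forall>x\<in>polybox (insert j I) ((\<lambda>i. l * r i)(j := \<rho>)).
        f x * q x = x j ^ d + (\<Sum>k<d. w k x * x j ^ k) \<and> 0 < q x * \<kappa>)" if l: "0 < l" "l \<le> l0" for l
    proof -
      let ?s = "(\<lambda>i. l * r i)(j := \<rho>)"
      have l1: "l \<le> 1" and \<rho>r: "\<rho> \<le> r j" using l \<rho> by (auto simp: l0_def \<rho>0_def)
      have sI: "\<forall>i\<in>I. 0 < ?s i" "0 < ?s j" using r l \<rho> j by auto
      have chI: "pser I ?s g C \<longleftrightarrow> pser I (\<lambda>i. l * r i) g C" for g C
        using j by (intro iffI; elim pser_widen) auto
      define c where "c k x = (if k \<le> d then a k x - ?a0 k else a k x)" for k x
      define t where "t = l + (\<rho> / r j) ^ Suc d"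
      define h where "h k = (if k \<le> d then l * b k else b k)" for k
      have cP: "pser I ?s (c k) (h k)" for k
      proof (cases "k \<le> d")
        case True
        obtain C where "C \<ge> 0" "C + \<bar>?a0 k\<bar> \<le> b k" "pser I (\<lambda>i. l * r i) (\<lambda>x. a k x - ?a0 k) (l * C)"
          using pser_scale[OF a l(1) l1] rI by blast
        moreover then have "l * C \<le> l * b k" using l(1) by (intro mult_left_mono) auto
        ultimately show ?thesis unfolding c_def h_def chI using True by (auto intro: pser_mono)
      next
        case False
        have "l * r i \<le> r i" if "i \<in> I" for i using rI l1 that l(1) by (simp add: mult_left_le_one_le)
        then show ?thesis unfolding c_def h_def chI using False by (auto intro: pser_widen[OF a])
      qed
      have hb: "h k * \<rho> ^ k \<le> t * (b k * r j ^ k)" for k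
      proof (cases "k \<le> d")
        case True
        have "l * (b k * \<rho> ^ k) \<le> t * (b k * r j ^ k)"
          using b0[of k] \<rho> \<rho>r l(1) r(1) by (intro mult_mono power_mono) (auto simp: t_def)
        then show ?thesis using True by (simp add: h_def)
      next
        case False
        have "(\<rho> / r j) ^ k \<le> (\<rho> / r j) ^ Suc d" using \<rho> \<rho>r r(1) False by (intro power_decreasing) auto
        also have "\<dots> \<le> t" using l(1) by (simp add: t_def)
        finally have "(\<rho> / r j) ^ k * (b k * r j ^ k) \<le> t * (b k * r j ^ k)"
          using b0[of k] r(1) by (intro mult_right_mono) auto
        moreover have "(\<rho> / r j) ^ k * (b k * r j ^ k) = b k * \<rho> ^ k" using r(1) by (simp add: power_divide)
        ultimately show ?thesis using False by (simp add: h_def)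
      qed
      have h0: "0 \<le> h k" for k using b0 l(1) by (simp add: h_def)
      have hs: "summable (\<lambda>k. h k * ?s j ^ k)"
        by (rule summable_comparison_test'[OF summable_mult[OF b(1), of t]]) (use hb h0 \<rho> in simp)
      define e where "e x = (\<Sum>k. c k x * x j ^ k)" for x
      have E: "pser (insert j I) ?s e (\<Sum>k. h k * ?s j ^ k)"
        unfolding e_def by (rule pser_power_series(1)[OF cP hs]) (use sI in \<open>auto intro: less_imp_le\<close>)
      have "(\<Sum>k. h k * ?s j ^ k) \<le> \<bar>\<kappa>\<bar> * ?s j ^ d / 3"
      proof -
        have "(\<Sum>k. h k * ?s j ^ k) \<le> (\<Sum>k. t * (b k * r j ^ k))"
          using hb hs summable_mult[OF b(1), of t] by (intro suminf_le) auto
        also have "\<dots> = t * (\<Sum>k. b k * r j ^ k)" using b(1) by (rule suminf_mult)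
        also have "\<dots> \<le> t * B" using b(2) l(1) \<rho> r(1) by (intro mult_left_mono) (auto simp: t_def)
        also have "\<dots> \<le> t * (B + 1)" using l(1) \<rho> r(1) by (intro mult_left_mono) (auto simp: t_def)
        also have "\<dots> \<le> \<bar>\<kappa>\<bar> * \<rho> ^ d / 3"
        proof -
          have "l * (B + 1) \<le> \<bar>\<kappa>\<bar> * \<rho> ^ d / 6" using l(2) B0 by (simp add: l0_def field_simps)
          moreover have "(\<rho> / r j) ^ Suc d * (B + 1) \<le> \<bar>\<kappa>\<bar> * \<rho> ^ d / 6"
          proof -
            have "\<rho> * (6 * (B + 1)) \<le> \<bar>\<kappa>\<bar> * r j ^ Suc d" using \<rho>(2) B0 by (simp add: \<rho>0_def field_simps)
            then have "\<rho> ^ d * (\<rho> * (6 * (B + 1))) \<le> \<rho> ^ d * (\<bar>\<kappa>\<bar> * r j ^ Suc d)"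
              using \<rho>(1) by (intro mult_left_mono) auto
            then show ?thesis using r(1) by (simp add: power_divide field_simps)
          qed
          ultimately show ?thesis unfolding t_def distrib_right by linarith
        qed
        finally show ?thesis by simp
      qed
      from weierstrass_division[OF E j sI(2,1) \<kappa> this]
      obtain q w where w: "\<forall>k. \<exists>C. pser I ?s (w k) C" and q: "\<forall>x\<in>polybox (insert j I) ?s.
        (\<kappa> * x j ^ d + e x) * q x = x j ^ d + (\<Sum>k<d. w k x * x j ^ k) \<and> 0 < q x * \<kappa>" by blast
      have "\<kappa> * x j ^ d + e x = f x" if x: "x \<in> polybox (insert j I) ?s" for x
      proof -
        have "l * r i \<le> r i" if "i \<in> I" for i using rI l1 that l(1) by (simp add: mult_left_le_one_le)
        then have x': "x \<in> polybox (insert j I) r"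
          using x \<rho>r j unfolding polybox_def by (fastforce split: if_splits)
        have "(\<lambda>k. if k \<in> {..d} then ?a0 k * x j ^ k else 0) sums (\<Sum>k\<le>d. ?a0 k * x j ^ k)"
          by (rule sums_If_finite_set) simp
        also have "(\<Sum>k\<le>d. ?a0 k * x j ^ k) = \<kappa> * x j ^ d"
          using lt by (simp add: \<kappa>_def flip: lessThan_Suc_atMost)
        finally have "(\<lambda>k. a k x * x j ^ k - (if k \<in> {..d} then ?a0 k * x j ^ k else 0)) sums (f x - \<kappa> * x j ^ d)"
          by (rule sums_diff[OF fa[OF x']])
        also have "(\<lambda>k. a k x * x j ^ k - (if k \<in> {..d} then ?a0 k * x j ^ k else 0)) = (\<lambda>k. c k x * x j ^ k)"
          by (auto simp: c_def algebra_simps)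
        finally show ?thesis by (simp add: e_def sums_iff)
      qed
      then show ?thesis using w q unfolding chI by (intro exI[of _ q] exI[of _ w]) simp
    qed
    ultimately show ?thesis by blast
  qed
  ultimately show ?thesis using \<kappa> by blast
qed

section \<open>Transfer of sign patterns\<close>

text \<open>\<open>Y\<close> plays the role of a neighbourhood of the origin; it is not required to be a box, since shears
  of the coordinates do not preserve boxes.\<close>

definition sign_transfer :: "'i \<Rightarrow> 'i \<Rightarrow> 'i set \<Rightarrow> ('i \<Rightarrow> real) \<Rightarrow> (('i \<Rightarrow> real) \<Rightarrow> real) set \<Rightarrow> bool" where
  "sign_transfer t c J r F \<longleftrightarrow> (\<exists>Y K \<delta>. 0 < \<delta> \<and> \<delta> \<le> 1 \<and> Y \<subseteq> polybox (insert c (insert t J)) r \<and>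
     (\<forall>x\<in>Y. 0 < x t \<and> 0 < x c) \<and>
     (\<forall>x\<in>polybox (insert c (insert t J)) (\<lambda>_. \<delta>). 0 < x t \<and> 0 < x c \<and> x c < x t ^ K \<longrightarrow> x \<in> Y) \<and>
     (\<forall>x\<in>Y. \<forall>\<tau> \<gamma>. 0 < \<tau> \<and> \<tau> < \<delta> \<and> 0 < \<gamma> \<and> \<gamma> < \<tau> ^ K \<longrightarrow>
       (\<exists>x'\<in>Y. x' t = \<tau> \<and> x' c = \<gamma> \<and> same_signs F x x')))"

lemma sign_transferI:
  assumes "0 < \<delta>" "\<delta> \<le> 1" "Y \<subseteq> polybox (insert c (insert t J)) r" "\<And>x. x \<in> Y \<Longrightarrow> 0 < x t \<and> 0 < x c"
    and "\<And>x. x \<in> polybox (insert c (insert t J)) (\<lambda>_. \<delta>) \<Longrightarrow> 0 < x t \<Longrightarrow> 0 < x c \<Longrightarrow> x c < x t ^ K \<Longrightarrow> x \<in> Y"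
    and "\<And>x \<tau> \<gamma>. x \<in> Y \<Longrightarrow> 0 < \<tau> \<Longrightarrow> \<tau> < \<delta> \<Longrightarrow> 0 < \<gamma> \<Longrightarrow> \<gamma> < \<tau> ^ K \<Longrightarrow>
      \<exists>x'\<in>Y. x' t = \<tau> \<and> x' c = \<gamma> \<and> same_signs F x x'"
  shows "sign_transfer t c J r F"
proof -
  have "\<forall>x\<in>polybox (insert c (insert t J)) (\<lambda>_. \<delta>). 0 < x t \<and> 0 < x c \<and> x c < x t ^ K \<longrightarrow> x \<in> Y"
    using assms(5) by simp
  moreover have "\<forall>x\<in>Y. \<forall>\<tau> \<gamma>. 0 < \<tau> \<and> \<tau> < \<delta> \<and> 0 < \<gamma> \<and> \<gamma> < \<tau> ^ K \<longrightarrow>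
      (\<exists>x'\<in>Y. x' t = \<tau> \<and> x' c = \<gamma> \<and> same_signs F x x')" using assms(6) by simp
  moreover have "\<forall>x\<in>Y. 0 < x t \<and> 0 < x c" using assms(4) by simp
  ultimately show ?thesis unfolding sign_transfer_def using assms(1-3)
    by (intro exI[of _ Y] exI[of _ K] exI[of _ \<delta>] conjI)
qed

lemma sign_transferE:
  assumes "sign_transfer t c J r F"
  obtains Y K \<delta> where "0 < \<delta>" "\<delta> \<le> 1" "Y \<subseteq> polybox (insert c (insert t J)) r" "\<And>x. x \<in> Y \<Longrightarrow> 0 < x t \<and> 0 < x c"
    "\<And>x. x \<in> polybox (insert c (insert t J)) (\<lambda>_. \<delta>) \<Longrightarrow> 0 < x t \<Longrightarrow> 0 < x c \<Longrightarrow> x c < x t ^ K \<Longrightarrow> x \<in> Y"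
    "\<And>x \<tau> \<gamma>. x \<in> Y \<Longrightarrow> 0 < \<tau> \<Longrightarrow> \<tau> < \<delta> \<Longrightarrow> 0 < \<gamma> \<Longrightarrow> \<gamma> < \<tau> ^ K \<Longrightarrow>
      \<exists>x'\<in>Y. x' t = \<tau> \<and> x' c = \<gamma> \<and> same_signs F x x'"
proof -
  from assms obtain Y K \<delta> where Y: "0 < \<delta>" "\<delta> \<le> 1" "Y \<subseteq> polybox (insert c (insert t J)) r"
    and p: "\<forall>x\<in>Y. 0 < x t \<and> 0 < x c"
    and c: "\<forall>x\<in>polybox (insert c (insert t J)) (\<lambda>_. \<delta>). 0 < x t \<and> 0 < x c \<and> x c < x t ^ K \<longrightarrow> x \<in> Y"
    and s: "\<forall>x\<in>Y. \<forall>\<tau> \<gamma>. 0 < \<tau> \<and> \<tau> < \<delta> \<and> 0 < \<gamma> \<and> \<gamma> < \<tau> ^ K \<longrightarrow>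
      (\<exists>x'\<in>Y. x' t = \<tau> \<and> x' c = \<gamma> \<and> same_signs F x x')"
    unfolding sign_transfer_def by (elim exE conjE) (rule that)
  show thesis
  proof (rule that[OF Y])
    show "0 < x t \<and> 0 < x c" if "x \<in> Y" for x using p that by simp
    show "x \<in> Y" if "x \<in> polybox (insert c (insert t J)) (\<lambda>_. \<delta>)" "0 < x t" "0 < x c" "x c < x t ^ K" for x
      using c that by simp
    show "\<exists>x'\<in>Y. x' t = \<tau> \<and> x' c = \<gamma> \<and> same_signs F x x'"
      if "x \<in> Y" "0 < \<tau>" "\<tau> < \<delta>" "0 < \<gamma>" "\<gamma> < \<tau> ^ K" for x \<tau> \<gamma>
      using s that by simp
  qed
qed

lemma function_ring_pser: "function_ring {f. \<exists>B. pser I r f B}"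
  unfolding function_ring_def by (blast intro: pser.const[OF order_refl] pser_add pser.mult)

lemma polybox_mono: "x \<in> polybox I r \<Longrightarrow> J \<subseteq> I \<Longrightarrow> (\<And>i. i \<in> J \<Longrightarrow> r i \<le> s i) \<Longrightarrow> x \<in> polybox J s"
  unfolding polybox_def by (auto intro: order_trans)

lemma sign_transfer_mono:
  assumes "sign_transfer t c J r F" "\<And>i. i \<in> insert c (insert t J) \<Longrightarrow> r i \<le> s i"
  shows "sign_transfer t c J s F"
proof -
  obtain Y K \<delta> where Y: "0 < \<delta>" "\<delta> \<le> 1" "Y \<subseteq> polybox (insert c (insert t J)) r" "\<And>x. x \<in> Y \<Longrightarrow> 0 < x t \<and> 0 < x c"
    "\<And>x. x \<in> polybox (insert c (insert t J)) (\<lambda>_. \<delta>) \<Longrightarrow> 0 < x t \<Longrightarrow> 0 < x c \<Longrightarrow> x c < x t ^ K \<Longrightarrow> x \<in> Y"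
    "\<And>x \<tau> \<gamma>. x \<in> Y \<Longrightarrow> 0 < \<tau> \<Longrightarrow> \<tau> < \<delta> \<Longrightarrow> 0 < \<gamma> \<Longrightarrow> \<gamma> < \<tau> ^ K \<Longrightarrow>
      \<exists>x'\<in>Y. x' t = \<tau> \<and> x' c = \<gamma> \<and> same_signs F x x'"
    using assms(1) by (rule sign_transferE) (rule that)
  have "Y \<subseteq> polybox (insert c (insert t J)) s" using Y(3) assms(2) polybox_mono by blast
  from sign_transferI[OF Y(1,2) this Y(4-6)] show ?thesis .
qed

section \<open>Transfer without further variables, under changes of coordinates and for one more
  variable\<close>

lemma sign_transfer_base:
  assumes ct: "c \<noteq> t" and r: "0 < r c" "0 < r t" and F: "finite F" "\<And>f. f \<in> F \<Longrightarrow> \<exists>B. pser {c, t} r f B"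
    and nz: "\<And>f. f \<in> F \<Longrightarrow> f (\<lambda>_. 0) \<noteq> 0"
  shows "sign_transfer t c {} r F"
proof -
  define P where "P f l \<longleftrightarrow> (\<forall>x\<in>polybox {c, t} (\<lambda>i. l * r i). sgn (f x) = sgn (f (\<lambda>_. 0)))"
    for f :: "('a \<Rightarrow> real) \<Rightarrow> real" and l
  have "\<exists>l0>0. \<forall>l. 0 < l \<and> l \<le> l0 \<longrightarrow> P f l" if f: "f \<in> F" for f
  proof -
    obtain B where B: "pser {c, t} r f B" using F(2) f by blast
    have B0: "0 \<le> B" using r by (intro pser_nonneg[OF B]) auto
    \<comment> \<open>\<open>l * (B + 1)\<close> is then at most half of
      \<open>\<bar>f (\<lambda>_. 0)\<bar>\<close>, so that a series nonzero at the origin keeps its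
      sign on the shrunken box.\<close>
    let ?l = "min 1 (\<bar>f (\<lambda>_. 0)\<bar> / (2 * (B + 1)))"
    have "P f l" if l: "0 < l" "l \<le> ?l" for l
      unfolding P_def
    proof
      fix x assume x: "x \<in> polybox {c, t} (\<lambda>i. l * r i)"
      have "l \<le> 1" using l by simp
      then obtain C where C: "C \<ge> 0" "C + \<bar>f (\<lambda>_. 0)\<bar> \<le> B" "pser {c, t} (\<lambda>i. l * r i) (\<lambda>x. f x - f (\<lambda>_. 0)) (l * C)"
        using pser_scale[OF B l(1)] r by fastforce
      have "\<bar>f x - f (\<lambda>_. 0)\<bar> \<le> l * C" using pser_bound[OF C(3) x] .
      also have "\<dots> \<le> l * (B + 1)" using l(1) C by (intro mult_left_mono) auto
      also have "\<dots> \<le> \<bar>f (\<lambda>_. 0)\<bar> / (2 * (B + 1)) * (B + 1)" using l B0 by (intro mult_right_mono) auto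
      also have "\<dots> < \<bar>f (\<lambda>_. 0)\<bar>" using B0 nz[OF f] by (simp add: field_simps add_pos_nonneg)
      finally show "sgn (f x) = sgn (f (\<lambda>_. 0))" by (auto simp: sgn_if)
    qed
    moreover have "0 < ?l" using nz[OF f] B0 by simp
    ultimately show ?thesis by blast
  qed
  then obtain L where L: "\<And>f. f \<in> F \<Longrightarrow> 0 < L f" "\<And>f l. f \<in> F \<Longrightarrow> 0 < l \<Longrightarrow> l \<le> L f \<Longrightarrow> P f l" by metis
  define l where "l = Min (insert 1 (L ` F))"
  have l: "0 < l" "\<And>f. f \<in> F \<Longrightarrow> l \<le> L f" "l \<le> 1" using F(1) L(1) by (auto simp: l_def)
  define \<delta> where "\<delta> = min 1 (l * min (r c) (r t))"
  define Y where "Y = {x \<in> polybox {c, t} (\<lambda>_. \<delta>). 0 < x t \<and> 0 < x c}"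
  have \<delta>: "0 < \<delta>" "\<delta> \<le> 1" "\<delta> \<le> l * r c" "\<delta> \<le> l * r t" using l r
    by (auto simp: \<delta>_def min_def intro: order_trans mult_left_mono)
  have Yl: "Y \<subseteq> polybox {c, t} (\<lambda>i. l * r i)" using \<delta> by (auto simp: Y_def polybox_def)
  have "l * r c \<le> r c" "l * r t \<le> r t" using l r by (simp_all add: mult_left_le_one_le)
  then have Yr: "Y \<subseteq> polybox {c, t} r" using \<delta> by (auto simp: Y_def polybox_def)
  show ?thesis
  proof (rule sign_transferI[OF \<delta>(1,2) Yr])
    fix x \<tau> \<gamma> assume x: "x \<in> Y" and *: "0 < \<tau>" "\<tau> < \<delta>" "0 < \<gamma>" "\<gamma> < \<tau> ^ 1"
    let ?x = "(\<lambda>i. if i = c then \<gamma> else \<tau>)"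
    have x': "?x \<in> Y" using * ct by (auto simp: Y_def polybox_def)
    have "sgn (f x) = sgn (f ?x)" if f: "f \<in> F" for f
      using L(2)[OF f l(1) l(2)[OF f]] x x' Yl unfolding P_def by (metis (no_types, lifting) subsetD)
    then have "same_signs F x ?x" by (simp add: same_signs_def)
    then show "\<exists>x'\<in>Y. x' t = \<tau> \<and> x' c = \<gamma> \<and> same_signs F x x'" using x' ct by (intro bexI[of _ ?x]) auto
  qed (auto simp: Y_def)
qed

text \<open>The substitution turns the wedge below \<open>t ^ K\<close> into the one below
  \<open>t ^ (k + K)\<close>. It is injective for positive \<open>t\<close>, so prescribed values of
  \<open>t\<close> and \<open>c\<close> can be pulled back.\<close>

lemma sign_transfer_rescale:
  fixes F H :: "(('i \<Rightarrow> real) \<Rightarrow> real) set"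
  assumes dist: "c \<noteq> t" "c \<notin> J" and r: "0 < r c" "r t \<le> 1" and H: "sign_transfer t c J r H"
    and FH: "\<And>f. f \<in> F \<Longrightarrow> \<exists>h\<in>H. \<forall>x\<in>polybox (insert c (insert t J)) r. 0 < x t \<longrightarrow> 0 < x c \<longrightarrow>
      sgn (f (x(c := x t ^ k * x c))) = sgn (h x)"
  shows "sign_transfer t c J r F"
proof -
  let ?I = "insert c (insert t J)"
  obtain Y K \<delta> where \<delta>: "0 < \<delta>" "\<delta> \<le> 1" and Y: "Y \<subseteq> polybox ?I r" and pos: "\<And>x. x \<in> Y \<Longrightarrow> 0 < x t \<and> 0 < x c"
    and inY: "\<And>x. x \<in> polybox ?I (\<lambda>_. \<delta>) \<Longrightarrow> 0 < x t \<Longrightarrow> 0 < x c \<Longrightarrow> x c < x t ^ K \<Longrightarrow> x \<in> Y"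
    and trans: "\<And>x \<tau> \<gamma>. x \<in> Y \<Longrightarrow> 0 < \<tau> \<Longrightarrow> \<tau> < \<delta> \<Longrightarrow> 0 < \<gamma> \<Longrightarrow> \<gamma> < \<tau> ^ K \<Longrightarrow>
      \<exists>x'\<in>Y. x' t = \<tau> \<and> x' c = \<gamma> \<and> same_signs H x x'"
    using H by (rule sign_transferE) (rule that)
  define \<Phi> where "\<Phi> x = x(c := x t ^ k * x c)" for x :: "'i \<Rightarrow> real"
  have \<Phi>t: "\<Phi> x t = x t" "\<Phi> x c = x t ^ k * x c" for x using dist by (simp_all add: \<Phi>_def)
  have "\<Phi> ` Y \<subseteq> polybox ?I r"
  proof
    fix y assume "y \<in> \<Phi> ` Y"
    then obtain x where x: "x \<in> Y" "y = \<Phi> x" by blast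
    have b: "\<bar>x i\<bar> \<le> r i" if "i \<in> ?I" for i using x Y that by (auto simp: polybox_def)
    have "\<bar>x t ^ k * x c\<bar> \<le> 1 * r c" unfolding abs_mult power_abs
      using b[of t] b[of c] r by (intro mult_mono power_le_one) auto
    then show "y \<in> polybox ?I r" using b by (auto simp: x(2) \<Phi>_def polybox_def)
  qed
  then show ?thesis
  proof (rule sign_transferI[OF \<delta>])
    show "0 < y t \<and> 0 < y c" if "y \<in> \<Phi> ` Y" for y using that pos \<Phi>t by fastforce
    \<comment> \<open>The extra 1 in the exponent keeps \<open>y c / y t ^ k\<close> below
      \<open>y t\<close>, hence within \<delta>, also when \<open>K = 0\<close>.\<close>
    show "y \<in> \<Phi> ` Y" if y: "y \<in> polybox ?I (\<lambda>_. \<delta>)" "0 < y t" "0 < y c" "y c < y t ^ (k + K + 1)" for y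
    proof -
      define x where "x = y(c := y c / y t ^ k)"
      have xt: "x t = y t" "x c = y c / y t ^ k" using dist by (simp_all add: x_def)
      have yt: "y t \<le> \<delta>" using y(1,2) by (auto simp: polybox_def)
      have "y c / y t ^ k < y t ^ (K + 1)" using y by (simp add: power_add field_simps)
      moreover have "y t ^ (K + 1) \<le> y t ^ K" "y t ^ (K + 1) \<le> y t ^ 1"
        using y(2) yt \<delta> by (intro power_decreasing; simp)+
      ultimately have "x c < x t ^ K" "x c \<le> \<delta>" unfolding xt using yt by auto
      moreover have "0 < x c" "0 < x t" using y unfolding xt by auto
      moreover have "x \<in> polybox ?I (\<lambda>_. \<delta>)"
        using y(1) \<open>x c \<le> \<delta>\<close> \<open>0 < x c\<close> xt(2) by (auto simp: polybox_def x_def)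
      ultimately have "x \<in> Y" using inY by blast
      moreover have "y = \<Phi> x" using y(2) xt by (auto simp: \<Phi>_def x_def)
      ultimately show ?thesis by blast
    qed
    fix y \<tau> \<gamma> assume "y \<in> \<Phi> ` Y" and \<tau>: "0 < \<tau>" "\<tau> < \<delta>" and \<gamma>: "0 < \<gamma>" "\<gamma> < \<tau> ^ (k + K + 1)"
    then obtain x where x: "x \<in> Y" "y = \<Phi> x" by blast
    have "\<gamma> / \<tau> ^ k < \<tau> ^ (K + 1)" using \<tau> \<gamma> by (simp add: power_add field_simps)
    also have "\<dots> \<le> \<tau> ^ K" using \<tau> \<delta> by (intro power_decreasing) auto
    finally obtain x' where x': "x' \<in> Y" "x' t = \<tau>" "x' c = \<gamma> / \<tau> ^ k" "same_signs H x x'"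
      using trans[OF x(1) \<tau>, of "\<gamma> / \<tau> ^ k"] \<tau> \<gamma> by auto
    have "same_signs F (\<Phi> x) (\<Phi> x')"
      unfolding same_signs_def
    proof
      fix f assume "f \<in> F"
      then obtain h where h: "h \<in> H" "\<And>x. x \<in> polybox ?I r \<Longrightarrow> 0 < x t \<Longrightarrow> 0 < x c \<Longrightarrow> sgn (f (\<Phi> x)) = sgn (h x)"
        unfolding \<Phi>_def using FH by blast
      have "sgn (f (\<Phi> x)) = sgn (h x)" using h(2)[of x] pos[OF x(1)] Y x(1) by blast
      also have "\<dots> = sgn (h x')" using same_signsD[OF x'(4) h(1)] .
      also have "\<dots> = sgn (f (\<Phi> x'))" using h(2)[of x'] pos[OF x'(1)] Y x'(1) by fastforce
      finally show "sgn (f (\<Phi> x)) = sgn (f (\<Phi> x'))" .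
    qed
    moreover have "\<Phi> x' t = \<tau>" "\<Phi> x' c = \<gamma>" using x' \<tau> by (simp_all add: \<Phi>t)
    ultimately show "\<exists>x'\<in>\<Phi> ` Y. x' t = \<tau> \<and> x' c = \<gamma> \<and> same_signs F y x'" using x x' by blast
  qed
qed

text \<open>The linear map that sends the \<open>j\<close>-th unit vector to \<open>v\<close>, read
  as 0 outside \<open>insert j J\<close>, and fixes the other unit vectors; the \<open>j\<close>
  axis becomes the line spanned by \<open>v\<close>.\<close>

definition shear :: "'i \<Rightarrow> 'i set \<Rightarrow> ('i \<Rightarrow> real) \<Rightarrow> ('i \<Rightarrow> real) \<Rightarrow> 'i \<Rightarrow> real" where
  "shear j J v x i = (if i = j then x j * v j else if i \<in> J then x i + x j * v i else x i)"

text \<open>The halved radii leave room for the two summands \<open>x i\<close> and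
  \<open>x j * v i\<close>. The radius \<open>s j\<close> may be 1, since after the shear
  \<open>x j\<close> acts as a multiple of \<open>v\<close>.\<close>

lemma sign_transfer_shear:
  assumes dist: "c \<notin> insert j J" "t \<notin> insert j J" "j \<notin> J" and v: "v j \<noteq> 0" "\<forall>i\<in>insert j J. \<bar>v i\<bar> \<le> r i / 2"
    and r: "\<forall>i\<in>insert c (insert t (insert j J)). 0 < r i \<and> r i \<le> 1"
    and s: "s j \<le> 1" "\<forall>i\<in>insert c (insert t J). s i \<le> r i / 2"
    and H: "sign_transfer t c (insert j J) s ((\<lambda>h x. h (shear j J v x)) ` H)"
  shows "sign_transfer t c (insert j J) r H"
proof -
  let ?I = "insert c (insert t (insert j J))" and ?\<Psi> = "shear j J v"
  obtain Y K \<delta> where \<delta>: "0 < \<delta>" "\<delta> \<le> 1" and Y: "Y \<subseteq> polybox ?I s" and pos: "\<And>x. x \<in> Y \<Longrightarrow> 0 < x t \<and> 0 < x c"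
    and inY: "\<And>x. x \<in> polybox ?I (\<lambda>_. \<delta>) \<Longrightarrow> 0 < x t \<Longrightarrow> 0 < x c \<Longrightarrow> x c < x t ^ K \<Longrightarrow> x \<in> Y"
    and trans: "\<And>x \<tau> \<gamma>. x \<in> Y \<Longrightarrow> 0 < \<tau> \<Longrightarrow> \<tau> < \<delta> \<Longrightarrow> 0 < \<gamma> \<Longrightarrow> \<gamma> < \<tau> ^ K \<Longrightarrow>
      \<exists>x'\<in>Y. x' t = \<tau> \<and> x' c = \<gamma> \<and> same_signs ((\<lambda>h x. h (?\<Psi> x)) ` H) x x'"
    using H by (rule sign_transferE) (rule that)
  \<comment> \<open>The inverse shear divides by \<open>v j\<close>: coordinates of size \<epsilon>
    grow to at most \<open>\<epsilon> + \<epsilon> / \<bar>v j\<bar>\<close>, which is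
    \<delta>.\<close>
  define \<epsilon> where "\<epsilon> = \<delta> / (1 + 1 / \<bar>v j\<bar>)"
  have vj: "0 < 1 / \<bar>v j\<bar>" using v(1) by simp
  have "\<epsilon> * (1 + 1 / \<bar>v j\<bar>) = \<delta>" using add_pos_pos[OF zero_less_one vj] by (simp add: \<epsilon>_def)
  then have \<epsilon>eq: "\<epsilon> + \<epsilon> / \<bar>v j\<bar> = \<delta>" by (simp add: distrib_left)
  have \<epsilon>0: "0 < \<epsilon>" unfolding \<epsilon>_def by (rule divide_pos_pos[OF \<delta>(1) add_pos_pos[OF zero_less_one vj]])
  then have "0 < \<epsilon> / \<bar>v j\<bar>" using v(1) by simp
  then have \<epsilon>\<delta>: "\<epsilon> \<le> \<delta>" "\<epsilon> / \<bar>v j\<bar> \<le> \<delta>" using \<epsilon>eq \<epsilon>0 by linarith+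
  have \<Psi>t: "?\<Psi> x t = x t" "?\<Psi> x c = x c" for x using dist by (auto simp: shear_def)
  have YI: "?\<Psi> ` Y \<subseteq> polybox ?I r"
  proof
    fix y assume "y \<in> ?\<Psi> ` Y"
    then obtain x where x: "x \<in> Y" "y = ?\<Psi> x" by blast
    have b: "\<bar>x i\<bar> \<le> s i" if "i \<in> ?I" for i using x Y that by (auto simp: polybox_def)
    have zv: "\<bar>x j * v i\<bar> \<le> r i / 2" if "i \<in> insert j J" for i
    proof -
      have "\<bar>x j\<bar> \<le> 1" using b[of j] s(1) by simp
      then have "\<bar>x j\<bar> * \<bar>v i\<bar> \<le> 1 * (r i / 2)" using v(2) that by (intro mult_mono) auto
      then show ?thesis by (simp add: abs_mult)
    qed
    have "\<bar>y i\<bar> \<le> r i" if i: "i \<in> ?I" for i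
    proof -
      consider "i = j" | "i \<in> J" | "i \<noteq> j" "i \<notin> J" by blast
      then show ?thesis
      proof cases
        case 1
        then show ?thesis using zv[of j] r by (auto simp: x(2) shear_def)
      next
        case 2
        then have "\<bar>x i\<bar> \<le> r i / 2" using b[of i] s(2) by (meson insertCI order_trans)
        moreover have "\<bar>x j * v i\<bar> \<le> r i / 2" using zv 2 by simp
        ultimately have "\<bar>x i + x j * v i\<bar> \<le> r i" by linarith
        then show ?thesis using 2 dist by (auto simp: x(2) shear_def)
      next
        case 3
        then have "\<bar>x i\<bar> \<le> r i / 2" "0 < r i" using b[of i] s(2) r i by (auto intro: order_trans)
        then show ?thesis using 3 by (simp add: x(2) shear_def)
      qed
    qed
    then show "y \<in> polybox ?I r" by (simp add: polybox_def)
  qed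
  have "\<epsilon> \<le> 1" using \<epsilon>\<delta> \<delta> by simp
  show ?thesis
  proof (rule sign_transferI[OF \<epsilon>0 \<open>\<epsilon> \<le> 1\<close> YI])
    show "0 < y t \<and> 0 < y c" if "y \<in> ?\<Psi> ` Y" for y using that pos \<Psi>t by fastforce
    show "y \<in> ?\<Psi> ` Y" if y: "y \<in> polybox ?I (\<lambda>_. \<epsilon>)" "0 < y t" "0 < y c" "y c < y t ^ K" for y
    proof -
      define x where "x i = (if i = j then y j / v j else if i \<in> J then y i - y j / v j * v i else y i)" for i
      have xt: "x t = y t" "x c = y c" using dist by (auto simp: x_def)
      have yb: "\<bar>y i\<bar> \<le> \<epsilon>" if "i \<in> ?I" for i using y(1) that by (auto simp: polybox_def)
      have z: "\<bar>y j / v j\<bar> \<le> \<epsilon> / \<bar>v j\<bar>" using yb[of j] by (simp add: divide_right_mono)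
      have "\<bar>x i\<bar> \<le> \<delta>" if i: "i \<in> ?I" for i
      proof -
        consider "i = j" | "i \<in> J" "i \<noteq> j" | "i \<noteq> j" "i \<notin> J" by blast
        then show ?thesis
        proof cases
          case 1
          then show ?thesis using z \<epsilon>\<delta> by (simp add: x_def)
        next
          case 2
          have "\<bar>v i\<bar> \<le> 1" using v(2) r 2 by fastforce
          then have "\<bar>y j / v j * v i\<bar> \<le> \<epsilon> / \<bar>v j\<bar> * 1" unfolding abs_mult using z \<epsilon>0
            by (intro mult_mono) auto
          then have "\<bar>y i - y j / v j * v i\<bar> \<le> \<delta>" using yb[OF i] \<epsilon>eq by linarith
          then show ?thesis using 2 by (simp add: x_def)
        next
          case 3
          then show ?thesis using yb[OF i] \<epsilon>\<delta> by (simp add: x_def)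
        qed
      qed
      then have "x \<in> polybox ?I (\<lambda>_. \<delta>)" by (simp add: polybox_def)
      then have "x \<in> Y" using y xt by (intro inY) simp_all
      moreover have "y = ?\<Psi> x" using v(1) dist by (auto simp: fun_eq_iff shear_def x_def)
      ultimately show ?thesis by blast
    qed
    fix y \<tau> \<gamma> assume "y \<in> ?\<Psi> ` Y" and \<tau>: "0 < \<tau>" "\<tau> < \<epsilon>" and \<gamma>: "0 < \<gamma>" "\<gamma> < \<tau> ^ K"
    then obtain x where x: "x \<in> Y" "y = ?\<Psi> x" by blast
    have "\<tau> < \<delta>" using \<tau> \<epsilon>\<delta> by simp
    then obtain x' where x': "x' \<in> Y" "x' t = \<tau>" "x' c = \<gamma>" "same_signs ((\<lambda>h x. h (?\<Psi> x)) ` H) x x'"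
      using trans[OF x(1) \<tau>(1) _ \<gamma>] by blast
    have "same_signs H (?\<Psi> x) (?\<Psi> x')" using x'(4) by (simp add: same_signs_def)
    then show "\<exists>x'\<in>?\<Psi> ` Y. x' t = \<tau> \<and> x' c = \<gamma> \<and> same_signs H y x'"
      using x x' by (intro bexI[of _ "?\<Psi> x'"]) (auto simp: \<Psi>t)
  qed
qed

text \<open>Up to a constant sign, preparation replaces each \<open>g\<close> by a monic polynomial
  in \<open>x j\<close>. Elimination of \<open>x j\<close> yields finitely many series in the
  remaining variables, to which the transfer applies. The new neighbourhood is the old one times the
  interval of radius \<rho>, and the coordinate \<open>z\<close> travels to
  \<open>\<sigma> z\<close>.\<close>

lemma sign_transfer_weierstrass:
  fixes G :: "(('i \<Rightarrow> real) \<Rightarrow> real) set"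
  assumes dist: "c \<noteq> t" "c \<notin> insert j J" "t \<notin> insert j J" "j \<notin> J" and G: "finite G"
    and r: "\<forall>i\<in>insert c (insert t (insert j J)). 0 < r i"
    and pG: "\<And>g. g \<in> G \<Longrightarrow> \<exists>B. pser (insert c (insert t (insert j J))) r g B"
    and nz: "\<And>g. g \<in> G \<Longrightarrow> \<exists>z. \<bar>z\<bar> \<le> r j \<and> g ((\<lambda>_. 0)(j := z)) \<noteq> 0"
    and IH: "\<And>F s. finite F \<Longrightarrow> \<forall>i\<in>insert c (insert t J). 0 < s i \<Longrightarrow>
      \<forall>f\<in>F. \<exists>B. pser (insert c (insert t J)) s f B \<Longrightarrow> sign_transfer t c J s F"
  shows "sign_transfer t c (insert j J) r G"
proof -
  let ?I = "insert c (insert t J)" and ?I' = "insert c (insert t (insert j J))"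
  have I': "?I' = insert j ?I" by auto
  have jI: "j \<notin> ?I" using dist by auto
  define W where "W g d \<kappa> \<rho> l \<longleftrightarrow> (\<exists>w. (\<forall>k. \<exists>C. pser ?I (\<lambda>i. l * r i) (w k) C) \<and>
      (\<forall>x\<in>polybox ?I' ((\<lambda>i. l * r i)(j := \<rho>)). sgn (g x) = sgn \<kappa> * sgn (x j ^ d + (\<Sum>k<d. w k x * x j ^ k))))"
    for g :: "('i \<Rightarrow> real) \<Rightarrow> real" and d and \<kappa> :: real and \<rho> l
  have "\<exists>d \<kappa> \<rho>0. 0 < \<rho>0 \<and> (\<forall>\<rho>. 0 < \<rho> \<and> \<rho> \<le> \<rho>0 \<longrightarrow> (\<exists>l0>0. \<forall>l. 0 < l \<and> l \<le> l0 \<longrightarrow> W g d \<kappa> \<rho> l))"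
    if g: "g \<in> G" for g
  proof -
    obtain B where B: "pser (insert j ?I) r g B" using pG[OF g] I' by auto
    obtain z where z: "\<bar>z\<bar> \<le> r j" "g ((\<lambda>_. 0)(j := z)) \<noteq> 0" using nz[OF g] by blast
    have r': "0 < r j" "\<forall>i\<in>?I. 0 < r i" using r by auto
    define V where "V d \<kappa> \<rho> l \<longleftrightarrow> (\<exists>q w. (\<forall>k. \<exists>C. pser ?I (\<lambda>i. l * r i) (w k) C) \<and>
        (\<forall>x\<in>polybox (insert j ?I) ((\<lambda>i. l * r i)(j := \<rho>)).
          g x * q x = x j ^ d + (\<Sum>k<d. w k x * x j ^ k) \<and> 0 < q x * \<kappa>))" for d \<kappa> \<rho> l
    obtain d \<kappa> \<rho>0 where \<kappa>: "\<kappa> \<noteq> 0" "0 < \<rho>0"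
      and *: "\<forall>\<rho>. 0 < \<rho> \<and> \<rho> \<le> \<rho>0 \<longrightarrow> (\<exists>l0>0. \<forall>l. 0 < l \<and> l \<le> l0 \<longrightarrow> V d \<kappa> \<rho> l)"
      using weierstrass_preparation[OF B jI r' z, folded V_def] by (elim exE conjE) (rule that)
    have "W g d \<kappa> \<rho> l" if V: "V d \<kappa> \<rho> l" for \<rho> l
    proof -
      obtain q w where w: "\<forall>k. \<exists>C. pser ?I (\<lambda>i. l * r i) (w k) C"
        and q: "\<forall>x\<in>polybox (insert j ?I) ((\<lambda>i. l * r i)(j := \<rho>)).
          g x * q x = x j ^ d + (\<Sum>k<d. w k x * x j ^ k) \<and> 0 < q x * \<kappa>"
        using V unfolding V_def by (elim exE conjE) (rule that)
      have "sgn (g x) = sgn \<kappa> * sgn (x j ^ d + (\<Sum>k<d. w k x * x j ^ k))"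
        if x: "x \<in> polybox (insert j ?I) ((\<lambda>i. l * r i)(j := \<rho>))" for x
      proof -
        have "g x * q x = x j ^ d + (\<Sum>k<d. w k x * x j ^ k)" and "0 < q x * \<kappa>" using q x by auto
        then have "sgn (x j ^ d + (\<Sum>k<d. w k x * x j ^ k)) = sgn (g x) * sgn (q x)" by (metis sgn_mult)
        moreover have "sgn \<kappa> * sgn (q x) = 1" using \<open>0 < q x * \<kappa>\<close> by (metis mult.commute sgn_mult sgn_pos)
        ultimately show ?thesis by (metis mult.left_commute mult.right_neutral)
      qed
      then show ?thesis unfolding W_def I' using w by (intro exI[of _ w]) simp
    qed
    then have "\<forall>\<rho>. 0 < \<rho> \<and> \<rho> \<le> \<rho>0 \<longrightarrow> (\<exists>l0>0. \<forall>l. 0 < l \<and> l \<le> l0 \<longrightarrow> W g d \<kappa> \<rho> l)" using * by meson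
    then show ?thesis using \<kappa>(2) by (intro exI[of _ d] exI[of _ \<kappa>] exI[of _ \<rho>0]) simp
  qed
  then obtain d \<kappa> \<rho>0 where \<rho>0: "\<And>g. g \<in> G \<Longrightarrow> 0 < \<rho>0 g" and
    W: "\<And>g \<rho>. g \<in> G \<Longrightarrow> 0 < \<rho> \<Longrightarrow> \<rho> \<le> \<rho>0 g \<Longrightarrow> \<exists>l0>0. \<forall>l. 0 < l \<and> l \<le> l0 \<longrightarrow> W g (d g) (\<kappa> g) \<rho> l" by metis
  define \<rho> where "\<rho> = Min (insert (r j) (\<rho>0 ` G))"
  have \<rho>: "0 < \<rho>" "\<rho> \<le> r j" "\<And>g. g \<in> G \<Longrightarrow> \<rho> \<le> \<rho>0 g" using G \<rho>0 r by (auto simp: \<rho>_def)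
  obtain l0 where l0: "\<And>g. g \<in> G \<Longrightarrow> 0 < l0 g" and W': "\<And>g l. g \<in> G \<Longrightarrow> 0 < l \<Longrightarrow> l \<le> l0 g \<Longrightarrow> W g (d g) (\<kappa> g) \<rho> l"
    using W[OF _ \<rho>(1,3)] by metis
  define l where "l = Min (insert 1 (l0 ` G))"
  have l: "0 < l" "l \<le> 1" "\<And>g. g \<in> G \<Longrightarrow> l \<le> l0 g" using G l0 by (auto simp: l_def)
  define s where "s i = l * r i" for i
  define P where "P g w \<longleftrightarrow> (\<forall>k. \<exists>C. pser ?I s (w k) C) \<and> (\<forall>x\<in>polybox ?I' (s(j := \<rho>)).
      sgn (g x) = sgn (\<kappa> g) * sgn (x j ^ d g + (\<Sum>k<d g. w k x * x j ^ k)))" for g and w :: "nat \<Rightarrow> ('i \<Rightarrow> real) \<Rightarrow> real"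
  have "\<exists>w. P g w" if "g \<in> G" for g using W'[OF that l(1) l(3)[OF that]] unfolding W_def P_def s_def .
  then obtain w where "\<And>g. g \<in> G \<Longrightarrow> P g (w g)" by metis
  then have w: "\<And>g k. g \<in> G \<Longrightarrow> \<exists>C. pser ?I s (w g k) C"
    and sg: "\<And>g x. g \<in> G \<Longrightarrow> x \<in> polybox ?I' (s(j := \<rho>)) \<Longrightarrow>
      sgn (g x) = sgn (\<kappa> g) * sgn (x j ^ d g + (\<Sum>k<d g. w g k x * x j ^ k))" by (simp_all add: P_def)
  define p where "p g x = monom 1 (d g) + (\<Sum>k<d g. monom (w g k x) k)" for g x
  have pp: "poly (p g x) z = z ^ d g + (\<Sum>k<d g. w g k x * z ^ k)" for g x z
    by (simp add: p_def poly_sum poly_monom)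
  define A where "A = {f. \<exists>B. pser ?I s f B}"
  have A: "function_ring A" unfolding A_def by (rule function_ring_pser)
  \<comment> \<open>At least 1, so that the linear polynomials vanishing at \<rho> and
    \<open>- \<rho>\<close> fit into the family. With them \<sigma> fixes both points and maps the
    interval between them to itself.\<close>
  define D where "D = Max (insert 1 (d ` G))"
  have D: "1 \<le> D" "\<And>g. g \<in> G \<Longrightarrow> d g \<le> D" using G by (auto simp: D_def)
  have pc: "coeff (p g x) k = (if k = d g then 1 else if k < d g then w g k x else 0)" for g x k
    by (auto simp: p_def coeff_sum)
  have "p g \<in> poly_family A D" if g: "g \<in> G" for g
  proof -
    have "(\<lambda>x. coeff (p g x) k) \<in> A" for k
    proof (cases "k < d g")
      case True
      then show ?thesis unfolding pc using w[OF g, of k] by (simp add: A_def)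
    next
      case False
      then show ?thesis unfolding pc using function_ringD(1)[OF A] by (cases "k = d g") simp_all
    qed
    moreover have "degree (p g x) \<le> D" for x using D(2)[OF g] by (intro degree_le) (auto simp: pc)
    ultimately show ?thesis by (simp add: poly_family_def)
  qed
  moreover have "(\<lambda>_. [:u, 1:]) \<in> poly_family A D" for u
  proof -
    have "(\<lambda>x. coeff [:u, 1:] k) \<in> A" for k by (rule function_ringD(1)[OF A])
    then show ?thesis using D(1) by (simp add: poly_family_def)
  qed
  ultimately have "p ` G \<union> {\<lambda>_. [:- \<rho>, 1:], \<lambda>_. [:\<rho>, 1:]} \<subseteq> poly_family A D" by auto
  moreover have "finite (p ` G \<union> {\<lambda>_. [:- \<rho>, 1:], \<lambda>_. [:\<rho>, 1:]})" using G by simp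
  ultimately have "sign_determined A (p ` G \<union> {\<lambda>_. [:- \<rho>, 1:], \<lambda>_. [:\<rho>, 1:]})"
    using sign_determined_poly_family[OF A] by blast
  then obtain E where E: "finite E" "E \<subseteq> A"
    and \<sigma>E: "\<And>x x'. same_signs E x x' \<Longrightarrow> \<exists>\<sigma>. sign_automorphism (p ` G \<union> {\<lambda>_. [:- \<rho>, 1:], \<lambda>_. [:\<rho>, 1:]}) \<sigma> x x'"
    by (rule sign_determinedE) (rule that)
  have "sign_transfer t c J s E"
  proof (rule IH[OF E(1)])
    show "\<forall>i\<in>?I. 0 < s i" using r l by (simp add: s_def)
    show "\<forall>f\<in>E. \<exists>B. pser ?I s f B" using E(2) unfolding A_def by blast
  qed
  then obtain Y K \<delta> where \<delta>: "0 < \<delta>" "\<delta> \<le> 1" and Y: "Y \<subseteq> polybox ?I s" and pos: "\<And>x. x \<in> Y \<Longrightarrow> 0 < x t \<and> 0 < x c"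
    and inY: "\<And>x. x \<in> polybox ?I (\<lambda>_. \<delta>) \<Longrightarrow> 0 < x t \<Longrightarrow> 0 < x c \<Longrightarrow> x c < x t ^ K \<Longrightarrow> x \<in> Y"
    and trans: "\<And>x \<tau> \<gamma>. x \<in> Y \<Longrightarrow> 0 < \<tau> \<Longrightarrow> \<tau> < \<delta> \<Longrightarrow> 0 < \<gamma> \<Longrightarrow> \<gamma> < \<tau> ^ K \<Longrightarrow>
      \<exists>x'\<in>Y. x' t = \<tau> \<and> x' c = \<gamma> \<and> same_signs E x x'"
    by (rule sign_transferE) (rule that)
  define \<epsilon> where "\<epsilon> = min \<delta> \<rho>"
  define X where "X = {x(j := z) | x z. x \<in> Y \<and> \<bar>z\<bar> \<le> \<rho>}"
  have \<epsilon>: "0 < \<epsilon>" "\<epsilon> \<le> 1" "\<epsilon> \<le> \<delta>" "\<epsilon> \<le> \<rho>" using \<delta> \<rho>(1) by (auto simp: \<epsilon>_def)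
  have Xs: "x(j := z) \<in> polybox ?I' (s(j := \<rho>))" if "x \<in> Y" "\<bar>z\<bar> \<le> \<rho>" for x z
    using that Y jI by (auto simp: polybox_def)
  have gsgn: "sgn (g (x(j := z))) = sgn (\<kappa> g) * sgn (poly (p g x) z)" if g: "g \<in> G" and x: "x \<in> Y" and z: "\<bar>z\<bar> \<le> \<rho>" for g x z
  proof -
    have "w g k (x(j := z)) = w g k x" for k
    proof -
      obtain C where "pser ?I s (w g k) C" using w[OF g] by blast
      moreover have "x \<in> polybox ?I s" using x Y by blast
      ultimately have "w g k x = w g k (x(j := z))" by (rule pser_local) (use jI in auto)
      then show ?thesis ..
    qed
    then show ?thesis using sg[OF g Xs[OF x z]] by (simp add: pp)
  qed
  show ?thesis
  proof (rule sign_transferI[OF \<epsilon>(1,2)])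
    show "X \<subseteq> polybox ?I' r"
    proof
      fix y assume "y \<in> X"
      then have "y \<in> polybox ?I' (s(j := \<rho>))" using Xs by (auto simp: X_def)
      then show "y \<in> polybox ?I' r"
        by (rule polybox_mono) (use \<rho>(2) l r in \<open>auto simp: s_def mult_le_cancel_right2\<close>)
    qed
    show "0 < y t \<and> 0 < y c" if "y \<in> X" for y using that pos dist by (auto simp: X_def)
    show "y \<in> X" if y: "y \<in> polybox ?I' (\<lambda>_. \<epsilon>)" "0 < y t" "0 < y c" "y c < y t ^ K" for y
    proof -
      have "y \<in> polybox ?I (\<lambda>_. \<delta>)" by (rule polybox_mono[OF y(1)]) (use \<epsilon> in auto)
      then have "y \<in> Y" using y by (intro inY)
      moreover have "\<bar>y j\<bar> \<le> \<rho>" using y(1) \<epsilon> by (auto simp: polybox_def)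
      ultimately show ?thesis unfolding X_def by (metis (mono_tags, lifting) CollectI fun_upd_triv)
    qed
    fix y \<tau> \<gamma> assume "y \<in> X" and \<tau>: "0 < \<tau>" "\<tau> < \<epsilon>" and \<gamma>: "0 < \<gamma>" "\<gamma> < \<tau> ^ K"
    then obtain x z where x: "x \<in> Y" "\<bar>z\<bar> \<le> \<rho>" "y = x(j := z)" by (auto simp: X_def)
    have "\<tau> < \<delta>" using \<tau> \<epsilon> by simp
    then obtain x' where x': "x' \<in> Y" "x' t = \<tau>" "x' c = \<gamma>" "same_signs E x x'"
      using trans[OF x(1) \<tau>(1) _ \<gamma>] by blast
    obtain \<sigma> where \<sigma>: "sign_automorphism (p ` G \<union> {\<lambda>_. [:- \<rho>, 1:], \<lambda>_. [:\<rho>, 1:]}) \<sigma> x x'" using \<sigma>E[OF x'(4)] by blast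
    then have eq: "sgn (poly (p g x) z) = sgn (poly (p g x') (\<sigma> z))" if "g \<in> G" for g
      using that by (simp add: sign_automorphism_def)
    have "sgn (z - \<rho>) = sgn (\<sigma> z - \<rho>)" "sgn (z + \<rho>) = sgn (\<sigma> z + \<rho>)"
      using \<sigma> by (simp_all add: sign_automorphism_def add.commute[of \<rho>])
    then have z': "\<bar>\<sigma> z\<bar> \<le> \<rho>" using x(2) by (auto simp: sgn_if split: if_splits)
    have "same_signs G y (x'(j := \<sigma> z))"
      unfolding same_signs_def x(3) using gsgn[OF _ x(1,2)] gsgn[OF _ x'(1) z'] eq by simp
    moreover have "x'(j := \<sigma> z) \<in> X" unfolding X_def using x' z' by blast
    ultimately show "\<exists>x'\<in>X. x' t = \<tau> \<and> x' c = \<gamma> \<and> same_signs G y x'"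
      using x' dist by (intro bexI[of _ "x'(j := \<sigma> z)"]) auto
  qed
qed

text \<open>\<open>k\<close> is the largest of the exponents required by the members of
  \<open>F\<close>. For positive \<open>t\<close> and \<open>c\<close> the monomial that is split
  off is positive and does not affect the sign.\<close>

lemma pser_common_factor:
  fixes F :: "(('i \<Rightarrow> real) \<Rightarrow> real) set"
  assumes dist: "c \<noteq> t" "c \<notin> J" "t \<notin> J" and F: "finite F"
    and r: "\<forall>i\<in>insert c (insert t J). 0 < r i" "r t \<le> 1"
    and pF: "\<And>f. f \<in> F \<Longrightarrow> \<exists>B. pser (insert c (insert t J)) r f B"
    and nz: "\<And>f. f \<in> F \<Longrightarrow> \<exists>x\<in>polybox (insert c (insert t J)) r. f x \<noteq> 0"
  obtains k h e where "\<And>f. f \<in> F \<Longrightarrow> \<exists>D. pser (insert c (insert t J)) r (h f) D"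
    "\<And>f. f \<in> F \<Longrightarrow> \<exists>C. pser J r (e f) C" "\<And>f. f \<in> F \<Longrightarrow> \<exists>y\<in>polybox J r. e f y \<noteq> 0"
    "\<And>f x. f \<in> F \<Longrightarrow> x \<in> polybox (insert c (insert t J)) r \<Longrightarrow> 0 < x t \<Longrightarrow> 0 < x c \<Longrightarrow>
        sgn (f (x(c := x t ^ k * x c))) = sgn (h f x)"
    "\<And>f x. f \<in> F \<Longrightarrow> x \<in> polybox (insert c (insert t J)) r \<Longrightarrow> x t = 0 \<Longrightarrow> x c = 0 \<Longrightarrow> h f x = e f x"
proof -
  let ?I = "insert c (insert t J)"
  define Q where "Q f k h e \<longleftrightarrow> (\<exists>D. pser ?I r h D) \<and> (\<exists>C. pser J r e C) \<and> (\<exists>y\<in>polybox J r. e y \<noteq> 0) \<and>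
    (\<forall>x\<in>polybox ?I r. 0 < x t \<longrightarrow> 0 < x c \<longrightarrow> sgn (f (x(c := x t ^ k * x c))) = sgn (h x)) \<and>
    (\<forall>x\<in>polybox ?I r. x t = 0 \<longrightarrow> x c = 0 \<longrightarrow> h x = e x)" for f h e :: "('i \<Rightarrow> real) \<Rightarrow> real" and k :: nat
  have "\<exists>a. \<forall>k\<ge>a. \<exists>h e. Q f k h e" if f: "f \<in> F" for f
  proof -
    obtain B where B: "pser ?I r f B" using pF[OF f] by blast
    obtain x0 where x0: "x0 \<in> polybox ?I r" "f x0 \<noteq> 0" using nz[OF f] by blast
    obtain a b e C where e: "pser J r e C" "\<exists>y\<in>polybox J r. e y \<noteq> 0" and
      *: "\<forall>K\<ge>a. \<exists>h D. pser ?I r h D \<and>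
      (\<forall>x\<in>polybox ?I r. f (x(c := x t ^ K * x c)) = x t ^ (a + K * b) * x c ^ b * h x) \<and>
      (\<forall>x\<in>polybox ?I r. x t = 0 \<longrightarrow> x c = 0 \<longrightarrow> h x = e x)"
      using pser_factor[OF B dist r x0] by (elim exE conjE) (rule that)
    have "\<exists>h e. Q f k h e" if k: "a \<le> k" for k
    proof -
      obtain h D where h: "pser ?I r h D" "\<forall>x\<in>polybox ?I r. f (x(c := x t ^ k * x c)) = x t ^ (a + k * b) * x c ^ b * h x"
        "\<forall>x\<in>polybox ?I r. x t = 0 \<longrightarrow> x c = 0 \<longrightarrow> h x = e x"
        using *[rule_format, OF k] by (elim exE conjE) (rule that)
      have "sgn (f (x(c := x t ^ k * x c))) = sgn (h x)" if "x \<in> polybox ?I r" "0 < x t" "0 < x c" for x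
      proof -
        have "sgn (x t ^ (a + k * b) * x c ^ b) = 1" using that by (intro sgn_pos) simp
        then show ?thesis using h(2) that by (simp add: sgn_mult)
      qed
      then have "Q f k h e" unfolding Q_def using e h(1,3) by blast
      then show ?thesis by blast
    qed
    then show ?thesis by blast
  qed
  then obtain a where a: "\<And>f k. f \<in> F \<Longrightarrow> a f \<le> k \<Longrightarrow> \<exists>h e. Q f k h e" by metis
  define k where "k = Max (insert 0 (a ` F))"
  have "a f \<le> k" if "f \<in> F" for f using F that by (auto simp: k_def)
  then have "\<exists>h e. Q f k h e" if "f \<in> F" for f using a that by blast
  then obtain h e where Q: "\<And>f. f \<in> F \<Longrightarrow> Q f k (h f) (e f)" by metis
  show thesis
    by (rule that[of h e k]) (use Q in \<open>simp_all add: Q_def\<close>)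
qed

text \<open>Induction on \<open>J\<close>. Once no series vanishes identically on
  \<open>t = c = 0\<close>, there is a direction \<open>v\<close> in which none of their
  restrictions vanishes; the shear along \<open>v\<close> makes every series nonzero somewhere on
  the \<open>j\<close> axis, so that it can be prepared.\<close>

theorem sign_transfer_pser:
  fixes F :: "(('i \<Rightarrow> real) \<Rightarrow> real) set"
  assumes "finite J" and ct: "c \<noteq> t" "c \<notin> J" "t \<notin> J" and "finite F" "\<forall>i\<in>insert c (insert t J). 0 < r i"
    and "\<forall>f\<in>F. \<exists>B. pser (insert c (insert t J)) r f B"
  shows "sign_transfer t c J r F"
proof -
  define R where "R J r h e \<longleftrightarrow> (\<exists>D. pser (insert c (insert t J)) r h D) \<and> (\<exists>C. pser J r e C) \<and>
      (\<exists>y\<in>polybox J r. e y \<noteq> 0) \<and> (\<forall>x\<in>polybox (insert c (insert t J)) r. x t = 0 \<longrightarrow> x c = 0 \<longrightarrow> h x = e x)"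
    for J r and h e :: "('i \<Rightarrow> real) \<Rightarrow> real"
  \<comment> \<open>Reduction to series that do not vanish identically on \<open>t = c = 0\<close>:
    members of \<open>F\<close> vanishing on the whole box have sign 0 and drop out, the others lose
    their monomial factor. Radii are cut down to at most 1 so that powers of \<open>t\<close> do not
    leave the box.\<close>
  have regularize: "sign_transfer t c J r F"
    if dist: "c \<notin> J" "t \<notin> J" and F: "finite F" "\<forall>f\<in>F. \<exists>B. pser (insert c (insert t J)) r f B"
      and r: "\<forall>i\<in>insert c (insert t J). 0 < r i"
      and reg: "\<And>H r. finite H \<Longrightarrow> \<forall>h\<in>H. \<exists>e. R J r h e \<Longrightarrow> \<forall>i\<in>insert c (insert t J). 0 < r i \<and> r i \<le> 1 \<Longrightarrow>
        sign_transfer t c J r H" for J F r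
  proof -
    let ?I = "insert c (insert t J)"
    define s where "s i = min 1 (r i)" for i
    define F1 where "F1 = {f \<in> F. \<exists>x\<in>polybox ?I s. f x \<noteq> 0}"
    have s: "\<forall>i\<in>?I. 0 < s i" "s t \<le> 1" using r by (auto simp: s_def)
    have ps: "\<exists>B. pser ?I s f B" if f: "f \<in> F" for f
    proof -
      obtain B where "pser ?I r f B" using F(2) f by blast
      then have "pser ?I s f B" by (rule pser_widen) (auto simp: s_def)
      then show ?thesis by blast
    qed
    have "finite F1" using F(1) by (simp add: F1_def)
    then obtain k h e where h: "\<And>f. f \<in> F1 \<Longrightarrow> \<exists>D. pser ?I s (h f) D" "\<And>f. f \<in> F1 \<Longrightarrow> \<exists>C. pser J s (e f) C"
        "\<And>f. f \<in> F1 \<Longrightarrow> \<exists>y\<in>polybox J s. e f y \<noteq> 0"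
      and sg: "\<And>f x. f \<in> F1 \<Longrightarrow> x \<in> polybox ?I s \<Longrightarrow> 0 < x t \<Longrightarrow> 0 < x c \<Longrightarrow>
        sgn (f (x(c := x t ^ k * x c))) = sgn (h f x)"
      and he: "\<And>f x. f \<in> F1 \<Longrightarrow> x \<in> polybox ?I s \<Longrightarrow> x t = 0 \<Longrightarrow> x c = 0 \<Longrightarrow> h f x = e f x"
    proof (rule pser_common_factor[OF ct(1) dist _ s])
      show "\<exists>B. pser ?I s f B" if "f \<in> F1" for f using ps that by (simp add: F1_def)
      show "\<exists>x\<in>polybox ?I s. f x \<noteq> 0" if "f \<in> F1" for f using that by (simp add: F1_def)
    qed (rule that)
    have hF: "sign_transfer t c J s (h ` F1)"
    proof (rule reg)
      have "R J s (h f) (e f)" if "f \<in> F1" for f unfolding R_def using h[OF that] he[OF that] by blast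
      then show "\<forall>h\<in>h ` F1. \<exists>e. R J s h e" by blast
    qed (use \<open>finite F1\<close> s in \<open>auto simp: s_def\<close>)
    have sc: "0 < s c" using s by simp
    have "sign_transfer t c J s F1"
    proof (rule sign_transfer_rescale[OF ct(1) dist(1) sc s(2) hF])
      show "\<exists>h\<in>h ` F1. \<forall>x\<in>polybox ?I s. 0 < x t \<longrightarrow> 0 < x c \<longrightarrow> sgn (f (x(c := x t ^ k * x c))) = sgn (h x)"
        if "f \<in> F1" for f using sg[OF that] that by blast
    qed
    then obtain Y K \<delta> where Y: "0 < \<delta>" "\<delta> \<le> 1" "Y \<subseteq> polybox ?I s" "\<And>x. x \<in> Y \<Longrightarrow> 0 < x t \<and> 0 < x c"
      "\<And>x. x \<in> polybox ?I (\<lambda>_. \<delta>) \<Longrightarrow> 0 < x t \<Longrightarrow> 0 < x c \<Longrightarrow> x c < x t ^ K \<Longrightarrow> x \<in> Y"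
      and tr: "\<And>x \<tau> \<gamma>. x \<in> Y \<Longrightarrow> 0 < \<tau> \<Longrightarrow> \<tau> < \<delta> \<Longrightarrow> 0 < \<gamma> \<Longrightarrow> \<gamma> < \<tau> ^ K \<Longrightarrow>
        \<exists>x'\<in>Y. x' t = \<tau> \<and> x' c = \<gamma> \<and> same_signs F1 x x'" by (rule sign_transferE) (rule that)
    have "same_signs F x x'" if "x \<in> Y" "x' \<in> Y" "same_signs F1 x x'" for x x'
    proof -
      have "sgn (f x) = sgn (f x')" if "f \<in> F" for f
      proof (cases "f \<in> F1")
        case True
        then show ?thesis using \<open>same_signs F1 x x'\<close> by (simp add: same_signs_def)
      next
        case False
        then have "f z = 0" if "z \<in> Y" for z using \<open>f \<in> F\<close> Y(3) that by (auto simp: F1_def)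
        then show ?thesis using \<open>x \<in> Y\<close> \<open>x' \<in> Y\<close> by simp
      qed
      then show ?thesis by (simp add: same_signs_def)
    qed
    then have "\<exists>x'\<in>Y. x' t = \<tau> \<and> x' c = \<gamma> \<and> same_signs F x x'"
      if "x \<in> Y" "0 < \<tau>" "\<tau> < \<delta>" "0 < \<gamma>" "\<gamma> < \<tau> ^ K" for x \<tau> \<gamma> using tr[OF that] that(1) by blast
    with Y have "sign_transfer t c J s F" by (rule sign_transferI)
    then show ?thesis by (rule sign_transfer_mono) (simp add: s_def)
  qed
  show ?thesis
    using assms(1,3-7)
  proof (induction J arbitrary: F r rule: finite_induct)
    case empty
    show ?case
    proof (rule regularize[OF empty.prems(1,2,3,5,4)])
      fix H r assume H: "finite H" "\<forall>h\<in>H. \<exists>e. R {} r h e" and r: "\<forall>i\<in>{c, t}. 0 < r i \<and> r i \<le> 1"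
      have "h (\<lambda>_. 0) \<noteq> 0" if h: "h \<in> H" for h
      proof -
        obtain e C y where e: "pser {} r e C" "e y \<noteq> 0" "\<forall>x\<in>polybox {c, t} r. x t = 0 \<longrightarrow> x c = 0 \<longrightarrow> h x = e x"
          using H(2) h unfolding R_def by blast
        have "(\<lambda>_. 0) \<in> polybox {} r" by (simp add: polybox_def)
        then have "e (\<lambda>_. 0) = e y" by (rule pser_local[OF e(1)]) (erule emptyE)
        moreover have "(\<lambda>_. 0) \<in> polybox {c, t} r" using r by (auto simp: polybox_def)
        ultimately show ?thesis using e by simp
      qed
      moreover have "\<exists>B. pser {c, t} r h B" if "h \<in> H" for h using H(2) that unfolding R_def by blast
      ultimately show "sign_transfer t c {} r H" using H(1) r by (intro sign_transfer_base[OF ct(1)]) auto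
    qed
  next
    case (insert j J)
    let ?I = "insert c (insert t (insert j J))"
    show ?case
    proof (rule regularize[OF insert.prems(1,2,3,5,4)])
      fix H r assume H: "finite H" "\<forall>h\<in>H. \<exists>e. R (insert j J) r h e" and r: "\<forall>i\<in>?I. 0 < r i \<and> r i \<le> 1"
      obtain e where e: "\<And>h. h \<in> H \<Longrightarrow> R (insert j J) r h (e h)" using H(2) by metis
      have rJ: "0 < r i" if "i \<in> insert j J" for i using r that by auto
      \<comment> \<open>The coordinate \<open>x j\<close> joins the series that must not vanish at
        \<open>v\<close>, because the shear is invertible only if \<open>v j\<close> is
        nonzero.\<close>
      define Es where "Es = insert (\<lambda>x. x j) (e ` H)"
      have pE: "\<exists>B. pser (insert j J) r g B" if "g \<in> Es" for g
        using that e pser.coord[of j "insert j J" r] unfolding Es_def R_def by blast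
      have nE: "\<exists>x\<in>polybox (insert j J) r. g x \<noteq> 0" if "g \<in> Es" for g
      proof (cases "g \<in> e ` H")
        case True
        then show ?thesis using e unfolding R_def by blast
      next
        case False
        then have "g = (\<lambda>x. x j)" using that by (simp add: Es_def)
        moreover have "r \<in> polybox (insert j J) r" using rJ by (auto simp: polybox_def less_imp_le)
        ultimately show ?thesis using rJ[of j] by (intro bexI[of _ r]) auto
      qed
      have "finite Es" using H(1) by (simp add: Es_def)
      have finJ: "finite (insert j J)" using insert.hyps(1) by simp
      obtain u where u: "u \<in> polybox (insert j J) r" "\<forall>g\<in>Es. g u \<noteq> 0"
        using pser_common_nonzero[OF finJ rJ \<open>finite Es\<close> pE nE] by blast
      \<comment> \<open>The point \<open>u\<close> is only known to lie in the box. A multiple by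
        \<open>l < 1 / 2\<close> lies in the half box, as the shear demands, and small multiples
        still avoid the zeros.\<close>
      have "eventually (\<lambda>l. \<forall>g\<in>Es. g (\<lambda>i. l * u i) \<noteq> 0) (at 0)"
        unfolding eventually_ball_finite_distrib[OF \<open>finite Es\<close>]
        using pser_ray_eventually_nonzero[OF _ u(1)] u(2) pE by blast
      then have "eventually (\<lambda>l. \<forall>g\<in>Es. g (\<lambda>i. l * u i) \<noteq> 0) (at_right (0::real))"
        by (simp add: eventually_at_split)
      moreover have "eventually (\<lambda>l. l < 1 / 2 \<and> 0 < l) (at_right (0::real))"
        by (intro eventually_conj eventually_at_right_less order_tendstoD(2)[OF tendsto_ident_at]) auto
      ultimately have "eventually (\<lambda>l. (\<forall>g\<in>Es. g (\<lambda>i. l * u i) \<noteq> 0) \<and> l < 1 / 2 \<and> 0 < l) (at_right (0::real))"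
        by (rule eventually_conj)
      then obtain l :: real where l: "\<forall>g\<in>Es. g (\<lambda>i. l * u i) \<noteq> 0" "l < 1 / 2" "0 < l"
        using eventually_happens'[OF trivial_limit_at_right_real] by blast
      define v where "v = (\<lambda>i. l * u i)"
      have v: "\<forall>g\<in>Es. g v \<noteq> 0" using l(1) by (simp add: v_def)
      have vb: "\<forall>i\<in>insert j J. \<bar>v i\<bar> \<le> r i / 2"
      proof
        fix i assume "i \<in> insert j J"
        then have "\<bar>u i\<bar> \<le> r i" using u(1) unfolding polybox_def by blast
        then have "l * \<bar>u i\<bar> \<le> 1 / 2 * r i" using l by (intro mult_mono) auto
        then show "\<bar>v i\<bar> \<le> r i / 2" using l by (simp add: v_def abs_mult)
      qed
      have vj: "v j \<noteq> 0" using v by (simp add: Es_def)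
      \<comment> \<open>After the shear the \<open>j\<close> axis reaches \<open>v\<close> at
        \<open>x j = 1\<close>, so this value has to belong to the box.\<close>
      define s where "s i = (if i = j then 1 else r i / 2)" for i
      have dist: "c \<notin> insert j J" "t \<notin> insert j J" "j \<notin> J" "j \<noteq> c" "j \<noteq> t" using insert.prems insert.hyps by auto
      have "sign_transfer t c (insert j J) s ((\<lambda>h x. h (shear j J v x)) ` H)"
      proof (rule sign_transfer_weierstrass[OF ct(1) dist(1-3)])
        show "finite ((\<lambda>h x. h (shear j J v x)) ` H)" using H(1) by simp
        show "\<forall>i\<in>?I. 0 < s i" using r by (simp add: s_def)
        fix g assume "g \<in> (\<lambda>h x. h (shear j J v x)) ` H"
        then obtain h where h: "h \<in> H" "g = (\<lambda>x. h (shear j J v x))" by blast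
        obtain D where D: "pser ?I r h D" using e[OF h(1)] unfolding R_def by blast
        have "pser ?I s (\<lambda>x. h (shear j J v x)) D"
        proof (rule pser_compose[OF D])
          fix i assume i: "i \<in> ?I"
          have jc: "pser ?I s (\<lambda>x. v i * x j) (\<bar>v i\<bar> * 1)" for i
            using pser_cmult[OF pser.coord[of j ?I s], of "v i"] by (simp add: s_def)
          consider "i = j" | "i \<in> J" "i \<noteq> j" | "i \<noteq> j" "i \<notin> J" by blast
          then show "pser ?I s (\<lambda>x. shear j J v x i) (r i)"
          proof cases
            case 1
            have "\<bar>v j\<bar> * 1 \<le> r j" using vb r by fastforce
            then show ?thesis using 1 pser_mono[OF jc] by (simp add: shear_def mult.commute)
          next
            case 2
            have "s i + \<bar>v i\<bar> * 1 \<le> r i" using vb 2 by (auto simp: s_def)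
            then have "pser ?I s (\<lambda>x. x i + v i * x j) (r i)"
              using pser_mono[OF pser_add[OF pser.coord[OF i] jc]] by blast
            then show ?thesis using 2 by (simp add: shear_def mult.commute)
          next
            case 3
            have "s i \<le> r i" using 3 r i by (auto simp: s_def)
            then show ?thesis using 3 pser_mono[OF pser.coord[OF i]] by (simp add: shear_def)
          qed
        qed
        then show "\<exists>B. pser ?I s g B" unfolding h(2) by blast
        \<comment> \<open>The sheared unit point of the \<open>j\<close> axis is \<open>v\<close>
          with \<open>t = c = 0\<close>, where \<open>h\<close> agrees with
          \<open>e h\<close>.\<close>
        define p where "p = shear j J v ((\<lambda>_. 0)(j := 1))"
        have p: "p i = (if i \<in> insert j J then v i else 0)" for i by (simp add: p_def shear_def)
        have pv: "p \<in> polybox (insert j J) r" "p \<in> polybox ?I r"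
          using vb r by (fastforce simp: polybox_def p)+
        have "h p = e h p" using e[OF h(1)] pv(2) dist(1,2) unfolding R_def by (auto simp: p)
        moreover obtain C where "pser (insert j J) r (e h) C" using e[OF h(1)] unfolding R_def by blast
        then have "e h p = e h v" using pv(1) by (rule pser_local) (simp add: p)
        moreover have "e h v \<noteq> 0" using v h(1) by (simp add: Es_def)
        ultimately have "g ((\<lambda>_. 0)(j := 1)) \<noteq> 0" unfolding h(2) p_def by simp
        then show "\<exists>z. \<bar>z\<bar> \<le> s j \<and> g ((\<lambda>_. 0)(j := z)) \<noteq> 0" by (intro exI[of _ 1]) (simp add: s_def)
      next
        fix F s assume "finite F" "\<forall>i\<in>insert c (insert t J). 0 < s i" "\<forall>f\<in>F. \<exists>B. pser (insert c (insert t J)) s f B"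
        then show "sign_transfer t c J s F" using insert.IH insert.prems(1,2) by simp
      qed
      then show "sign_transfer t c (insert j J) r H"
        using dist r by (intro sign_transfer_shear[OF dist(1-3) vj vb]) (auto simp: s_def)
    qed
  qed
qed

section \<open>Real analytic maps and Milnor sets\<close>

definition pseries_at :: "(real^'m \<Rightarrow> real) \<Rightarrow> real^'m \<Rightarrow> real \<Rightarrow> (('m \<Rightarrow> nat) \<Rightarrow> real) \<Rightarrow> bool" where
  "pseries_at f x r c \<longleftrightarrow>
     (\<forall>y\<in>ball x r. ((\<lambda>\<alpha>. (\<Prod>i\<in>UNIV. (y $ i - x $ i) ^ \<alpha> i) * c \<alpha>) has_sum f y) UNIV)"

text \<open>Evaluation at the corner with all coordinates displaced by \<open>s\<close>, at distance
  at most \<open>r / 2\<close> from \<open>x\<close>: every monomial is there \<open>s\<close> to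
  the total degree, and unconditional convergence of a real series is absolute.\<close>

lemma pseries_at_summable:
  fixes f :: "real^'m \<Rightarrow> real"
  assumes f: "pseries_at f x r c" and r: "0 < r" and s: "s = r / (2 * real CARD('m))"
  shows "(\<lambda>\<alpha>. \<bar>c \<alpha>\<bar> * s ^ sum \<alpha> UNIV) summable_on UNIV"
proof -
  have s0: "0 < s" using r by (simp add: s)
  let ?y = "x + (\<chi> i. s)"
  have "norm (\<chi> i. s :: real^'m) \<le> (\<Sum>i\<in>UNIV. \<bar>(\<chi> i. s :: real^'m) $ i\<bar>)" by (rule norm_le_l1_cart)
  also have "\<dots> = r / 2" using r by (simp add: s)
  also have "\<dots> < r" using r by simp
  finally have "?y \<in> ball x r" by (simp add: dist_norm)
  then have hs: "((\<lambda>\<alpha>. (\<Prod>i\<in>UNIV. (?y $ i - x $ i) ^ \<alpha> i) * c \<alpha>) has_sum f ?y) UNIV"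
    using f unfolding pseries_at_def by (rule bspec[rotated])
  have eq: "(\<Prod>i\<in>UNIV. (?y $ i - x $ i) ^ \<alpha> i) = s ^ sum \<alpha> UNIV" for \<alpha> :: "'m \<Rightarrow> nat"
  proof -
    have "?y $ i - x $ i = s" for i by simp
    then show ?thesis by (simp only: power_sum)
  qed
  have "((\<lambda>\<alpha>. s ^ sum \<alpha> UNIV * c \<alpha>) has_sum f ?y) UNIV" using hs unfolding eq .
  then have "(\<lambda>\<alpha>. s ^ sum \<alpha> UNIV * c \<alpha>) summable_on UNIV" by (auto simp: summable_on_def)
  then have "(\<lambda>\<alpha>. norm (s ^ sum \<alpha> UNIV * c \<alpha>)) summable_on UNIV"
    by (rule summable_on_iff_abs_summable_on_real[THEN iffD1])
  then show ?thesis using s0 by (simp add: abs_mult mult.commute)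
qed

text \<open>Lets a sum over multi-indices be read as an ordinary series, for termwise
  differentiation and for the rule \<open>series\<close> of \<open>pser\<close>.\<close>

lemma multiindex_enumeration: "bij_betw (from_nat_into UNIV) UNIV (UNIV :: ('m::finite \<Rightarrow> nat) set)"
proof (rule bij_betw_from_nat_into)
  have "inj (\<lambda>n (_::'m). n :: nat)" by (auto intro: injI dest: fun_cong)
  then show "infinite (UNIV :: ('m \<Rightarrow> nat) set)" by (metis finite_imageD finite_subset infinite_UNIV_nat subset_UNIV)
qed simp

lemma pseries_at_subset: "pseries_at f x r c \<Longrightarrow> s \<le> r \<Longrightarrow> pseries_at f x s c"
  by (auto simp: pseries_at_def)

text \<open>Termwise differentiation on a ball where the differentiated series is uniformly
  dominated; \<open>g j\<close> is the \<open>j\<close>-th partial derivative.\<close>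

lemma pseries_at_derivative:
  fixes f :: "real^'m \<Rightarrow> real"
  assumes f: "pseries_at f x r c" and r: "0 < r"
  shows "\<exists>s>0. \<exists>g. (\<forall>j. \<exists>c'. pseries_at (g j) x s c') \<and>
    (\<forall>y\<in>ball x s. (f has_derivative (\<lambda>h. \<Sum>j\<in>UNIV. h $ j * g j y)) (at y))"
proof -
  define s where "s = r / (2 * real CARD('m))"
  have s0: "0 < s" using r by (simp add: s_def)
  have sr: "s / 2 \<le> r"
  proof -
    have "1 \<le> CARD('m)" using zero_less_card_finite[where 'a = 'm] by linarith
    then have "real 1 \<le> real CARD('m)" unfolding of_nat_le_iff .
    then have "1 \<le> 4 * real CARD('m)" unfolding of_nat_1 by linarith
    then show ?thesis using r by (simp add: s_def divide_simps)
  qed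
  define e :: "nat \<Rightarrow> 'm \<Rightarrow> nat" where "e = from_nat_into UNIV"
  have e: "bij_betw e UNIV UNIV" unfolding e_def by (rule multiindex_enumeration)
  \<comment> \<open>Majorant for coordinates within \<open>s / 2\<close>: the factor
    \<open>\<alpha> j\<close> from differentiation is at most 2 to the total degree, which turns
    powers of \<open>s / 2\<close> into powers of \<open>s\<close>; the power lost to
    differentiation is the factor \<open>2 / s\<close>.\<close>
  define b where "b \<alpha> = 2 / s * (\<bar>c \<alpha>\<bar> * s ^ sum \<alpha> UNIV)" for \<alpha> :: "'m \<Rightarrow> nat"
  have b: "b summable_on UNIV"
    unfolding b_def using pseries_at_summable[OF f r s_def] by (rule summable_on_cmult_right)
  have b0: "0 \<le> b \<alpha>" for \<alpha> using s0 by (simp add: b_def)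
  have "(\<lambda>n. b (e n)) summable_on UNIV" using b summable_on_reindex_bij_betw[OF e, of b] by simp
  then have bs: "summable (\<lambda>n. b (e n))" by (auto simp: summable_on_def dest!: has_sum_imp_sums simp: sums_iff)
  define S where "S = ball x (s / 2)"
  have yS: "\<bar>y $ i - x $ i\<bar> \<le> s / 2" if "y \<in> S" for y i
    using component_le_norm_cart[of "y - x" i] that by (simp add: S_def dist_norm norm_minus_commute)
  define P where "P j \<alpha> y = real (\<alpha> j) * (y $ j - x $ j) ^ (\<alpha> j - 1) * (\<Prod>k\<in>UNIV - {j}. (y $ k - x $ k) ^ \<alpha> k)"
    for j and \<alpha> :: "'m \<Rightarrow> nat" and y :: "real^'m"
  have Pb: "\<bar>P j \<alpha> y * c \<alpha>\<bar> \<le> b \<alpha>" if y: "y \<in> S" for j \<alpha> y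
  proof (cases "\<alpha> j = 0")
    case True
    then show ?thesis using b0[of \<alpha>] by (simp add: P_def)
  next
    case False
    have "\<bar>y $ j - x $ j\<bar> ^ (\<alpha> j - 1) * (\<Prod>k\<in>UNIV - {j}. \<bar>y $ k - x $ k\<bar> ^ \<alpha> k)
        \<le> (s / 2) ^ (\<alpha> j - 1) * (\<Prod>k\<in>UNIV - {j}. (s / 2) ^ \<alpha> k)"
      using yS[OF y] s0 by (intro mult_mono power_mono prod_mono prod_nonneg conjI) auto
    also have "\<dots> = (s / 2) ^ (\<alpha> j - 1 + sum \<alpha> (UNIV - {j}))" by (simp add: power_add power_sum)
    also have "\<alpha> j - 1 + sum \<alpha> (UNIV - {j}) = sum \<alpha> UNIV - 1"
      using False by (simp add: sum.remove[of UNIV j])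
    also have "(s / 2) ^ (sum \<alpha> UNIV - 1) = 2 / s * (s / 2) ^ sum \<alpha> UNIV"
    proof -
      have "sum \<alpha> UNIV = Suc (sum \<alpha> UNIV - 1)" using False sum.remove[of UNIV j \<alpha>] by simp
      then have "(s / 2) ^ sum \<alpha> UNIV = (s / 2) * (s / 2) ^ (sum \<alpha> UNIV - 1)" by (metis power_Suc)
      then show ?thesis using s0 by (simp add: field_simps)
    qed
    finally have 1: "\<bar>y $ j - x $ j\<bar> ^ (\<alpha> j - 1) * (\<Prod>k\<in>UNIV - {j}. \<bar>y $ k - x $ k\<bar> ^ \<alpha> k)
        \<le> 2 / s * (s / 2) ^ sum \<alpha> UNIV" .
    have "\<alpha> j \<le> sum \<alpha> UNIV" by (rule member_le_sum) auto
    also have "\<dots> \<le> 2 ^ sum \<alpha> UNIV" by (rule less_imp_le[OF less_exp])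
    finally have 2: "real (\<alpha> j) \<le> 2 ^ sum \<alpha> UNIV" by (metis of_nat_le_iff of_nat_numeral of_nat_power)
    have "\<bar>P j \<alpha> y\<bar> = real (\<alpha> j) * (\<bar>y $ j - x $ j\<bar> ^ (\<alpha> j - 1) * (\<Prod>k\<in>UNIV - {j}. \<bar>y $ k - x $ k\<bar> ^ \<alpha> k))"
      by (simp add: P_def abs_mult power_abs abs_prod)
    also have "\<dots> \<le> 2 ^ sum \<alpha> UNIV * (2 / s * (s / 2) ^ sum \<alpha> UNIV)"
      by (rule mult_mono[OF 2 1]) (auto intro!: mult_nonneg_nonneg prod_nonneg)
    also have "\<dots> = 2 / s * s ^ sum \<alpha> UNIV" by (simp add: power_divide)
    finally have "\<bar>P j \<alpha> y\<bar> * \<bar>c \<alpha>\<bar> \<le> 2 / s * s ^ sum \<alpha> UNIV * \<bar>c \<alpha>\<bar>" by (rule mult_right_mono) simp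
    then show ?thesis by (simp add: b_def abs_mult mult_ac)
  qed
  define g where "g j y = (\<Sum>\<^sub>\<infinity>\<alpha>. P j \<alpha> y * c \<alpha>)" for j y
  have Ps: "(\<lambda>\<alpha>. P j \<alpha> y * c \<alpha>) summable_on UNIV" if "y \<in> S" for j y
  proof (rule abs_summable_summable)
    show "(\<lambda>\<alpha>. norm (P j \<alpha> y * c \<alpha>)) summable_on UNIV"
      by (rule Infinite_Sum.abs_summable_on_comparison_test'[OF b]) (use Pb[OF that] in simp)
  qed
  then have gs: "((\<lambda>\<alpha>. P j \<alpha> y * c \<alpha>) has_sum g j y) UNIV" if "y \<in> S" for j y
    unfolding g_def using that by (intro has_sum_infsum)
  have "\<exists>c'. pseries_at (g j) x (s / 2) c'" for j
  proof (intro exI)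
    \<comment> \<open>Terms with \<open>\<alpha> j = 0\<close> vanish; reindexing the others by
      raising the \<open>j\<close>-th exponent exhibits \<open>g j\<close> as a power
      series.\<close>
    let ?h = "\<lambda>\<beta> :: 'm \<Rightarrow> nat. \<beta>(j := Suc (\<beta> j))"
    show "pseries_at (g j) x (s / 2) (\<lambda>\<beta>. real (Suc (\<beta> j)) * c (?h \<beta>))"
      unfolding pseries_at_def
    proof
      fix y assume "y \<in> ball x (s / 2)"
      then have y: "y \<in> S" by (simp add: S_def)
      have inj: "inj ?h"
      proof (rule injI)
        fix \<alpha> \<beta> :: "'m \<Rightarrow> nat" assume *: "?h \<alpha> = ?h \<beta>"
        show "\<alpha> = \<beta>"
        proof
          fix i show "\<alpha> i = \<beta> i" using fun_cong[OF *, of i] by (cases "i = j") auto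
        qed
      qed
      have rng: "\<alpha> \<in> range ?h" if "\<alpha> j \<noteq> 0" for \<alpha>
        using that by (intro image_eqI[of _ _ "\<alpha>(j := \<alpha> j - 1)"]) auto
      have "((\<lambda>\<alpha>. P j \<alpha> y * c \<alpha>) has_sum g j y) (range ?h)"
        using gs[OF y] by (rule has_sum_cong_neutral[THEN iffD1, rotated 3]) (use rng in \<open>auto simp: P_def\<close>)
      then have "((\<lambda>\<beta>. P j (?h \<beta>) y * c (?h \<beta>)) has_sum g j y) UNIV"
        by (subst (asm) has_sum_reindex[OF inj]) (simp add: o_def)
      moreover have "P j (?h \<beta>) y = (\<Prod>i\<in>UNIV. (y $ i - x $ i) ^ \<beta> i) * real (Suc (\<beta> j))" for \<beta>
      proof -
        have "(\<Prod>k\<in>UNIV - {j}. (y $ k - x $ k) ^ (?h \<beta>) k) = (\<Prod>k\<in>UNIV - {j}. (y $ k - x $ k) ^ \<beta> k)"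
          by (intro prod.cong) auto
        then show ?thesis by (simp add: P_def prod.remove[of UNIV j] del: of_nat_Suc)
      qed
      ultimately show "((\<lambda>\<beta>. (\<Prod>i\<in>UNIV. (y $ i - x $ i) ^ \<beta> i) * (real (Suc (\<beta> j)) * c (?h \<beta>))) has_sum g j y) UNIV"
        by (simp add: mult.assoc del: of_nat_Suc)
    qed
  qed
  moreover have "(f has_derivative (\<lambda>h. \<Sum>j\<in>UNIV. h $ j * g j y)) (at y)" if yS': "y \<in> S" for y
  proof -
    define F where "F n y = (\<Prod>i\<in>UNIV. (y $ i - x $ i) ^ e n i) * c (e n)" for n y
    define F' where "F' n y h = (\<Sum>j\<in>UNIV. h $ j * (P j (e n) y * c (e n)))" for n y h
    have gs': "(\<lambda>n. P j (e n) y * c (e n)) sums g j y" if "y \<in> S" for j y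
      using gs[OF that, of j] has_sum_reindex_bij_betw[OF e, of "\<lambda>\<alpha>. P j \<alpha> y * c \<alpha>"] by (intro has_sum_imp_sums) simp
    have Fs: "(\<lambda>n. F n y) sums f y" if "y \<in> S" for y
    proof -
      have "((\<lambda>\<alpha>. (\<Prod>i\<in>UNIV. (y $ i - x $ i) ^ \<alpha> i) * c \<alpha>) has_sum f y) UNIV"
        using f that sr by (auto simp: pseries_at_def S_def)
      then show ?thesis unfolding F_def
        using has_sum_reindex_bij_betw[OF e, of "\<lambda>\<alpha>. (\<Prod>i\<in>UNIV. (y $ i - x $ i) ^ \<alpha> i) * c \<alpha>"]
        by (intro has_sum_imp_sums) simp
    qed
    have "\<exists>G. \<forall>y\<in>S. (\<lambda>n. F n y) sums G y \<and> (G has_derivative (\<lambda>h. \<Sum>j\<in>UNIV. h $ j * g j y)) (at y within S)"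
    proof (rule has_derivative_series[where f' = F'])
      show "convex S" by (simp add: S_def)
      show "(F n has_derivative F' n y) (at y within S)" for n y
      proof -
        have "((\<lambda>y. (y $ i - x $ i) ^ e n i) has_derivative
            (\<lambda>h. h $ i * (real (e n i) * (y $ i - x $ i) ^ (e n i - 1)))) (at y within S)" for i
          by (rule derivative_eq_intros refl bounded_linear.has_derivative[OF bounded_linear_vec_nth] |
              simp add: fun_eq_iff mult_ac)+
        from has_derivative_mult_left[OF has_derivative_prod[where I = UNIV, OF this]]
        show ?thesis unfolding F_def F'_def P_def
          by (rule has_derivative_eq_rhs) (simp add: sum_distrib_left mult_ac fun_eq_iff)
      qed
      show "\<forall>\<^sub>F n in sequentially. \<forall>y\<in>S. \<forall>h. norm ((\<Sum>i<n. F' i y h) - (\<Sum>j\<in>UNIV. h $ j * g j y)) \<le> \<epsilon> * norm h"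
        if "0 < \<epsilon>" for \<epsilon>
      proof -
        have "0 < \<epsilon> / real CARD('m)" using that by simp
        then obtain N where N: "\<And>n. N \<le> n \<Longrightarrow> norm (\<Sum>i. b (e (i + n))) < \<epsilon> / real CARD('m)"
          using suminf_exist_split[OF _ bs] by metis
        have "norm ((\<Sum>i<n. F' i y h) - (\<Sum>j\<in>UNIV. h $ j * g j y)) \<le> \<epsilon> * norm h"
          if n: "N \<le> n" and y: "y \<in> S" for n y h
        proof -
          define p where "p j = (\<lambda>i. P j (e i) y * c (e i))" for j
          have ps: "summable (p j)" and pg: "suminf (p j) = g j y" for j
            using gs'[OF y, of j] by (auto simp: p_def sums_iff)
          have tail: "\<bar>(\<Sum>i<n. p j i) - g j y\<bar> \<le> \<epsilon> / real CARD('m)" for j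
          proof -
            have 1: "summable (\<lambda>i. b (e (i + n)))" using summable_ignore_initial_segment[OF bs] .
            have le: "\<bar>p j (i + n)\<bar> \<le> b (e (i + n))" for i using Pb[OF y] by (simp add: p_def)
            have 2: "summable (\<lambda>i. \<bar>p j (i + n)\<bar>)" by (rule summable_comparison_test'[OF 1]) (use le in simp)
            have "\<bar>(\<Sum>i<n. p j i) - g j y\<bar> = \<bar>\<Sum>i. p j (i + n)\<bar>"
              using suminf_minus_initial_segment[OF ps, of j n] pg by simp
            also have "\<dots> \<le> (\<Sum>i. \<bar>p j (i + n)\<bar>)" using 2 by (rule summable_rabs)
            also have "\<dots> \<le> (\<Sum>i. b (e (i + n)))" using le 2 1 by (rule suminf_le)
            also have "\<dots> \<le> \<epsilon> / real CARD('m)" using N[OF n] by simp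
            finally show ?thesis .
          qed
          have "(\<Sum>i<n. F' i y h) = (\<Sum>j\<in>UNIV. h $ j * (\<Sum>i<n. p j i))"
            unfolding F'_def p_def sum_distrib_left by (rule sum.swap)
          then have "(\<Sum>i<n. F' i y h) - (\<Sum>j\<in>UNIV. h $ j * g j y) = (\<Sum>j\<in>UNIV. h $ j * ((\<Sum>i<n. p j i) - g j y))"
            by (simp add: sum_subtractf right_diff_distrib)
          also have "\<bar>\<dots>\<bar> \<le> (\<Sum>j\<in>(UNIV::'m set). norm h * (\<epsilon> / real CARD('m)))"
          proof (rule order_trans[OF sum_abs sum_mono])
            fix j
            show "\<bar>h $ j * ((\<Sum>i<n. p j i) - g j y)\<bar> \<le> norm h * (\<epsilon> / real CARD('m))"
              unfolding abs_mult using tail[of j] component_le_norm_cart[of h j] by (intro mult_mono) auto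
          qed
          also have "\<dots> = \<epsilon> * norm h" by simp
          finally show ?thesis by simp
        qed
        then show ?thesis unfolding eventually_sequentially by blast
      qed
      show "y \<in> S" "(\<lambda>n. F n y) sums f y" using yS' Fs by auto
    qed
    then obtain G where G: "\<And>y. y \<in> S \<Longrightarrow> (\<lambda>n. F n y) sums G y"
      "\<And>y. y \<in> S \<Longrightarrow> (G has_derivative (\<lambda>h. \<Sum>j\<in>UNIV. h $ j * g j y)) (at y within S)" by blast
    have "G z = f z" if "z \<in> S" for z using G(1)[OF that] Fs[OF that] by (rule sums_unique2)
    moreover have "open S" by (simp add: S_def)
    moreover have "(G has_derivative (\<lambda>h. \<Sum>j\<in>UNIV. h $ j * g j y)) (at y)"
      using G(2)[OF yS'] unfolding at_within_open[OF yS' \<open>open S\<close>] .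
    ultimately show ?thesis using yS' has_derivative_transform_within_open by blast
  qed
  ultimately show ?thesis using s0 unfolding S_def
    by (intro exI[of _ "s / 2"] conjI exI[of _ g]) auto
qed

definition analytic_fun :: "(real^'m) set \<Rightarrow> (real^'m \<Rightarrow> real) \<Rightarrow> bool" where
  "analytic_fun U f \<longleftrightarrow> (\<forall>x\<in>U. \<exists>r>0. \<exists>c. pseries_at f x r c)"

lemma real_analytic_on_component:
  assumes "real_analytic_on U G"
  shows "analytic_fun U (\<lambda>x. G x $ k)"
  unfolding analytic_fun_def
proof
  fix x assume "x \<in> U"
  then obtain r c where r: "0 < r"
    and c: "\<forall>y\<in>ball x r. ((\<lambda>\<alpha>. (\<Prod>i\<in>UNIV. (y $ i - x $ i) ^ \<alpha> i) *\<^sub>R c \<alpha>) has_sum G y) UNIV"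
    using assms unfolding real_analytic_on_def by blast
  have "((\<lambda>\<alpha>. ((\<Prod>i\<in>UNIV. (y $ i - x $ i) ^ \<alpha> i) *\<^sub>R c \<alpha>) $ k) has_sum G y $ k) UNIV" if "y \<in> ball x r" for y
    using has_sum_bounded_linear[OF bounded_linear_vec_nth] c that by blast
  then have "pseries_at (\<lambda>x. G x $ k) x r (\<lambda>\<alpha>. c \<alpha> $ k)" by (simp add: pseries_at_def)
  then show "\<exists>r>0. \<exists>c. pseries_at (\<lambda>x. G x $ k) x r c" using r by blast
qed

lemma analytic_fun_cong:
  assumes "analytic_fun U f" "open U" "\<And>x. x \<in> U \<Longrightarrow> f x = g x"
  shows "analytic_fun U g"
  unfolding analytic_fun_def
proof
  fix x assume x: "x \<in> U"
  then obtain r c where r: "0 < r" "pseries_at f x r c" using assms(1) unfolding analytic_fun_def by blast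
  obtain d where d: "0 < d" "ball x d \<subseteq> U" using assms(2) x by (meson open_contains_ball)
  have "pseries_at g x (min r d) c"
    unfolding pseries_at_def
  proof
    fix y assume "y \<in> ball x (min r d)"
    then have y: "y \<in> ball x r" "y \<in> U" using d by auto
    then show "((\<lambda>\<alpha>. (\<Prod>i\<in>UNIV. (y $ i - x $ i) ^ \<alpha> i) * c \<alpha>) has_sum g y) UNIV"
      using r(2) assms(3) unfolding pseries_at_def by metis
  qed
  moreover have "0 < min r d" using r d by simp
  ultimately show "\<exists>r>0. \<exists>c. pseries_at g x r c" by blast
qed

lemma has_sum_finite_sum:
  fixes f :: "'i \<Rightarrow> 'b \<Rightarrow> real"
  assumes "finite I" "\<And>i. i \<in> I \<Longrightarrow> (f i has_sum s i) A"
  shows "((\<lambda>x. \<Sum>i\<in>I. f i x) has_sum (\<Sum>i\<in>I. s i)) A"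
  using assms by (induction I rule: finite_induct) (auto intro: has_sum_0 has_sum_add)

lemma analytic_fun_derivative:
  assumes "analytic_fun U f"
  shows "x \<in> U \<Longrightarrow> f differentiable (at x)" "analytic_fun U (\<lambda>x. frechet_derivative f (at x) v)"
proof -
  have main: "f differentiable (at x) \<and> (\<exists>r>0. \<exists>c. pseries_at (\<lambda>x. frechet_derivative f (at x) v) x r c)"
    if x: "x \<in> U" for x
  proof -
    obtain r c where r: "0 < r" "pseries_at f x r c" using assms x unfolding analytic_fun_def by blast
    obtain s g where s: "0 < s" and g: "\<forall>j. \<exists>c'. pseries_at (g j) x s c'"
      and d: "\<forall>y\<in>ball x s. (f has_derivative (\<lambda>h. \<Sum>j\<in>UNIV. h $ j * g j y)) (at y)"
      using pseries_at_derivative[OF r(2,1)] by blast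
    obtain c' where c': "\<And>j. pseries_at (g j) x s (c' j)" using g by metis
    have "pseries_at (\<lambda>x. frechet_derivative f (at x) v) x s (\<lambda>\<alpha>. \<Sum>j\<in>UNIV. v $ j * c' j \<alpha>)"
      unfolding pseries_at_def
    proof
      fix y assume y: "y \<in> ball x s"
      have "((\<lambda>\<alpha>. (\<Prod>i\<in>UNIV. (y $ i - x $ i) ^ \<alpha> i) * c' j \<alpha>) has_sum g j y) UNIV" for j
        using c' y unfolding pseries_at_def by blast
      then have "((\<lambda>\<alpha>. \<Sum>j\<in>UNIV. v $ j * ((\<Prod>i\<in>UNIV. (y $ i - x $ i) ^ \<alpha> i) * c' j \<alpha>)) has_sum
          (\<Sum>j\<in>UNIV. v $ j * g j y)) UNIV" by (intro has_sum_finite_sum has_sum_cmult_right) auto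
      moreover have "frechet_derivative f (at y) v = (\<Sum>j\<in>UNIV. v $ j * g j y)"
        using frechet_derivative_at[OF bspec[OF d y]] by metis
      moreover have "(\<Prod>i\<in>UNIV. (y $ i - x $ i) ^ \<alpha> i) * (\<Sum>j\<in>UNIV. v $ j * c' j \<alpha>) =
          (\<Sum>j\<in>UNIV. v $ j * ((\<Prod>i\<in>UNIV. (y $ i - x $ i) ^ \<alpha> i) * c' j \<alpha>))" for \<alpha>
        by (simp add: sum_distrib_left mult.left_commute)
      ultimately show "((\<lambda>\<alpha>. (\<Prod>i\<in>UNIV. (y $ i - x $ i) ^ \<alpha> i) * (\<Sum>j\<in>UNIV. v $ j * c' j \<alpha>)) has_sum
          frechet_derivative f (at y) v) UNIV" by (simp only:)
    qed
    moreover have "f differentiable (at x)" using d s by (auto simp: differentiable_def)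
    ultimately show ?thesis using s by blast
  qed
  show "x \<in> U \<Longrightarrow> f differentiable (at x)" using main by blast
  show "analytic_fun U (\<lambda>x. frechet_derivative f (at x) v)" using main unfolding analytic_fun_def by blast
qed

lemma has_derivative_vec:
  fixes f :: "'a::real_normed_vector \<Rightarrow> real^'p"
  shows "(f has_derivative f') (at x) \<longleftrightarrow> (\<forall>k. ((\<lambda>x. f x $ k) has_derivative (\<lambda>h. f' h $ k)) (at x))"
  by (subst has_derivative_componentwise_within) (simp add: Basis_vec_def inner_axis)

lemma components_differentiable:
  fixes f :: "'a::euclidean_space \<Rightarrow> real^'p"
  assumes "\<And>k. (\<lambda>x. f x $ k) differentiable (at x)"
  shows "f differentiable (at x)" "frechet_derivative f (at x) v $ k = frechet_derivative (\<lambda>x. f x $ k) (at x) v"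
proof -
  let ?D = "\<lambda>h. \<chi> k. frechet_derivative (\<lambda>x. f x $ k) (at x) h"
  have "(f has_derivative ?D) (at x)"
    unfolding has_derivative_vec using assms by (simp add: frechet_derivative_works[symmetric])
  then show "f differentiable (at x)" by (rule differentiableI)
  have "?D = frechet_derivative f (at x)" using \<open>(f has_derivative ?D) (at x)\<close> by (rule frechet_derivative_at)
  then have "frechet_derivative f (at x) v = ?D v" by metis
  then show "frechet_derivative f (at x) v $ k = frechet_derivative (\<lambda>x. f x $ k) (at x) v" by simp
qed

text \<open>Directional derivatives of analytic functions are analytic on the same set, so the
  induction runs over all such \<open>f\<close> at once.\<close>

lemma Ck_on_analytic:
  fixes f :: "real^'m \<Rightarrow> real^'p"
  assumes "open U" "\<And>k. analytic_fun U (\<lambda>x. f x $ k)"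
  shows "Ck_on n U f"
  using assms(2)
proof (induction n arbitrary: f)
  case 0
  have "f differentiable (at x)" if "x \<in> U" for x
    using analytic_fun_derivative(1)[OF 0 that] by (rule components_differentiable)
  then show ?case
    by (auto intro!: differentiable_imp_continuous_on simp: differentiable_on_def differentiable_at_withinI)
next
  case (Suc n)
  have d: "(\<lambda>x. f x $ k) differentiable (at x)" if "x \<in> U" for x k
    using analytic_fun_derivative(1)[OF Suc.prems that] .
  have "analytic_fun U (\<lambda>x. frechet_derivative f (at x) v $ k)" for v k
    by (rule analytic_fun_cong[OF analytic_fun_derivative(2)[OF Suc.prems] assms(1)])
      (use components_differentiable(2)[OF d] in simp)
  then have "Ck_on n U (\<lambda>x. frechet_derivative f (at x) v)" for v by (rule Suc.IH)
  then show ?case using components_differentiable(1)[OF d] by simp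
qed

lemma Ck_on_const: "Ck_on n S (\<lambda>_. c)"
  by (induction n arbitrary: c) auto

lemma smooth_on_line: "smooth_on S (\<lambda>s::real. y + s *\<^sub>R v)"
  unfolding smooth_on_def
proof
  fix n
  have d: "((\<lambda>s::real. y + s *\<^sub>R v) has_derivative (\<lambda>h. h *\<^sub>R v)) (at s)" for s
    by (auto intro!: derivative_eq_intros)
  show "Ck_on n S (\<lambda>s::real. y + s *\<^sub>R v)"
  proof (cases n)
    case 0
    then show ?thesis by (auto intro!: continuous_intros)
  next
    case (Suc k)
    then show ?thesis using d by (auto simp: differentiable_def frechet_derivative_at[OF d, symmetric] Ck_on_const)
  qed
qed

text \<open>Derivatives are again of this form, with \<open>p\<close> and \<open>q\<close> exchanged
  and scaled, whence the induction over all \<open>p\<close> and \<open>q\<close>.\<close>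

lemma smooth_on_circle: "smooth_on S (\<lambda>s::real. cos (w * s) *\<^sub>R p + sin (w * s) *\<^sub>R q)"
  unfolding smooth_on_def
proof
  fix n
  show "Ck_on n S (\<lambda>s::real. cos (w * s) *\<^sub>R p + sin (w * s) *\<^sub>R q)"
  proof (induction n arbitrary: p q)
    case 0
    then show ?case by (auto intro!: continuous_intros)
  next
    case (Suc n)
    have d: "((\<lambda>s::real. cos (w * s) *\<^sub>R p + sin (w * s) *\<^sub>R q) has_derivative
        (\<lambda>h. cos (w * s) *\<^sub>R ((h * w) *\<^sub>R q) + sin (w * s) *\<^sub>R ((- h * w) *\<^sub>R p))) (at s)" for s and p q
      by (auto intro!: derivative_eq_intros simp: fun_eq_iff algebra_simps)
    have "Ck_on n S (\<lambda>s. frechet_derivative (\<lambda>s. cos (w * s) *\<^sub>R p + sin (w * s) *\<^sub>R q) (at s) h)" for h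
      unfolding frechet_derivative_at[OF d, symmetric] by (rule Suc.IH)
    moreover have "(\<lambda>s. cos (w * s) *\<^sub>R p + sin (w * s) *\<^sub>R q) differentiable (at s)" for s
      by (rule differentiableI[OF d])
    ultimately show ?case by simp
  qed
qed

section \<open>Tangent vectors and transversality to spheres\<close>

lemma tangent_space_open:
  assumes "open Y" "y \<in> Y"
  shows "tangent_space Y y = UNIV"
proof -
  have "v \<in> tangent_space Y y" for v
  proof -
    define \<gamma> where "\<gamma> s = y + s *\<^sub>R v" for s :: real
    have "isCont \<gamma> 0" unfolding \<gamma>_def by (intro continuous_intros)
    then have "(\<gamma> \<longlongrightarrow> \<gamma> 0) (nhds 0)" by (simp add: isCont_def tendsto_at_iff_tendsto_nhds)
    then have "eventually (\<lambda>s. \<gamma> s \<in> Y) (nhds 0)" using assms(1)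
      by (rule topological_tendstoD) (simp add: \<gamma>_def assms(2))
    then have "eventually (\<lambda>s. y + s *\<^sub>R v \<in> Y) (nhds (0::real))" by (simp add: \<gamma>_def)
    then obtain \<delta> where \<delta>: "0 < \<delta>" "\<And>s. \<bar>s\<bar> < \<delta> \<Longrightarrow> y + s *\<^sub>R v \<in> Y"
      by (auto simp: eventually_nhds_metric dist_real_def)
    have "((\<lambda>s::real. y + s *\<^sub>R v) has_vector_derivative v) (at 0)"
      by (auto intro!: derivative_eq_intros)
    then show ?thesis unfolding tangent_space_def
      using \<delta> smooth_on_line[of "{-\<delta><..<\<delta>}" y v]
      by (intro CollectI exI[of _ \<delta>] conjI exI[of _ "\<lambda>s. y + s *\<^sub>R v"]) (auto simp: abs_less_iff)
  qed
  then show ?thesis by blast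
qed

text \<open>The great circle through \<open>x\<close> with initial velocity \<open>v\<close> stays
  on the sphere for all time and in \<open>W\<close> for a short time.\<close>

lemma tangent_space_sphere:
  fixes x v :: "'a::euclidean_space"
  assumes "open W" "x \<in> W" "norm x = \<epsilon>" "0 < \<epsilon>" "x \<bullet> v = 0"
  shows "v \<in> tangent_space (sphere 0 \<epsilon> \<inter> W) x"
proof -
  \<comment> \<open>The angular speed. For \<open>v = 0\<close> the conventions on division give
    \<open>w = 0\<close> and \<open>q = 0\<close>, and the circle degenerates to a constant
    curve.\<close>
  define w where "w = norm v / \<epsilon>"
  define q where "q = (1 / w) *\<^sub>R v"
  define \<gamma> where "\<gamma> s = cos (w * s) *\<^sub>R x + sin (w * s) *\<^sub>R q" for s
  have wq: "w *\<^sub>R q = v" using assms(4) by (auto simp: q_def w_def)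
  have xq: "x \<bullet> q = 0" using assms(5) by (simp add: q_def)
  have \<gamma>\<epsilon>: "norm (\<gamma> s) = \<epsilon>" for s
  proof (cases "v = 0")
    case True
    then show ?thesis using assms(3) by (simp add: \<gamma>_def w_def)
  next
    case False
    then have "q \<bullet> q = \<epsilon>\<^sup>2" using assms(4) by (simp add: q_def w_def dot_square_norm power_divide field_simps)
    moreover have "x \<bullet> x = \<epsilon>\<^sup>2" using assms(3) by (simp add: dot_square_norm)
    ultimately have "\<gamma> s \<bullet> \<gamma> s = ((cos (w * s))\<^sup>2 + (sin (w * s))\<^sup>2) * \<epsilon>\<^sup>2"
      using xq unfolding distrib_right
      by (simp add: \<gamma>_def inner_add_left inner_add_right inner_commute[of q x] power2_eq_square)
    also have "\<dots> = \<epsilon>\<^sup>2" by simp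
    finally have "(norm (\<gamma> s))\<^sup>2 = \<epsilon>\<^sup>2" by (simp add: dot_square_norm)
    then show ?thesis using assms(4) by (simp add: power2_eq_iff_nonneg)
  qed
  have "isCont \<gamma> 0" unfolding \<gamma>_def by (intro continuous_intros)
  then have "(\<gamma> \<longlongrightarrow> \<gamma> 0) (nhds 0)" by (simp add: isCont_def tendsto_at_iff_tendsto_nhds)
  moreover have \<gamma>0: "\<gamma> 0 = x" by (simp add: \<gamma>_def)
  ultimately have "eventually (\<lambda>s. \<gamma> s \<in> W) (nhds 0)" using assms(1,2) by (intro topological_tendstoD) simp_all
  then have "eventually (\<lambda>s. \<gamma> s \<in> sphere 0 \<epsilon> \<inter> W) (nhds 0)" using \<gamma>\<epsilon> by simp
  then obtain \<delta> where \<delta>: "0 < \<delta>" "\<And>s. \<bar>s\<bar> < \<delta> \<Longrightarrow> \<gamma> s \<in> sphere 0 \<epsilon> \<inter> W"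
    unfolding eventually_nhds_metric by (auto simp: dist_real_def)
  have "(\<gamma> has_vector_derivative w *\<^sub>R q) (at 0)"
    unfolding \<gamma>_def by (auto intro!: derivative_eq_intros)
  moreover have "smooth_on {-\<delta><..<\<delta>} \<gamma>" unfolding \<gamma>_def by (rule smooth_on_circle)
  ultimately show ?thesis unfolding tangent_space_def
    using \<delta> \<gamma>0 wq by (intro CollectI exI[of _ \<delta>] conjI exI[of _ \<gamma>]) (auto simp: abs_less_iff)
qed

lemma gradient_inner:
  fixes f :: "real^'m \<Rightarrow> real"
  assumes "f differentiable (at x)"
  shows "gradient f x \<bullet> v = frechet_derivative f (at x) v"
proof -
  interpret linear "frechet_derivative f (at x)" using assms by (rule linear_frechet_derivative)
  have "frechet_derivative f (at x) v = frechet_derivative f (at x) (\<Sum>j\<in>UNIV. v $ j *\<^sub>R axis j 1)"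
    using basis_expansion[of v] by (simp add: scalar_mult_eq_scaleR)
  also have "\<dots> = (\<Sum>j\<in>UNIV. v $ j * frechet_derivative f (at x) (axis j 1))" by (simp add: sum scale)
  finally show ?thesis by (simp add: gradient_def inner_vec_def mult.commute)
qed

lemma gradient_norm_sq: "gradient (\<lambda>y. (norm y)\<^sup>2) x = 2 *\<^sub>R (x :: real^'m)"
proof -
  have d: "((\<lambda>y::real^'m. (norm y)\<^sup>2) has_derivative (\<lambda>h. 2 * (x \<bullet> h))) (at x)"
    unfolding power2_norm_eq_inner by (auto intro!: derivative_eq_intros simp: inner_commute)
  have "gradient (\<lambda>y. (norm y)\<^sup>2) x \<bullet> v = (2 *\<^sub>R x) \<bullet> v" for v
    using gradient_inner[OF differentiableI[OF d], of v] fun_cong[OF frechet_derivative_at[OF d], of v] by simp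
  then show ?thesis by (rule vector_eq_rdot[THEN iffD1, OF allI])
qed

text \<open>Testing the relation among gradients against all vectors turns the coefficients into a
  vector \<open>b\<close> of the target, which can be compared with the image of a tangent space
  under the differential.\<close>

lemma Milnor_set_iff:
  fixes G :: "real^'m \<Rightarrow> real^'p"
  assumes "G differentiable (at x)"
  shows "x \<in> Milnor_set U G \<longleftrightarrow> x \<in> U \<and> (\<exists>a b. (a \<noteq> 0 \<or> b \<noteq> 0) \<and>
    (\<forall>v. 2 * a * (x \<bullet> v) + b \<bullet> frechet_derivative G (at x) v = 0))"
proof -
  have dk: "(\<lambda>y. G y $ k) differentiable (at x)" for k
    using assms unfolding differentiable_def has_derivative_vec by blast
  have eq: "a *\<^sub>R gradient (\<lambda>y. (norm y)\<^sup>2) x + (\<Sum>i\<in>UNIV. b $ i *\<^sub>R gradient (\<lambda>y. G y $ i) x) = 0 \<longleftrightarrow>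
    (\<forall>v. 2 * a * (x \<bullet> v) + b \<bullet> frechet_derivative G (at x) v = 0)" for a and b :: "real^'p"
  proof -
    have "(a *\<^sub>R gradient (\<lambda>y. (norm y)\<^sup>2) x + (\<Sum>i\<in>UNIV. b $ i *\<^sub>R gradient (\<lambda>y. G y $ i) x)) \<bullet> v =
      2 * a * (x \<bullet> v) + b \<bullet> frechet_derivative G (at x) v" for v
      by (simp add: gradient_norm_sq inner_add_left inner_sum_left gradient_inner[OF dk]
          components_differentiable(2)[OF dk] inner_vec_def[of b])
    then show ?thesis by (subst vector_eq_rdot[symmetric]) (simp only: inner_zero_left)
  qed
  have nz: "(\<exists>i. b $ i \<noteq> 0) \<longleftrightarrow> b \<noteq> 0" for b :: "real^'p" by (simp add: vec_eq_iff)
  show ?thesis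
  proof
    assume "x \<in> Milnor_set U G"
    then obtain a b where x: "x \<in> U" and ab: "a \<noteq> 0 \<or> (\<exists>i. b i \<noteq> 0)"
      "a *\<^sub>R gradient (\<lambda>y. (norm y)\<^sup>2) x + (\<Sum>i\<in>UNIV. b i *\<^sub>R gradient (\<lambda>y. G y $ i) x) = 0"
      unfolding Milnor_set_def by blast
    have "(\<forall>v. 2 * a * (x \<bullet> v) + (\<chi> i. b i) \<bullet> frechet_derivative G (at x) v = 0)"
      using ab(2) by (subst eq[symmetric]) simp
    moreover have "a \<noteq> 0 \<or> (\<chi> i. b i) \<noteq> 0" using ab(1) nz[of "\<chi> i. b i"] by simp
    ultimately show "x \<in> U \<and> (\<exists>a b. (a \<noteq> 0 \<or> b \<noteq> 0) \<and>
      (\<forall>v. 2 * a * (x \<bullet> v) + b \<bullet> frechet_derivative G (at x) v = 0))" using x by blast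
  next
    assume "x \<in> U \<and> (\<exists>a b. (a \<noteq> 0 \<or> b \<noteq> 0) \<and>
      (\<forall>v. 2 * a * (x \<bullet> v) + b \<bullet> frechet_derivative G (at x) v = 0))"
    then obtain a b where x: "x \<in> U" and ab: "a \<noteq> 0 \<or> b \<noteq> 0"
      "\<forall>v. 2 * a * (x \<bullet> v) + b \<bullet> frechet_derivative G (at x) v = 0" by blast
    have "a *\<^sub>R gradient (\<lambda>y. (norm y)\<^sup>2) x + (\<Sum>i\<in>UNIV. b $ i *\<^sub>R gradient (\<lambda>y. G y $ i) x) = 0"
      using ab(2) by (subst eq)
    then show "x \<in> Milnor_set U G" unfolding Milnor_set_def
      using x ab(1) nz by (intro CollectI conjI exI[of _ a] exI[of _ "($) b"]) auto
  qed
qed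

lemma has_derivative_cong_nhds:
  assumes "(f has_derivative f') (at x)" "eventually (\<lambda>y. f y = g y) (nhds x)"
  shows "(g has_derivative f') (at x)"
proof (rule has_derivative_transform_eventually[OF assms(1)])
  show "eventually (\<lambda>y. f y = g y) (at x)" using assms(2) by (simp add: eventually_at_filter eventually_mono)
  show "f x = g x" using assms(2) by (rule eventually_nhds_x_imp_x)
qed simp

text \<open>On vectors orthogonal to \<open>x\<close>, a relation \<open>(a, b)\<close> says that
  \<open>b\<close> is orthogonal to their image under the differential. If this image is everything,
  \<open>b = 0\<close> and then \<open>a = 0\<close>; if it is not, a nonzero normal vector
  \<open>b\<close> of it extends to a relation.\<close>

lemma smooth_submersion_slice_iff:
  fixes G :: "real^'m \<Rightarrow> real^'p" and \<eta> :: real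
  assumes U: "open U" and an: "real_analytic_on U G" and \<epsilon>: "0 < \<epsilon>"
  defines "X \<equiv> sphere 0 \<epsilon> \<inter> {x \<in> U. G x \<in> ball 0 \<eta> - {0}}"
  shows "smooth_submersion X (ball 0 \<eta> - {0}) G \<longleftrightarrow> Milnor_set U G \<inter> X = {}"
proof -
  let ?Y = "ball 0 \<eta> - {0} :: (real^'p) set"
  have Y: "open ?Y" by (simp add: open_delete)
  have comp: "\<And>k. analytic_fun U (\<lambda>x. G x $ k)" using an by (rule real_analytic_on_component)
  have sm: "smooth_on U G" unfolding smooth_on_def using Ck_on_analytic[OF U comp] by blast
  have dG: "G differentiable (at x)" if "x \<in> U" for x
    using analytic_fun_derivative(1)[OF comp that] by (rule components_differentiable)
  have cG: "continuous_on U G"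
    by (auto intro!: differentiable_imp_continuous_on simp: differentiable_on_def differentiable_at_withinI dG)
  define W where "W = {x \<in> U. G x \<in> ?Y}"
  have W: "open W" using continuous_open_preimage[OF cG U Y] by (simp add: W_def vimage_def Int_def)
  have XW: "X = sphere 0 \<epsilon> \<inter> W" by (simp add: X_def W_def)
  have GX: "G ` X \<subseteq> ?Y" by (auto simp: X_def)
  have TY: "tangent_space ?Y (G x) = UNIV" if "x \<in> X" for x
    using GX that by (intro tangent_space_open[OF Y]) blast
  show ?thesis
  proof
    assume sub: "smooth_submersion X ?Y G"
    show "Milnor_set U G \<inter> X = {}"
    proof (rule ccontr)
      assume "Milnor_set U G \<inter> X \<noteq> {}"
      then obtain x where x: "x \<in> Milnor_set U G" "x \<in> X" by blast
      have xU: "x \<in> U" and nx: "norm x = \<epsilon>" using x(2) by (auto simp: X_def)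
      let ?D = "frechet_derivative G (at x)"
      have D: "(G has_derivative ?D) (at x)" using dG[OF xU] by (simp add: frechet_derivative_works[symmetric])
      obtain a b where ab: "a \<noteq> 0 \<or> b \<noteq> 0" and eq: "\<And>v. 2 * a * (x \<bullet> v) + b \<bullet> ?D v = 0"
        using x(1) Milnor_set_iff[OF dG[OF xU], of U] by blast
      obtain V g where V: "open V" "x \<in> V" and g: "smooth_on V g" "\<And>y. y \<in> X \<inter> V \<Longrightarrow> g y = G y"
        and im: "frechet_derivative g (at x) ` tangent_space X x = UNIV"
        using sub x(2) TY unfolding smooth_submersion_def by metis
      have "Ck_on (Suc 0) V g" using g(1) unfolding smooth_on_def by blast
      then have Dg: "(g has_derivative frechet_derivative g (at x)) (at x)"
        using V(2) by (simp add: frechet_derivative_works[symmetric])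
      obtain v where v: "v \<in> tangent_space X x" "frechet_derivative g (at x) v = b" using im by (metis UNIV_I imageE)
      obtain \<delta> \<gamma> where \<delta>: "0 < \<delta>" and \<gamma>X: "\<gamma> ` {-\<delta><..<\<delta>} \<subseteq> X" and \<gamma>0: "\<gamma> 0 = x"
        and \<gamma>': "(\<gamma> has_vector_derivative v) (at (0::real))"
        using v(1) unfolding tangent_space_def by blast
      have \<gamma>d: "(\<gamma> has_derivative (\<lambda>h. h *\<^sub>R v)) (at 0)" using \<gamma>' by (simp add: has_vector_derivative_def)
      have "isCont \<gamma> 0" using \<gamma>d by (rule has_derivative_continuous)
      then have "(\<gamma> \<longlongrightarrow> x) (nhds 0)" using \<gamma>0 by (metis isCont_def tendsto_at_iff_tendsto_nhds)
      then have "eventually (\<lambda>s. \<gamma> s \<in> V) (nhds 0)" using V by (rule topological_tendstoD)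
      moreover have "eventually (\<lambda>s. s \<in> {-\<delta><..<\<delta>}) (nhds (0::real))"
        using \<delta> by (intro eventually_nhds_in_open) auto
      ultimately have ev: "eventually (\<lambda>s. \<gamma> s \<in> X \<inter> V) (nhds 0)"
        by eventually_elim (use \<gamma>X in auto)
      \<comment> \<open>The local extension \<open>g\<close> is known to agree with \<open>G\<close>
        on \<open>X\<close> only, so the two differentials are compared on velocities of curves in
        \<open>X\<close>.\<close>
      have 1: "((\<lambda>s. g (\<gamma> s)) has_derivative (\<lambda>h. frechet_derivative g (at x) (h *\<^sub>R v))) (at 0)"
        using has_derivative_compose[OF \<gamma>d, of g] Dg \<gamma>0 by simp
      have 2: "((\<lambda>s. G (\<gamma> s)) has_derivative (\<lambda>h. ?D (h *\<^sub>R v))) (at 0)"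
        using has_derivative_compose[OF \<gamma>d, of G] D \<gamma>0 by simp
      have "eventually (\<lambda>s. g (\<gamma> s) = G (\<gamma> s)) (nhds 0)"
        using ev by eventually_elim (use g(2) in auto)
      with 1 have "((\<lambda>s. G (\<gamma> s)) has_derivative (\<lambda>h. frechet_derivative g (at x) (h *\<^sub>R v))) (at 0)"
        by (rule has_derivative_cong_nhds)
      from has_derivative_unique[OF this 2] have "frechet_derivative g (at x) (1 *\<^sub>R v) = ?D (1 *\<^sub>R v)" by (rule fun_cong)
      then have Dv: "?D v = b" using v(2) by simp
      have 3: "((\<lambda>s. \<gamma> s \<bullet> \<gamma> s) has_derivative (\<lambda>h. 2 * (x \<bullet> (h *\<^sub>R v)))) (at 0)"
        using has_derivative_inner[OF \<gamma>d \<gamma>d] \<gamma>0 by (simp add: inner_commute)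
      have "eventually (\<lambda>s. \<gamma> s \<bullet> \<gamma> s = \<epsilon>\<^sup>2) (nhds 0)"
        using ev by eventually_elim (auto simp: X_def dot_square_norm)
      with 3 have "((\<lambda>s. \<epsilon>\<^sup>2) has_derivative (\<lambda>h. 2 * (x \<bullet> (h *\<^sub>R v)))) (at (0::real))"
        by (rule has_derivative_cong_nhds)
      from has_derivative_unique[OF this has_derivative_const] have "2 * (x \<bullet> (1 *\<^sub>R v)) = 0" by (rule fun_cong)
      then have "x \<bullet> v = 0" by simp
      then have "b \<bullet> b = 0" using eq[of v] Dv by simp
      then have "b = 0" by simp
      then have "a \<noteq> 0" using ab by simp
      moreover have "2 * a * (x \<bullet> x) = 0" using eq[of x] \<open>b = 0\<close> by simp
      ultimately have "x = 0" by simp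
      then show False using nx \<epsilon> by simp
    qed
  next
    assume emp: "Milnor_set U G \<inter> X = {}"
    have "frechet_derivative G (at x) ` tangent_space X x = UNIV" if x: "x \<in> X" for x
    proof -
      have xU: "x \<in> U" and xW: "x \<in> W" and nx: "norm x = \<epsilon>" using x by (auto simp: XW W_def)
      let ?D = "frechet_derivative G (at x)" and ?S = "{v. x \<bullet> v = 0}"
      interpret D: linear ?D using dG[OF xU] by (rule linear_frechet_derivative)
      have "?D ` ?S = UNIV"
      proof (rule ccontr)
        assume ne: "?D ` ?S \<noteq> UNIV"
        have "subspace ?S" by (auto simp: subspace_def inner_add_right)
        then have "subspace (?D ` ?S)" by (rule linear_subspace_image[OF D.linear_axioms])
        then have sp: "span (?D ` ?S) = ?D ` ?S" by (rule span_eq_iff[THEN iffD2])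
        have "span (?D ` ?S) \<noteq> UNIV" using ne unfolding sp .
        then obtain b where "b \<noteq> 0" "span (?D ` ?S) \<subseteq> {w. b \<bullet> w = 0}"
          using span_not_univ_subset_hyperplane by blast
        then have b: "b \<noteq> 0" "\<And>w. w \<in> ?D ` ?S \<Longrightarrow> b \<bullet> w = 0" using span_base[of _ "?D ` ?S"] by blast+
        have xx: "x \<bullet> x \<noteq> 0" using nx \<epsilon> by auto
        \<comment> \<open>Determined by the relation at \<open>v = x\<close>; on vectors orthogonal
          to \<open>x\<close> the relation holds by the choice of \<open>b\<close>.\<close>
        define a where "a = - (b \<bullet> ?D x) / (2 * (x \<bullet> x))"
        have "2 * a * (x \<bullet> v) + b \<bullet> ?D v = 0" for v
        proof -
          let ?u = "v - ((x \<bullet> v) / (x \<bullet> x)) *\<^sub>R x"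
          have "x \<bullet> ?u = 0" using xx by (simp add: inner_diff_right)
          then have "b \<bullet> ?D ?u = 0" using b(2) by blast
          then have "b \<bullet> ?D v = (x \<bullet> v) / (x \<bullet> x) * (b \<bullet> ?D x)"
            by (simp add: D.diff D.scale inner_diff_right)
          then show ?thesis using xx by (simp add: a_def)
        qed
        then have "x \<in> Milnor_set U G" using Milnor_set_iff[OF dG[OF xU], of U] xU b(1) by blast
        then show False using emp x by blast
      qed
      moreover have "?S \<subseteq> tangent_space X x"
        unfolding XW using tangent_space_sphere[OF W xW nx \<epsilon>] by blast
      ultimately show ?thesis by blast
    qed
    then show "smooth_submersion X ?Y G"
      unfolding smooth_submersion_def using GX U sm TY
      by (intro conjI ballI exI[of _ U] exI[of _ G]) (auto simp: X_def)
  qed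
qed

section \<open>The power bound on the Milnor set\<close>

lemma norm_le_card_mult:
  fixes y :: "real^'m"
  assumes "\<And>j. \<bar>y $ j\<bar> \<le> s"
  shows "norm y \<le> real CARD('m) * s"
proof -
  have "norm y \<le> (\<Sum>j\<in>UNIV. \<bar>y $ j\<bar>)" by (rule norm_le_l1_cart)
  also have "\<dots> \<le> (\<Sum>j\<in>(UNIV :: 'm set). s)" by (intro sum_mono assms)
  finally show ?thesis by simp
qed

text \<open>\<open>\<iota>\<close> places the coordinates of the point among a larger set of
  variables. The whole cube of radius \<open>s\<close> lies in the ball of convergence, and the
  absolute values of the terms at its corner provide the majorant.\<close>

lemma pser_pseries_at:
  fixes \<iota> :: "'m::finite \<Rightarrow> 'i"
  assumes f: "pseries_at f 0 r c" and r: "0 < r" and s: "s = r / (2 * real CARD('m))"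
    and \<iota>: "\<And>j. \<iota> j \<in> T" "\<And>j. \<rho> (\<iota> j) = s"
  shows "\<exists>B. pser T \<rho> (\<lambda>x. f (\<chi> j. x (\<iota> j))) B"
proof -
  define e :: "nat \<Rightarrow> 'm \<Rightarrow> nat" where "e = from_nat_into UNIV"
  have e: "bij_betw e UNIV UNIV" unfolding e_def by (rule multiindex_enumeration)
  define B where "B = (\<lambda>n. s ^ sum (e n) UNIV * \<bar>c (e n)\<bar>)"
  have "(\<lambda>\<alpha>. \<bar>c \<alpha>\<bar> * s ^ sum \<alpha> UNIV) summable_on UNIV" using f r s by (rule pseries_at_summable)
  then have "(\<lambda>n. \<bar>c (e n)\<bar> * s ^ sum (e n) UNIV) summable_on UNIV"
    by (rule summable_on_reindex_bij_betw[OF e, THEN iffD2])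
  then have "B summable_on UNIV" by (simp add: B_def mult.commute)
  then have sB: "summable B" by (auto simp: summable_on_def sums_iff dest!: has_sum_imp_sums)
  have pm: "pser T \<rho> (\<lambda>x. \<Prod>j\<in>S. x (\<iota> j) ^ \<alpha> j) (\<Prod>j\<in>S. s ^ \<alpha> j)" for S and \<alpha> :: "'m \<Rightarrow> nat"
  proof (induction S rule: infinite_finite_induct)
    case (insert j S)
    have "pser T \<rho> (\<lambda>x. x (\<iota> j) ^ \<alpha> j) (s ^ \<alpha> j)" using pser_power[OF pser.coord[OF \<iota>(1), of \<rho>]] \<iota>(2) by simp
    then show ?case using insert pser.mult by simp
  qed (auto intro: pser.const)
  have pn: "pser T \<rho> (\<lambda>x. (\<Prod>j\<in>UNIV. x (\<iota> j) ^ e n j) * c (e n)) (B n)" for n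
    unfolding B_def power_sum by (intro pser.mult pm pser.const order_refl)
  have "pser T \<rho> (\<lambda>x. f (\<chi> j. x (\<iota> j))) (suminf B)"
  proof (rule pser.series[OF pn sB])
    fix x assume x: "x \<in> polybox T \<rho>"
    let ?y = "\<chi> j. x (\<iota> j)"
    have "\<bar>x (\<iota> j)\<bar> \<le> s" for j using x \<iota> unfolding polybox_def by (metis (mono_tags) mem_Collect_eq)
    then have "norm ?y \<le> real CARD('m) * s" by (intro norm_le_card_mult) simp
    also have "\<dots> < r" using r by (simp add: s)
    finally have "?y \<in> ball 0 r" by simp
    then have "((\<lambda>\<alpha>. (\<Prod>j\<in>UNIV. x (\<iota> j) ^ \<alpha> j) * c \<alpha>) has_sum f ?y) UNIV"
      using f unfolding pseries_at_def by fastforce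
    then have "((\<lambda>n. (\<Prod>j\<in>UNIV. x (\<iota> j) ^ e n j) * c (e n)) has_sum f ?y) UNIV"
      by (rule has_sum_reindex_bij_betw[OF e, THEN iffD2])
    then show "(\<lambda>n. (\<Prod>j\<in>UNIV. x (\<iota> j) ^ e n j) * c (e n)) sums f ?y" by (rule has_sum_imp_sums)
  qed
  then show ?thesis by blast
qed

text \<open>\<open>Radius\<close> and \<open>Level\<close> are the parameters \<open>t\<close> and
  \<open>c\<close> of the transfer. The other constructors are the variables to be eliminated: the
  point and the coefficients of a dependence relation at it.\<close>

datatype ('m, 'p) milnor_var = Radius | Level | Point 'm | Rho_coeff | Map_coeff 'p

lemma Milnor_set_components:
  "y \<in> Milnor_set U G \<longleftrightarrow> y \<in> U \<and> (\<exists>a b. (a \<noteq> 0 \<or> (\<exists>i. b i \<noteq> 0)) \<and>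
    (\<forall>j. 2 * a * y $ j + (\<Sum>i\<in>UNIV. b i * frechet_derivative (\<lambda>y. G y $ i) (at y) (axis j 1)) = 0))"
  unfolding Milnor_set_def gradient_norm_sq by (simp add: vec_eq_iff gradient_def mult_ac)

text \<open>The coefficients of a linear dependence relation among the gradients can be taken arbitrarily
  small, so that the Milnor set is the projection of the zero set of power series around the origin.\<close>

lemma Milnor_set_level_lower_bound:
  fixes G :: "real^'m \<Rightarrow> real^'p"
  assumes U: "open U" "0 \<in> U" and an: "real_analytic_on U G" and \<epsilon>0: "0 < \<epsilon>0"
    and slice: "\<And>\<epsilon>. 0 < \<epsilon> \<Longrightarrow> \<epsilon> < \<epsilon>0 \<Longrightarrow> \<exists>\<eta>>0. \<forall>x\<in>Milnor_set U G. norm x = \<epsilon> \<longrightarrow> G x \<noteq> 0 \<longrightarrow> \<eta> \<le> norm (G x)"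
  shows "\<exists>K. \<exists>\<delta>>0. \<forall>x\<in>Milnor_set U G. 0 < norm x \<longrightarrow> norm x < \<delta> \<longrightarrow> G x \<noteq> 0 \<longrightarrow> norm x ^ K \<le> (norm (G x))\<^sup>2"
proof -
  let ?V = "UNIV :: ('m, 'p) milnor_var set"
  define D where "D i j y = frechet_derivative (\<lambda>y. G y $ i) (at y) (axis j 1)" for i j y
  have aG: "analytic_fun U (\<lambda>y. G y $ i)" for i using an by (rule real_analytic_on_component)
  then have aD: "analytic_fun U (D i j)" for i j unfolding D_def by (rule analytic_fun_derivative(2))
  define PG where "PG i r \<longleftrightarrow> 0 < r \<and> (\<exists>c. pseries_at (\<lambda>y. G y $ i) 0 r c)" for i r
  have "\<exists>r. PG i r" for i using aG U(2) unfolding analytic_fun_def PG_def by blast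
  then obtain rG where rG: "\<And>i. PG i (rG i)" by metis
  define PD where "PD i j r \<longleftrightarrow> 0 < r \<and> (\<exists>c. pseries_at (D i j) 0 r c)" for i j r
  have "\<exists>r. PD i j r" for i j using aD U(2) unfolding analytic_fun_def PD_def by blast
  then obtain rD where rD: "\<And>i j. PD i j (rD i j)" by metis
  obtain d where d: "0 < d" "ball 0 d \<subseteq> U" using U by (meson open_contains_ball)
  define r where "r = Min (insert d (range rG \<union> range (\<lambda>(i, j). rD i j)))"
  have r: "0 < r" "r \<le> d" using d rG rD by (auto simp: r_def PG_def PD_def)
  have "r \<le> rG i" for i unfolding r_def by (intro Min_le) auto
  then have sG: "\<exists>c. pseries_at (\<lambda>y. G y $ i) 0 r c" for i using rG pseries_at_subset unfolding PG_def by blast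
  have "r \<le> rD i j" for i j unfolding r_def by (intro Min_le) force+
  then have sD: "\<exists>c. pseries_at (D i j) 0 r c" for i j using rD pseries_at_subset unfolding PD_def by blast
  define s where "s = r / (2 * real CARD('m))"
  have s: "0 < s" using r by (simp add: s_def)
  define A where "A = {f. \<exists>B. pser ?V (\<lambda>_. s) f B}"
  have A: "function_ring A" unfolding A_def by (rule function_ring_pser)
  note A_add = function_ringD(2)[OF A] and A_mult = function_ringD(3)[OF A]
    and A_diff = function_ringD(4)[OF A] and A_const = function_ringD(1)[OF A]
  have A_coord: "(\<lambda>x. x i) \<in> A" for i unfolding A_def using pser.coord[of i ?V "\<lambda>_. s"] by blast
  have A_sum: "(\<lambda>x. \<Sum>i\<in>S. f i x) \<in> A" if "\<And>i. f i \<in> A" for S :: "'b set" and f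
    by (induction S rule: infinite_finite_induct) (simp_all add: A_const A_add that)
  have A_sum': "(\<lambda>x. \<Sum>i\<in>S. f i x) \<in> A" if "\<And>i. f i \<in> A" for S :: "'c set" and f
    by (induction S rule: infinite_finite_induct) (simp_all add: A_const A_add that)
  define X :: "(('m, 'p) milnor_var \<Rightarrow> real) \<Rightarrow> real^'m" where "X x = (\<chi> j. x (Point j))" for x
  have A_X: "(\<lambda>x. f (X x)) \<in> A" if f: "\<exists>c. pseries_at f 0 r c" for f
  proof -
    obtain c where "pseries_at f 0 r c" using f by blast
    from pser_pseries_at[OF this r(1) s_def, of Point ?V "\<lambda>_. s"] show ?thesis by (simp add: A_def X_def)
  qed
  have A_G: "(\<lambda>x. G (X x) $ i) \<in> A" and A_D: "(\<lambda>x. D i j (X x)) \<in> A" for i j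
    using A_X[OF sG] A_X[OF sD] by blast+
  \<comment> \<open>The system will be \<open>q0 = 0\<close> for a point on the sphere of radius
    \<open>Radius\<close>, \<open>qm j = 0\<close> for all \<open>j\<close> and
    \<open>qn > 0\<close> for a nontrivial relation, \<open>qg > 0\<close> off the zero locus, and
    \<open>qc < 0\<close> below the level. Squared norms keep all of these power series.\<close>
  define q0 where "q0 x = (\<Sum>j\<in>UNIV. x (Point j) * x (Point j)) - x Radius * x Radius" for x :: "('m, 'p) milnor_var \<Rightarrow> real"
  define qm where "qm j x = 2 * x Rho_coeff * x (Point j) + (\<Sum>i\<in>UNIV. x (Map_coeff i) * D i j (X x))" for j and x :: "('m, 'p) milnor_var \<Rightarrow> real"
  define qn where "qn x = x Rho_coeff * x Rho_coeff + (\<Sum>i\<in>UNIV. x (Map_coeff i) * x (Map_coeff i))" for x :: "('m, 'p) milnor_var \<Rightarrow> real"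
  define qg where "qg x = (\<Sum>i\<in>UNIV. G (X x) $ i * G (X x) $ i)" for x :: "('m, 'p) milnor_var \<Rightarrow> real"
  define qc where "qc x = qg x - x Level" for x :: "('m, 'p) milnor_var \<Rightarrow> real"
  define F where "F = {q0, qn, qg, qc} \<union> range qm"
  have q0: "q0 x = (norm (X x))\<^sup>2 - (x Radius)\<^sup>2" for x
    unfolding q0_def X_def power2_norm_eq_inner inner_vec_def by (simp add: power2_eq_square)
  have qg: "qg x = (norm (G (X x)))\<^sup>2" for x by (simp add: qg_def power2_norm_eq_inner inner_vec_def)
  have "F \<subseteq> A"
  proof -
    have "q0 \<in> A" unfolding q0_def by (intro A_diff A_sum A_mult A_coord)
    moreover have "qn \<in> A" unfolding qn_def by (intro A_add A_sum' A_mult A_coord)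
    moreover have qgA: "qg \<in> A" unfolding qg_def by (intro A_sum' A_mult A_G)
    moreover have "qc \<in> A" unfolding qc_def by (intro A_diff qgA A_coord)
    moreover have "qm j \<in> A" for j unfolding qm_def by (intro A_add A_sum' A_mult A_coord A_const A_D)
    ultimately show ?thesis by (auto simp: F_def)
  qed
  define J where "J = range Point \<union> {Rho_coeff} \<union> range (Map_coeff :: 'p \<Rightarrow> ('m, 'p) milnor_var)"
  have I: "insert Level (insert Radius J) = ?V"
  proof -
    have "v \<in> insert Level (insert Radius J)" for v by (cases v) (auto simp: J_def)
    then show ?thesis by blast
  qed
  have "sign_transfer Radius Level J (\<lambda>_. s) F"
  proof (rule sign_transfer_pser)
    show "\<forall>f\<in>F. \<exists>B. pser (insert Level (insert Radius J)) (\<lambda>_. s) f B" using \<open>F \<subseteq> A\<close> unfolding I A_def by blast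
  qed (use s in \<open>auto simp: J_def F_def\<close>)
  then obtain Y K \<delta> where \<delta>: "0 < \<delta>" "\<delta> \<le> 1" and Y: "Y \<subseteq> polybox ?V (\<lambda>_. s)"
    and inY: "\<And>x. x \<in> polybox ?V (\<lambda>_. \<delta>) \<Longrightarrow> 0 < x Radius \<Longrightarrow> 0 < x Level \<Longrightarrow> x Level < x Radius ^ K \<Longrightarrow> x \<in> Y"
    and trans: "\<And>x \<tau> \<gamma>. x \<in> Y \<Longrightarrow> 0 < \<tau> \<Longrightarrow> \<tau> < \<delta> \<Longrightarrow> 0 < \<gamma> \<Longrightarrow> \<gamma> < \<tau> ^ K \<Longrightarrow>
      \<exists>x'\<in>Y. x' Radius = \<tau> \<and> x' Level = \<gamma> \<and> same_signs F x x'"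
    by (rule sign_transferE[of Radius Level J "\<lambda>_. s" F, unfolded I]) (rule that)
  have XU: "X x \<in> U" if "x \<in> Y" for x
  proof -
    have "\<bar>X x $ j\<bar> \<le> s" for j using that Y by (auto simp: X_def polybox_def)
    then have "norm (X x) \<le> real CARD('m) * s" by (rule norm_le_card_mult)
    also have "\<dots> < r" using r by (simp add: s_def)
    finally show ?thesis using r d by auto
  qed
  have no: False if x: "x \<in> Y" and sx: "q0 x = 0" "\<And>j. qm j x = 0" "0 < qn x" "0 < qg x" "qc x < 0" for x
  proof -
    \<comment> \<open>One radius suffices, below the bounds of both the transfer and the hypothesis.
      The level \<gamma> is then put below the square of the bound on this sphere, which the
      transferred solution contradicts.\<close>
    define \<tau> where "\<tau> = min \<delta> \<epsilon>0 / 2"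
    have \<tau>: "0 < \<tau>" "\<tau> < \<delta>" "\<tau> < \<epsilon>0" using \<delta> \<epsilon>0 by (auto simp: \<tau>_def)
    obtain \<eta> where \<eta>: "0 < \<eta>" "\<And>x. x \<in> Milnor_set U G \<Longrightarrow> norm x = \<tau> \<Longrightarrow> G x \<noteq> 0 \<Longrightarrow> \<eta> \<le> norm (G x)"
      using slice[OF \<tau>(1,3)] by blast
    define \<gamma> where "\<gamma> = min (\<tau> ^ K) (\<eta>\<^sup>2) / 2"
    have "0 < min (\<tau> ^ K) (\<eta>\<^sup>2)" using \<tau> \<eta>(1) by simp
    then have "0 < \<gamma>" "\<gamma> < min (\<tau> ^ K) (\<eta>\<^sup>2)" unfolding \<gamma>_def by linarith+
    then have \<gamma>: "0 < \<gamma>" "\<gamma> < \<tau> ^ K" "\<gamma> < \<eta>\<^sup>2" by simp_all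
    obtain x' where x': "x' \<in> Y" "x' Radius = \<tau>" "x' Level = \<gamma>" and ss: "same_signs F x x'"
      using trans[OF x \<tau>(1,2) \<gamma>(1,2)] by blast
    have sg: "sgn (f x) = sgn (f x')" if "f \<in> F" for f using ss that by (rule same_signsD)
    have s0: "q0 x' = 0" using sg[of q0] sx(1) by (simp add: F_def sgn_0_0)
    have sm: "qm j x' = 0" for j using sg[of "qm j"] sx(2) by (simp add: F_def sgn_0_0)
    have sn: "0 < qn x'" using sg[of qn] sx(3) by (simp add: F_def sgn_1_pos)
    have sgg: "0 < qg x'" using sg[of qg] sx(4) by (simp add: F_def sgn_1_pos)
    have "sgn (qc x) = sgn (qc x')" by (rule sg) (simp add: F_def)
    then have sc: "qc x' < 0" using sx(5) by (simp add: sgn_if split: if_splits)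
    have "(norm (X x'))\<^sup>2 = \<tau>\<^sup>2" using s0 x'(2) by (simp add: q0)
    then have 1: "norm (X x') = \<tau>" using \<tau>(1) by (simp add: power2_eq_iff_nonneg)
    have "x' Rho_coeff \<noteq> 0 \<or> (\<exists>i. x' (Map_coeff i) \<noteq> 0)"
    proof (rule ccontr)
      assume "\<not> ?thesis"
      then have "qn x' = 0" by (simp add: qn_def)
      then show False using sn by simp
    qed
    then have 2: "X x' \<in> Milnor_set U G"
      unfolding Milnor_set_components using XU[OF x'(1)] sm unfolding qm_def D_def
      by (intro conjI exI[of _ "x' Rho_coeff"] exI[of _ "\<lambda>i. x' (Map_coeff i)"]) (auto simp: X_def)
    have 3: "G (X x') \<noteq> 0" using sgg by (auto simp: qg)
    have "(norm (G (X x')))\<^sup>2 < \<eta>\<^sup>2" using sc x'(3) \<gamma>(3) by (simp add: qc_def qg)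
    then have "norm (G (X x')) < \<eta>" using \<eta>(1) by (simp add: power2_less_imp_less)
    then show False using \<eta>(2)[OF 2 1 3] by simp
  qed
  \<comment> \<open>The additional power of the norm forces \<gamma> below \<open>norm x\<close>,
    hence below \<delta>, also when \<open>K = 0\<close>: the level has to lie in the \<delta>-box
    as well.\<close>
  have "norm x ^ Suc K \<le> (norm (G x))\<^sup>2" if x: "x \<in> Milnor_set U G" "0 < norm x" "norm x < \<delta>" "G x \<noteq> 0" for x
  proof (rule ccontr)
    assume "\<not> norm x ^ Suc K \<le> (norm (G x))\<^sup>2"
    then obtain \<gamma> where \<gamma>: "(norm (G x))\<^sup>2 < \<gamma>" "\<gamma> < norm x ^ Suc K" using dense by (metis not_le)
    have x1: "norm x \<le> 1" using x(3) \<delta>(2) by simp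
    have "norm x ^ Suc K \<le> norm x ^ K" "norm x ^ Suc K \<le> norm x ^ 1"
      using x(2) x1 by (intro power_decreasing; simp)+
    then have \<gamma>': "0 < \<gamma>" "\<gamma> < norm x ^ K" "\<gamma> \<le> \<delta>"
      using \<gamma> x(3) by (auto intro: le_less_trans[OF zero_le_power2])
    obtain a b where ab: "a \<noteq> 0 \<or> (\<exists>i. b i \<noteq> 0)" and eq: "\<And>j. 2 * a * x $ j + (\<Sum>i\<in>UNIV. b i * D i j x) = 0"
      using x(1) unfolding Milnor_set_components D_def by blast
    define \<mu> where "\<mu> = \<delta> / (1 + \<bar>a\<bar> + (\<Sum>i\<in>UNIV. \<bar>b i\<bar>))"
    have S0: "0 \<le> (\<Sum>i\<in>UNIV. \<bar>b i\<bar>)" by (intro sum_nonneg) auto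
    have den: "0 < 1 + \<bar>a\<bar> + (\<Sum>i\<in>UNIV. \<bar>b i\<bar>)" using S0 by linarith
    have \<mu>: "0 < \<mu>" unfolding \<mu>_def by (rule divide_pos_pos[OF \<delta>(1) den])
    have \<mu>1: "\<mu> * \<bar>u\<bar> \<le> \<delta>" if "\<bar>u\<bar> \<le> 1 + \<bar>a\<bar> + (\<Sum>i\<in>UNIV. \<bar>b i\<bar>)" for u
    proof -
      have "\<mu> * \<bar>u\<bar> \<le> \<mu> * (1 + \<bar>a\<bar> + (\<Sum>i\<in>UNIV. \<bar>b i\<bar>))" using that \<mu> by (intro mult_left_mono) auto
      also have "\<dots> = \<delta>" using den unfolding \<mu>_def by simp
      finally show ?thesis .
    qed
    define p :: "('m, 'p) milnor_var \<Rightarrow> real" where "p v = (case v of Radius \<Rightarrow> norm x | Level \<Rightarrow> \<gamma> | Point j \<Rightarrow> x $ j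
        | Rho_coeff \<Rightarrow> \<mu> * a | Map_coeff i \<Rightarrow> \<mu> * b i)" for v
    have Xp: "X p = x" by (simp add: X_def p_def vec_eq_iff)
    have "\<bar>p v\<bar> \<le> \<delta>" for v
    proof (cases v)
      case (Point j)
      then show ?thesis using component_le_norm_cart[of x j] x(3) by (simp add: p_def)
    next
      case Rho_coeff
      then show ?thesis using \<mu>1[of a] \<mu> S0 by (simp add: p_def abs_mult)
    next
      case (Map_coeff i)
      have "\<bar>b i\<bar> \<le> (\<Sum>i\<in>UNIV. \<bar>b i\<bar>)" by (rule member_le_sum) auto
      then show ?thesis using \<mu>1[of "b i"] \<mu> Map_coeff by (simp add: p_def abs_mult)
    qed (use x(3) \<gamma>' in \<open>auto simp: p_def\<close>)
    then have "p \<in> Y" using x(2) \<gamma>' by (intro inY) (auto simp: polybox_def p_def)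
    moreover have "q0 p = 0" by (simp add: q0 Xp) (simp add: p_def)
    moreover have "qm j p = 0" for j
    proof -
      have "qm j p = \<mu> * (2 * a * x $ j + (\<Sum>i\<in>UNIV. b i * D i j x))"
        unfolding qm_def Xp by (simp add: p_def distrib_left sum_distrib_left mult_ac)
      then show ?thesis using eq[of j] by simp
    qed
    moreover have "0 < qn p"
    proof -
      have "0 \<le> qn p" unfolding qn_def by (intro add_nonneg_nonneg sum_nonneg) auto
      moreover have "qn p \<noteq> 0"
      proof
        assume z: "qn p = 0"
        have s1: "0 \<le> (\<Sum>i\<in>UNIV. p (Map_coeff i) * p (Map_coeff i))" by (intro sum_nonneg) auto
        have s2: "0 \<le> p Rho_coeff * p Rho_coeff" by simp
        have "p Rho_coeff * p Rho_coeff = 0" "(\<Sum>i\<in>UNIV. p (Map_coeff i) * p (Map_coeff i)) = 0"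
          using z s1 s2 unfolding qn_def by linarith+
        then have "p Rho_coeff = 0" "\<And>i. p (Map_coeff i) = 0"
          by (simp_all add: sum_nonneg_eq_0_iff)
        then show False using ab \<mu> by (auto simp: p_def)
      qed
      ultimately show ?thesis by simp
    qed
    moreover have "0 < qg p" using x(4) by (simp add: qg Xp)
    moreover have "qc p < 0" using \<gamma>(1) by (simp add: qc_def qg Xp) (simp add: p_def)
    ultimately show False using no by blast
  qed
  then show ?thesis using \<delta>(1) by blast
qed

section \<open>Equivalence of condition (b) and submersivity on small spheres\<close>

theorem lemma6p10:
  fixes G :: "real^'m \<Rightarrow> real^'p" and U :: "(real^'m) set"
  assumes "2 \<le> CARD('p)" and "CARD('p) \<le> CARD('m)"
    and "open U" and "0 \<in> U"
    and "real_analytic_on U G" and "G 0 = 0"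
    and "nonconstant_germ G"
    and "isolated_critical_value U G"
  shows "Milnor_condition_b U G \<longleftrightarrow>
    (\<exists>\<epsilon>\<^sub>0>0. \<forall>\<epsilon>. 0 < \<epsilon> \<and> \<epsilon> < \<epsilon>\<^sub>0 \<longrightarrow>
       (\<exists>\<eta>. 0 < \<eta> \<and> \<eta> < \<epsilon> \<and>
          smooth_submersion (sphere 0 \<epsilon> \<inter> {x \<in> U. G x \<in> ball 0 \<eta> - {0}}) (ball 0 \<eta> - {0}) G))"
proof -
  let ?M = "Milnor_set U G"
  have MU: "?M \<subseteq> U" by (auto simp: Milnor_set_def)
  have cG: "continuous_on U G"
    using Ck_on_analytic[OF \<open>open U\<close> real_analytic_on_component[OF \<open>real_analytic_on U G\<close>], of 0] by simp
  obtain d where d: "0 < d" "ball 0 d \<subseteq> U" using \<open>open U\<close> \<open>0 \<in> U\<close> by (meson open_contains_ball)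
  have sub: "smooth_submersion (sphere 0 \<epsilon> \<inter> {x \<in> U. G x \<in> ball 0 \<eta> - {0}}) (ball 0 \<eta> - {0}) G \<longleftrightarrow>
      (\<forall>x\<in>?M. norm x = \<epsilon> \<longrightarrow> G x \<noteq> 0 \<longrightarrow> \<eta> \<le> norm (G x))" if "0 < \<epsilon>" for \<epsilon> \<eta>
    unfolding smooth_submersion_slice_iff[OF \<open>open U\<close> \<open>real_analytic_on U G\<close> that]
    using MU by (auto simp: not_less[symmetric])
  show ?thesis
  proof
    assume "Milnor_condition_b U G"
    then have "eventually (\<lambda>x. x \<in> closure (?M - zero_locus U G) \<inter> zero_locus U G \<longrightarrow> x = 0) (nhds 0)"
      by (simp add: Milnor_condition_b_def germ_subset_def)
    then obtain e where e: "0 < e" "\<And>x. norm x < e \<Longrightarrow> x \<in> closure (?M - zero_locus U G) \<Longrightarrow> x \<in> zero_locus U G \<Longrightarrow> x = 0"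
      unfolding eventually_nhds_metric by (auto simp: dist_norm)
    have "\<exists>\<eta>. 0 < \<eta> \<and> \<eta> < \<epsilon> \<and> (\<forall>x\<in>?M. norm x = \<epsilon> \<longrightarrow> G x \<noteq> 0 \<longrightarrow> \<eta> \<le> norm (G x))"
      if \<epsilon>: "0 < \<epsilon>" "\<epsilon> < min d e" for \<epsilon>
    proof -
      \<comment> \<open>Under (b) this compact set misses the zero locus: a zero of \<open>G\<close>
        in the closure, at so small a distance, would be the origin. So \<open>norm (G x)\<close>
        has a positive minimum on it unless it is empty.\<close>
      define C where "C = closure (?M - zero_locus U G) \<inter> sphere 0 \<epsilon>"
      have CU: "C \<subseteq> U" using d \<epsilon> by (auto simp: C_def)
      have nz: "G x \<noteq> 0" if "x \<in> C" for x
        using e(2)[of x] that \<epsilon> CU by (auto simp: C_def zero_locus_def)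
      have "compact C" unfolding C_def by (intro closed_Int_compact) auto
      moreover have "continuous_on C (\<lambda>x. norm (G x))"
        using cG CU by (intro continuous_on_norm) (rule continuous_on_subset)
      ultimately obtain \<eta> where \<eta>: "0 < \<eta>" "\<And>x. x \<in> C \<Longrightarrow> \<eta> \<le> norm (G x)"
      proof (cases "C = {}")
        case True
        then show ?thesis using that[of 1] by simp
      next
        case False
        then obtain x0 where "x0 \<in> C" "\<And>x. x \<in> C \<Longrightarrow> norm (G x0) \<le> norm (G x)"
          using continuous_attains_inf[OF \<open>compact C\<close> False \<open>continuous_on C _\<close>] by blast
        then show ?thesis using that[of "norm (G x0)"] nz by simp
      qed
      have "x \<in> C" if "x \<in> ?M" "norm x = \<epsilon>" "G x \<noteq> 0" for x
        using that closure_subset[of "?M - zero_locus U G"] by (auto simp: C_def zero_locus_def)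
      then have "\<forall>x\<in>?M. norm x = \<epsilon> \<longrightarrow> G x \<noteq> 0 \<longrightarrow> min \<eta> (\<epsilon> / 2) \<le> norm (G x)"
        using \<eta>(2) by (meson min.coboundedI1)
      then show ?thesis using \<eta>(1) \<epsilon> by (intro exI[of _ "min \<eta> (\<epsilon> / 2)"]) auto
    qed
    note main = this
    show "\<exists>\<epsilon>\<^sub>0>0. \<forall>\<epsilon>. 0 < \<epsilon> \<and> \<epsilon> < \<epsilon>\<^sub>0 \<longrightarrow> (\<exists>\<eta>. 0 < \<eta> \<and> \<eta> < \<epsilon> \<and>
          smooth_submersion (sphere 0 \<epsilon> \<inter> {x \<in> U. G x \<in> ball 0 \<eta> - {0}}) (ball 0 \<eta> - {0}) G)"
    proof (rule exI[of _ "min d e"], intro conjI allI impI)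
      fix \<epsilon> assume "0 < \<epsilon> \<and> \<epsilon> < min d e"
      then obtain \<eta> where \<eta>: "0 < \<eta>" "\<eta> < \<epsilon>" "\<forall>x\<in>?M. norm x = \<epsilon> \<longrightarrow> G x \<noteq> 0 \<longrightarrow> \<eta> \<le> norm (G x)" and \<epsilon>: "0 < \<epsilon>"
        using main by meson
      have "smooth_submersion (sphere 0 \<epsilon> \<inter> {x \<in> U. G x \<in> ball 0 \<eta> - {0}}) (ball 0 \<eta> - {0}) G"
        by (rule sub[OF \<epsilon>, THEN iffD2]) (rule \<eta>(3))
      then show "\<exists>\<eta>. 0 < \<eta> \<and> \<eta> < \<epsilon> \<and>
          smooth_submersion (sphere 0 \<epsilon> \<inter> {x \<in> U. G x \<in> ball 0 \<eta> - {0}}) (ball 0 \<eta> - {0}) G"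
        using \<eta>(1,2) by blast
    qed (use d(1) e(1) in simp)
  next
    assume "\<exists>\<epsilon>\<^sub>0>0. \<forall>\<epsilon>. 0 < \<epsilon> \<and> \<epsilon> < \<epsilon>\<^sub>0 \<longrightarrow> (\<exists>\<eta>. 0 < \<eta> \<and> \<eta> < \<epsilon> \<and>
          smooth_submersion (sphere 0 \<epsilon> \<inter> {x \<in> U. G x \<in> ball 0 \<eta> - {0}}) (ball 0 \<eta> - {0}) G)"
    then obtain \<epsilon>0 where \<epsilon>0: "0 < \<epsilon>0" and sm: "\<forall>\<epsilon>. 0 < \<epsilon> \<and> \<epsilon> < \<epsilon>0 \<longrightarrow> (\<exists>\<eta>. 0 < \<eta> \<and> \<eta> < \<epsilon> \<and>
          smooth_submersion (sphere 0 \<epsilon> \<inter> {x \<in> U. G x \<in> ball 0 \<eta> - {0}}) (ball 0 \<eta> - {0}) G)"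
      by (elim exE conjE) (rule that)
    have slice: "\<exists>\<eta>>0. \<forall>x\<in>?M. norm x = \<epsilon> \<longrightarrow> G x \<noteq> 0 \<longrightarrow> \<eta> \<le> norm (G x)" if \<epsilon>: "0 < \<epsilon>" "\<epsilon> < \<epsilon>0" for \<epsilon>
    proof -
      obtain \<eta> where \<eta>: "0 < \<eta>"
        and sub\<eta>: "smooth_submersion (sphere 0 \<epsilon> \<inter> {x \<in> U. G x \<in> ball 0 \<eta> - {0}}) (ball 0 \<eta> - {0}) G"
        using sm[rule_format, OF conjI[OF \<epsilon>]] by (elim exE conjE) (rule that)
      show ?thesis using \<eta> sub[OF \<epsilon>(1), THEN iffD1, OF sub\<eta>] by (intro exI[of _ \<eta>] conjI)
    qed
    from Milnor_set_level_lower_bound[OF \<open>open U\<close> \<open>0 \<in> U\<close> \<open>real_analytic_on U G\<close> \<epsilon>0 slice]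
    obtain K \<delta> where \<delta>: "0 < \<delta>" and low: "\<And>x. x \<in> ?M \<Longrightarrow> 0 < norm x \<Longrightarrow> norm x < \<delta> \<Longrightarrow> G x \<noteq> 0 \<Longrightarrow>
        norm x ^ K \<le> (norm (G x))\<^sup>2" by blast
    have "x = 0" if x: "norm x < \<delta>" "x \<in> closure (?M - zero_locus U G)" "x \<in> zero_locus U G" for x
    proof (rule ccontr)
      assume "x \<noteq> 0"
      have xU: "x \<in> U" and Gx: "G x = 0" using x(3) by (auto simp: zero_locus_def)
      \<comment> \<open>Near a zero \<open>x\<close> of \<open>G\<close> other than the origin,
        \<open>norm y ^ K\<close> exceeds \<open>(norm (G y))\<^sup>2\<close> by continuity. Points
        of the Milnor set off the zero locus that accumulate at \<open>x\<close> would violate the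
        power bound.\<close>
      have "continuous_on U (\<lambda>y. norm y ^ K - (norm (G y))\<^sup>2)" by (intro continuous_intros cG)
      then have "open (U \<inter> (\<lambda>y. norm y ^ K - (norm (G y))\<^sup>2) -` {0<..})"
        using \<open>open U\<close> by (intro continuous_open_preimage) auto
      then have "open (U \<inter> (\<lambda>y. norm y ^ K - (norm (G y))\<^sup>2) -` {0<..} \<inter> (ball 0 \<delta> - {0}))" (is "open ?N")
        by (rule open_Int) (simp add: open_delete)
      moreover have "x \<in> ?N" using xU Gx \<open>x \<noteq> 0\<close> x(1) by simp
      ultimately obtain y where "y \<in> ?N" "y \<in> ?M - zero_locus U G"
        using x(2) by (meson closure_iff_nhds_not_empty disjoint_iff order_refl)
      then have "norm y ^ K > (norm (G y))\<^sup>2" "y \<in> ?M" "0 < norm y" "norm y < \<delta>" "G y \<noteq> 0"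
        using MU by (auto simp: zero_locus_def)
      then show False using low[of y] by simp
    qed
    then have "eventually (\<lambda>x. x \<in> closure (?M - zero_locus U G) \<inter> zero_locus U G \<longrightarrow> x \<in> {0}) (nhds 0)"
      unfolding eventually_nhds_metric using \<delta> by (intro exI[of _ \<delta>]) (auto simp: dist_norm)
    then show "Milnor_condition_b U G" by (simp add: Milnor_condition_b_def germ_subset_def)
  qed
qed

end
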